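(* Let $S$ be a Polish space and $G$ a compact group with $G\neq\{e\}$. Let $\theta:S\to G$, $\psi:G\times S\to S$ and $\psi^{-1}:G\times S\to S$ be measurable maps such that $$\psi^{-1}(g,\psi(g,s))=\psi(g,\psi^{-1}(g,s))=s,\qquad \theta(\psi(g,s))=g\cdot\theta(s),\qquad g\in G,\ s\in S.$$ Let $\mu=(\mu_k)_{k\in-\mathbf N}$ be a sequence of Borel probability measures on $S$. Consider the Tsirelson–Yor equation (TYE) $\eta_k=\psi(\theta(\eta_{k-1}),\xi_k)$, $k\in-\mathbf N$, with noise law $\mu$ and solution set $\mathcal P_\mu$, and the simple Tsirelson–Yor equation (STYE) $\hat\eta_k=\hat\eta_{k-1}\cdot\hat\xi_k$, $k\in-\mathbf N$, on $G$ with noise law $\hat\mu=(\mu_k\circ\theta^{-1})_{k\in-\mathbf N}$ and solution set $\hat{\mathcal P}_{\hat\mu}$. Then: (i) The mapping $\mathcal P_\mu\ni\mathbf P\mapsto\hat{\mathbf P}\in\hat{\mathcal P}_{\hat\mu}$ is bijective, where $\hat{\mathbf P}$ is the law on $G^{-\mathbf N}$ of $(\theta(\eta_k))_{k\in-\mathbf N}$ under $\mathbf P$. (ii) $\mathbf P\in\mathcal P_\mu$ is strong if and only if $\hat{\mathbf P}\in\hat{\mathcal P}_{\hat\mu}$ is strong. (iii) $\mathbf P\in\mathcal P_\mu$ is extremal if and only if $\hat{\mathbf P}\in\hat{\mathcal P}_{\hat\mu}$ is extremal. (iv) The family of mappings $(T_g: g\in G)$ defines a group action on $\mathcal P_\mu$,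 and its restriction to $\mathrm{ex}(\mathcal P_\mu)$ is transitive. (v) The case (C1), (C2) or (C3) occurs for the TYE with the noise law $\mu$ if and only if the same case occurs for the STYE on $G$ with the noise law $\hat\mu$, respectively.
   Context: $-\mathbf N=\{0,-1,-2,\dots\}$; $e$ is the unit of $G$. TYE: on $S^{-\mathbf N}$ let $\eta=(\eta_k)_{k\in-\mathbf N}$ be the coordinate process and $\xi_k=\psi^{-1}(\theta(\eta_{k-1}),\eta_k)$, $k\in-\mathbf N$. STYE: on $G^{-\mathbf N}$ let $\hat\eta=(\hat\eta_k)_{k\in-\mathbf N}$ be the coordinate process and $\hat\xi_k=(\hat\eta_{k-1})^{-1}\cdot\hat\eta_k$, $k\in-\mathbf N$. In each case (writing $\eta,\xi,\mu$ generically) let $\mathcal F^\eta_k=\sigma(\eta_k,\eta_{k-1},\dots)$ and $\mathcal F^\xi_k=\sigma(\xi_k,\xi_{k-1},\dots)$. A solution with noise law $\mu$ is a probability measure $\mathbf P$ on the path space ($S^{-\mathbf N}$, resp. $G^{-\mathbf N}$) such that, for every $k\in-\mathbf N$, under $\mathbf P$: (i) $\xi_k$ is independent of $\mathcal F^\eta_{k-1}$; (ii) $\xi_k$ has law $\mu_k$. The set of solutions ($\mathcal P_\mu$, resp. $\hat{\mathcal P}_{\hat\mu}$) is convex; "extremal" means being an extremal point of this set, and $\mathrm{ex}(\mathcal P_\mu)$ is the set of extremal points of $\mathcal P_\mu$. A solution $\mathbf P$ is strong if $\mathcal F^\eta_k\subset\mathcal F^\xi_k$ up to $\mathbf P$-null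 sets for every $k\in-\mathbf N$. Uniqueness in law holds if the set of solutions consists of exactly one element. Cases: (C1) uniqueness in law holds and there is no strong solution; (C2) uniqueness in law fails and there exists a strong solution; (C3) uniqueness in law fails and there is no strong solution. For $g\in G$ and $\mathbf P\in\mathcal P_\mu$ (TYE), $T_g(\mathbf P)$ is the law under $\mathbf P$ of the process $(\eta'_k)_{k\in-\mathbf N}$ given by $\eta'_k=\psi(g\cdot\theta(\eta_{k-1}),\xi_k)$. *)

theory Defs
  imports "HOL-Probability.Probability" "HOL-Algebra.Group_Action"
begin

text \<open>
  The group is a type of class \<open>topological_group_add\<close>, so its operation is written \<open>+\<close>, its
  unit \<open>0\<close> and the inverse \<open>- g\<close>; this class does not make \<open>+\<close> commutative, and the order of
  the summands matters throughout.

  The index set \<open>- \<nat>\<close> is \<open>{..0} :: int set\<close>. Families indexed by it are functions on \<open>int\<close>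
  of which only the values at indices \<open>k \<le> 0\<close> are used.
\<close>

definition path_space :: "(int \<Rightarrow> 'x::topological_space) measure" where
  "path_space = PiM {..0} (\<lambda>_. borel)"

text \<open>The \<open>\<sigma>\<close>-algebra on path space generated by \<open>X k, X (k - 1), \<dots>\<close>.\<close>

definition past :: "(int \<Rightarrow> (int \<Rightarrow> 'x::topological_space) \<Rightarrow> 'x) \<Rightarrow> int \<Rightarrow> (int \<Rightarrow> 'x) set set" where
  "past X k = sigma_sets (space path_space)
     {X j -` A \<inter> space path_space | j A. j \<le> k \<and> A \<in> sets borel}"

definition coord :: "int \<Rightarrow> (int \<Rightarrow> 'x) \<Rightarrow> 'x" where
  "coord k \<eta> = \<eta> k"

text \<open>
  The two equations differ only in how the noise process is obtained from the coordinate process,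
  so the notions below take the noise process \<open>\<xi>\<close> as a parameter.
\<close>

definition tye_noise ::
  "('s \<Rightarrow> 'g) \<Rightarrow> ('g \<Rightarrow> 's \<Rightarrow> 's) \<Rightarrow> int \<Rightarrow> (int \<Rightarrow> 's) \<Rightarrow> 's" where
  "tye_noise \<theta> \<psi>inv k \<eta> = \<psi>inv (\<theta> (\<eta> (k - 1))) (\<eta> k)"

definition stye_noise :: "int \<Rightarrow> (int \<Rightarrow> 'g::group_add) \<Rightarrow> 'g" where
  "stye_noise k \<eta> = - \<eta> (k - 1) + \<eta> k"

definition solutions ::
  "(int \<Rightarrow> (int \<Rightarrow> 'x::topological_space) \<Rightarrow> 'x) \<Rightarrow> (int \<Rightarrow> 'x measure) \<Rightarrow> (int \<Rightarrow> 'x) measure set" where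
  "solutions \<xi> \<mu> = {P \<in> space (prob_algebra path_space).
     \<forall>k\<le>0. prob_space.indep_set P {\<xi> k -` A \<inter> space path_space | A. A \<in> sets borel}
                                 (past coord (k - 1))
         \<and> distr P borel (\<xi> k) = \<mu> k}"

definition strong ::
  "(int \<Rightarrow> (int \<Rightarrow> 'x::topological_space) \<Rightarrow> 'x) \<Rightarrow> (int \<Rightarrow> 'x) measure \<Rightarrow> bool" where
  "strong \<xi> P \<longleftrightarrow> (\<forall>k\<le>0. \<forall>A \<in> past coord k. \<exists>B \<in> past \<xi> k. (A - B) \<union> (B - A) \<in> null_sets P)"

text \<open>
  Measures do not form a real vector space, so \<open>extreme_point_of\<close> does not apply; this is the same
  condition with convex combinations taken eventwise.
\<close>

definition extremal_points :: "'w measure set \<Rightarrow> 'w measure set" where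
  "extremal_points K = {P \<in> K. \<not> (\<exists>Q\<in>K. \<exists>R\<in>K. Q \<noteq> R \<and> (\<exists>t::real. 0 < t \<and> t < 1 \<and>
     (\<forall>A \<in> sets P. measure P A = (1 - t) * measure Q A + t * measure R A)))}"

definition unique_in_law ::
  "(int \<Rightarrow> (int \<Rightarrow> 'x::topological_space) \<Rightarrow> 'x) \<Rightarrow> (int \<Rightarrow> 'x measure) \<Rightarrow> bool" where
  "unique_in_law \<xi> \<mu> \<longleftrightarrow> (\<exists>!P. P \<in> solutions \<xi> \<mu>)"

definition strong_solution_exists ::
  "(int \<Rightarrow> (int \<Rightarrow> 'x::topological_space) \<Rightarrow> 'x) \<Rightarrow> (int \<Rightarrow> 'x measure) \<Rightarrow> bool" where
  "strong_solution_exists \<xi> \<mu> \<longleftrightarrow> (\<exists>P \<in> solutions \<xi> \<mu>. strong \<xi> P)"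

definition case_C1 where
  "case_C1 \<xi> \<mu> \<longleftrightarrow> unique_in_law \<xi> \<mu> \<and> \<not> strong_solution_exists \<xi> \<mu>"

definition case_C2 where
  "case_C2 \<xi> \<mu> \<longleftrightarrow> \<not> unique_in_law \<xi> \<mu> \<and> strong_solution_exists \<xi> \<mu>"

definition case_C3 where
  "case_C3 \<xi> \<mu> \<longleftrightarrow> \<not> unique_in_law \<xi> \<mu> \<and> \<not> strong_solution_exists \<xi> \<mu>"

definition theta_law ::
  "('s \<Rightarrow> 'g) \<Rightarrow> (int \<Rightarrow> 's::topological_space) measure \<Rightarrow> (int \<Rightarrow> 'g::topological_space) measure" where
  "theta_law \<theta> P = distr P path_space (\<lambda>\<eta>. \<lambda>k\<in>{..0}. \<theta> (\<eta> k))"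

definition translate ::
  "('s \<Rightarrow> 'g::group_add) \<Rightarrow> ('g \<Rightarrow> 's \<Rightarrow> 's) \<Rightarrow> ('g \<Rightarrow> 's \<Rightarrow> 's) \<Rightarrow> 'g
    \<Rightarrow> (int \<Rightarrow> 's::topological_space) measure \<Rightarrow> (int \<Rightarrow> 's) measure" where
  "translate \<theta> \<psi> \<psi>inv g P =
     distr P path_space (\<lambda>\<eta>. \<lambda>k\<in>{..0}. \<psi> (g + \<theta> (\<eta> (k - 1))) (tye_noise \<theta> \<psi>inv k \<eta>))"

text \<open>The type-class group as a \<open>HOL-Algebra\<close> group, for use with \<open>group_action\<close>.\<close>

definition group_of_type :: "'g::group_add monoid" where
  "group_of_type = \<lparr>carrier = UNIV, monoid.mult = (+), one = 0\<rparr>"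

end

theory Submission
  imports Defs
begin

text \<open>
  Everything rests on a parametrisation of the solutions by the laws \<open>\<Lambda> n\<close> of their group components
  \<open>\<theta> (\<eta> n)\<close>. A window \<open>\<eta> n, \<dots>, \<eta> 0\<close> is a function of \<open>\<eta> n\<close> and of the noise after \<open>n\<close>. These are
  independent, and \<open>\<eta> n = \<psi> (\<theta> (\<eta> (n - 1))) (\<xi> n)\<close> is a function of the independent variables
  \<open>\<theta> (\<eta> (n - 1))\<close> and \<open>\<xi> n\<close>. So a solution is determined by the laws \<open>\<Lambda> n\<close> (\<open>solution_unique\<close>).
  Conversely, if each \<open>\<Lambda> n\<close> is the law of a product of independent variables with laws \<open>\<Lambda> (n - 1)\<close> and
  that of \<open>\<theta> (\<xi> n)\<close>, then the window laws built in this way are consistent, and Kolmogorov's extension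
  theorem gives a solution (\<open>solution_exists\<close>). The simple equation is the instance \<open>\<theta> = id\<close>,
  \<open>\<psi> = (+)\<close>, with the same condition on the laws \<open>\<Lambda> n\<close>; hence the bijection. It is affine, and
  mixtures of solutions are solutions, so it preserves extremal points.

  The maps \<open>T g\<close> come from the map of paths that keeps the noise and multiplies all group components by
  \<open>g\<close> from the left, and therefore form an action. It is transitive on the extremal points for the
  following reason. For a bounded \<open>f\<close>, the conditional expectations of \<open>f (\<theta> (\<eta> k))\<close> given the past of
  \<open>n\<close> converge as \<open>n\<close> decreases. The limit belongs to the remote past, and tilting the solution by it
  gives two solutions of which the given one is a mixture; so for an extremal solution the limit is
  constant (\<open>extremal_average_converges\<close>). By independence the conditional expectation is a function of
  \<open>\<theta> (\<eta> n)\<close>: it is the mean of \<open>f (g + x)\<close> over the product \<open>x\<close> of the noise in between, at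
  \<open>g = \<theta> (\<eta> n)\<close>. Thus some point \<open>g\<close> reproduces the laws \<open>\<Lambda> k\<close> of one extremal solution approximately,
  and some point \<open>h\<close> those of another one. Translation by \<open>h + - g\<close> then carries the first laws
  approximately to the second, and by compactness some translation does so exactly
  (\<open>extremal_transitive\<close>).

  If the simple solution is strong, so is the other one, because \<open>\<eta> k\<close> is a function of
  \<open>\<theta> (\<eta> (k - 1))\<close> and \<open>\<xi> k\<close>. In the other direction it has to be shown that \<open>\<theta> (\<eta> k)\<close>, if it is a
  function of the noise, is a function of the noise components \<open>\<theta> (\<xi> i)\<close> alone. It is close to a
  function of finitely many noise variables, and remains so if \<open>\<theta> (\<eta> n)\<close>, for \<open>n\<close> before all of
  these, is replaced by a suitable constant; what results depends on the \<open>\<theta> (\<xi> i)\<close> only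
  (\<open>freeze_start\<close>).

  All this needs the multiplication of \<open>G\<close> to be measurable for the product of the Borel
  \<open>\<sigma>\<close>-algebras, which for a compact group without countable base may fail. Here it holds because the
  measurability of \<open>\<psi>\<close> forces \<open>G\<close> to have a countable base (\<open>countable_base_if_action_measurable\<close>).
\<close>

section \<open>Countable bases of compact groups\<close>

text \<open>The property of Baire, in a form that is stable under the Borel operations: off a countable union of
nowhere dense sets, \<open>A\<close> is open.\<close>

lemma borel_almost_open:
  fixes A :: "'a::topological_space set"
  assumes "A \<in> sets borel"
  shows "\<exists>U W. open U \<and> (\<forall>n::nat. open (W n) \<and> closure (W n) = UNIV) \<and> A \<inter> \<Inter>(range W) = U \<inter> \<Inter>(range W)"
proof -
  have "A \<in> sigma_sets UNIV {S. open S}"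
    using assms by (simp add: borel_def)
  then show ?thesis
  proof induction
    case (Basic a)
    then show ?case
      by (intro exI[of _ a] exI[of _ "\<lambda>_. UNIV"]) auto
  next
    case Empty
    show ?case
      by (intro exI[of _ "{}"] exI[of _ "\<lambda>_. UNIV"]) auto
  next
    case (Compl a)
    then obtain U W where U: "open U" and W: "\<And>n::nat. open (W n)" "\<And>n. closure (W n) = UNIV"
      and eq: "a \<inter> \<Inter>(range W) = U \<inter> \<Inter>(range W)"
      by auto
    \<comment> \<open>The complement of \<open>U\<close> differs from its interior only in the boundary of \<open>U\<close>, whose
      complement is one more dense open set.\<close>
    define D where "D = U \<union> interior (- U)"
    have "closure U \<union> interior (- U) \<subseteq> closure D"
      unfolding D_def using closure_mono[of U "U \<union> interior (- U)"]
        closure_subset[of "U \<union> interior (- U)"] by blast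
    then have "closure D = UNIV"
      by (auto simp: interior_complement)
    moreover have "open D"
      unfolding D_def using U by (intro open_Un open_interior)
    moreover have "(UNIV - a) \<inter> \<Inter>(range (case_nat D W)) = interior (- U) \<inter> \<Inter>(range (case_nat D W))"
    proof -
      have "\<Inter>(range (case_nat D W)) = D \<inter> \<Inter>(range W)"
      proof -
        have "(\<forall>n. z \<in> case_nat D W n) \<longleftrightarrow> z \<in> D \<and> (\<forall>n. z \<in> W n)" for z
          by (metis nat.case nat.exhaust)
        then show ?thesis by auto
      qed
      moreover have "interior (- U) \<subseteq> - U" by (rule interior_subset)
      ultimately show ?thesis
        using eq unfolding D_def by (simp only: set_eq_iff Int_iff Un_iff Diff_iff Compl_iff subset_iff) blast
    qed
    ultimately show ?case
      using W by (intro exI[of _ "interior (- U)"] exI[of _ "case_nat D W"] conjI)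
        (auto split: nat.split)
  next
    case (Union a)
    then have "\<forall>i. \<exists>U W. open U \<and> (\<forall>n::nat. open (W n) \<and> closure (W n) = UNIV)
        \<and> a i \<inter> \<Inter>(range W) = U \<inter> \<Inter>(range W)"
      by blast
    then obtain U W where U: "\<And>i. open (U i)"
      and W: "\<And>i n::nat. open (W i n)" "\<And>i n. closure (W i n) = UNIV"
      and eq: "\<And>i. a i \<inter> \<Inter>(range (W i)) = U i \<inter> \<Inter>(range (W i))"
      by metis
    define V where "V n = case_prod W (prod_decode n)" for n
    have V: "\<Inter>(range V) = (\<Inter>i. \<Inter>(range (W i)))"
    proof (intro equalityI subsetI)
      fix z assume z: "z \<in> \<Inter>(range V)"
      have "z \<in> W i n" for i n
      proof -
        have "V (prod_encode (i, n)) = W i n" by (simp add: V_def)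
        with z show ?thesis by blast
      qed
      then show "z \<in> (\<Inter>i. \<Inter>(range (W i)))" by simp
    next
      fix z assume "z \<in> (\<Inter>i. \<Inter>(range (W i)))"
      then show "z \<in> \<Inter>(range V)" by (simp add: V_def split_beta)
    qed
    have "(\<Union>i. a i) \<inter> \<Inter>(range V) = (\<Union>i. U i) \<inter> \<Inter>(range V)"
    proof -
      have "z \<in> a i \<longleftrightarrow> z \<in> U i" if "z \<in> (\<Inter>i. \<Inter>(range (W i)))" for z i
        using eq[of i] that by blast
      then show ?thesis unfolding V by (simp add: set_eq_iff) blast
    qed
    moreover have "open (V n)" "closure (V n) = UNIV" for n
      using W by (auto simp: V_def split: prod.split)
    ultimately show ?case
      using U by (intro exI[of _ "\<Union>i. U i"] exI[of _ V]) auto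
  qed
qed

lemma Hausdorff_space_euclidean_t2: "Hausdorff_space (euclidean :: 'a::t2_space topology)"
  unfolding Hausdorff_space_def disjnt_def open_openin[symmetric] by (metis hausdorff)

lemma compact_shrink_open:
  fixes V :: "'a::t2_space set"
  assumes "compact (UNIV :: 'a set)" "open V" "x \<in> V"
  shows "\<exists>U. open U \<and> x \<in> U \<and> closure U \<subseteq> V"
proof -
  have "regular_space (euclidean :: 'a topology)"
    using assms(1) by (intro compact_Hausdorff_imp_regular_space) (auto simp: compact_space_def Hausdorff_space_euclidean_t2)
  then have "neighbourhood_base_of (closedin euclidean) (euclidean :: 'a topology)"
    using neighbourhood_base_of_closedin[of "euclidean :: 'a topology"] by simp
  then have "\<exists>U W. open U \<and> closed W \<and> x \<in> U \<and> U \<subseteq> W \<and> W \<subseteq> V"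
    using assms(2,3) unfolding neighbourhood_base_of by auto
  then show ?thesis
    by (meson closure_minimal subset_trans)
qed

text \<open>Baire category. Off a meagre set the separating sets \<open>A n\<close> coincide with open sets. A decreasing
sequence of open sets that avoids the meagre set and decides membership in each \<open>A n\<close> shrinks to one
point, and by compactness such a sequence is a base of neighbourhoods of this point.\<close>

lemma point_of_countable_character:
  fixes A :: "nat \<Rightarrow> 'a::t2_space set"
  assumes cpt: "compact (UNIV :: 'a set)"
    and A: "\<And>n. A n \<in> sets borel"
    and sep: "\<And>x y. (\<And>n. x \<in> A n \<longleftrightarrow> y \<in> A n) \<Longrightarrow> x = y"
  shows "\<exists>(x::'a) N. (\<forall>n::nat. open (N n) \<and> x \<in> N n) \<and> (\<forall>V. open V \<longrightarrow> x \<in> V \<longrightarrow> (\<exists>n. N n \<subseteq> V))"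
proof -
  have "\<forall>i. \<exists>U W. open U \<and> (\<forall>n::nat. open (W n) \<and> closure (W n) = UNIV)
      \<and> A i \<inter> \<Inter>(range W) = U \<inter> \<Inter>(range W)"
    using borel_almost_open A by blast
  then obtain U W where U: "\<And>i. open (U i)"
    and W: "\<And>i n::nat. open (W i n)" "\<And>i n. closure (W i n) = UNIV"
    and eq: "\<And>i. A i \<inter> \<Inter>(range (W i)) = U i \<inter> \<Inter>(range (W i))"
    by metis
  define D where "D n = case_prod W (prod_decode n)" for n
  have D: "open (D n)" "closure (D n) = UNIV" for n
    using W by (auto simp: D_def split: prod.split)
  have D_sub: "(\<Inter>n. D n) \<subseteq> W i m" for i m
  proof -
    have "D (prod_encode (i, m)) = W i m" by (simp add: D_def)
    then show ?thesis by blast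
  qed
  \<comment> \<open>The new set enters the \<open>n\<close>-th dense open set and lies inside or outside \<open>U n\<close>.\<close>
  have step: "\<exists>O'. (open O' \<and> O' \<noteq> {}) \<and> closure O' \<subseteq> V \<inter> D n \<and> (O' \<subseteq> U n \<or> O' \<inter> U n = {})"
    if "open V \<and> V \<noteq> {}" for V n
  proof -
    have "V \<inter> D n \<noteq> {}"
      using that D(2)[of n] open_Int_closure_eq_empty[of V "D n"] by auto
    then obtain V' x where V': "open V'" "x \<in> V'" "V' \<subseteq> V \<inter> D n" "V' \<subseteq> U n \<or> V' \<inter> U n = {}"
    proof (cases "V \<inter> D n \<inter> U n = {}")
      case True
      then show ?thesis
        using \<open>V \<inter> D n \<noteq> {}\<close> \<open>open V \<and> V \<noteq> {}\<close> D(1)[of n] that[of "V \<inter> D n"] by (auto simp: open_Int)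
    next
      case False
      then show ?thesis
        using \<open>open V \<and> V \<noteq> {}\<close> D(1)[of n] U[of n] that[of "V \<inter> D n \<inter> U n"] by (auto simp: open_Int)
    qed
    obtain O' where "open O'" "x \<in> O'" "closure O' \<subseteq> V'"
      using compact_shrink_open[OF cpt V'(1,2)] by blast
    then show ?thesis
      using V'(3,4) closure_subset[of O'] by (intro exI[of _ O']) auto
  qed
  obtain N where N: "\<And>n. open (N n) \<and> N n \<noteq> {}"
    and N': "\<And>n. closure (N (Suc n)) \<subseteq> N n \<inter> D n \<and> (N (Suc n) \<subseteq> U n \<or> N (Suc n) \<inter> U n = {})"
    using dependent_nat_choice[where P="\<lambda>_ V. open V \<and> V \<noteq> ({}::'a set)" and
        Q="\<lambda>n V V'. closure V' \<subseteq> V \<inter> D n \<and> (V' \<subseteq> U n \<or> V' \<inter> U n = {})"] step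
    by (metis (no_types, lifting) UNIV_not_empty open_UNIV)
  have N_dec: "N (Suc n) \<subseteq> N n" for n
    using N'[of n] closure_subset by blast
  have anti: "m \<le> n \<Longrightarrow> N n \<subseteq> N m" for m n
    using lift_Suc_antimono_le[of N] N_dec by blast
  have meets: "(\<Inter>n. closure (N n)) \<inter> - V \<noteq> {}" if V: "\<And>n. \<not> N n \<subseteq> V" "open V" for V
  proof -
    have "(- V) \<inter> (\<Inter>n\<in>UNIV. closure (N n)) \<noteq> {}"
    proof (rule compact_imp_fip_image)
      show "compact (- V)"
        using V(2) cpt closed_Compl by (metis Int_UNIV_left compact_Int_closed)
      fix I :: "nat set" assume "finite I"
      then obtain m where m: "\<And>i. i \<in> I \<Longrightarrow> i \<le> m"
        by (meson finite_nat_set_iff_bounded_le)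
      obtain y where "y \<in> N m" "y \<notin> V" using V(1) by blast
      then have "y \<in> - V \<inter> (\<Inter>i\<in>I. closure (N i))"
        using m anti closure_subset by (auto simp: subset_iff) blast
      then show "- V \<inter> (\<Inter>i\<in>I. closure (N i)) \<noteq> {}" by blast
    qed auto
    then show ?thesis by blast
  qed
  from meets[of "{}"] N obtain x where x: "\<And>n. x \<in> closure (N n)" by auto
  have uniq: "y = x" if y: "\<And>n. y \<in> closure (N n)" for y
  proof (rule sep)
    fix n
    have inD: "z \<in> D n" "z \<in> N n" if "\<And>n. z \<in> closure (N n)" for z n
      using N'[of n] that[of "Suc n"] by auto
    have inW: "z \<in> \<Inter>(range (W n))" if "\<And>n. z \<in> closure (N n)" for z
      using inD[OF that] D_sub by blast
    have "y \<in> U n \<longleftrightarrow> x \<in> U n"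
      using N'[of n] inD(2)[OF x, of "Suc n"] inD(2)[OF y, of "Suc n"] by blast
    then show "y \<in> A n \<longleftrightarrow> x \<in> A n"
      using eq[of n] inW[OF x] inW[OF y] by blast
  qed
  have "x \<in> N n" for n using x[of "Suc n"] N'[of n] by blast
  moreover have "\<exists>n. N n \<subseteq> V" if "open V" "x \<in> V" for V
    using meets[of V] uniq that by blast
  ultimately show ?thesis
    using N by (intro exI[of _ x] exI[of _ N]) simp
qed

text \<open>Translates of the neighbourhoods of one point form a base; by compactness finitely many translates
of each suffice.\<close>

lemma group_countable_base:
  fixes x :: "'g::{topological_group_add, t2_space}"
  assumes cpt: "compact (UNIV :: 'g set)"
    and N: "\<And>n::nat. open (N n)" "\<And>n. x \<in> N n"
    and base: "\<And>V. open V \<Longrightarrow> x \<in> V \<Longrightarrow> \<exists>n. N n \<subseteq> V"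
  shows "\<exists>B :: 'g set set. countable B \<and> (\<forall>b\<in>B. open b) \<and> (\<forall>V y. open V \<longrightarrow> y \<in> V \<longrightarrow> (\<exists>b\<in>B. y \<in> b \<and> b \<subseteq> V))"
proof -
  define M where "M n a = (\<lambda>y. x + (- a + y)) -` N n" for n a
  have M: "open (M n a)" for n a
    unfolding M_def by (intro open_vimage N continuous_intros)
  have "\<exists>F. finite F \<and> (UNIV :: 'g set) \<subseteq> (\<Union>a\<in>F. M n a)" for n
  proof -
    have "a \<in> M n a" for a using N(2) by (simp add: M_def)
    then have "UNIV \<subseteq> (\<Union>a\<in>UNIV. M n a)" by blast
    then obtain F where "finite F" "UNIV \<subseteq> (\<Union>a\<in>F. M n a)"
      using compactE_image[OF cpt, of UNIV "M n"] M by auto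
    then show ?thesis by blast
  qed
  then obtain F where F: "\<And>n. finite (F n)" "\<And>n. (UNIV :: 'g set) \<subseteq> (\<Union>a\<in>F n. M n a)"
    by metis
  define B where "B = (\<Union>n. M n ` F n)"
  have "countable B"
    unfolding B_def using F(1) by (meson countableI_type countable_UN countable_finite countable_image)
  moreover have "\<exists>b\<in>B. y \<in> b \<and> b \<subseteq> V" if V: "open V" "y \<in> V" for V y
  proof -
    \<comment> \<open>If \<open>y\<close> and \<open>z\<close> lie in the same translate \<open>M n a\<close>, then \<open>z = \<phi> (u, v)\<close> with \<open>u, v\<close> in \<open>N n\<close>.\<close>
    define \<phi> where "\<phi> p = y + - (- x + fst p) + (- x + snd p)" for p
    have "open (\<phi> -` V)"
      unfolding \<phi>_def by (intro open_vimage V continuous_intros)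
    moreover have "(x, x) \<in> \<phi> -` V" using V by (simp add: \<phi>_def)
    ultimately obtain P Q where "open P" "open Q" "(x, x) \<in> P \<times> Q" "P \<times> Q \<subseteq> \<phi> -` V"
      by (rule open_prod_elim)
    moreover obtain n where n: "N n \<subseteq> P \<inter> Q"
      using base[of "P \<inter> Q"] calculation by auto
    ultimately have *: "\<phi> (u, v) \<in> V" if "u \<in> N n" "v \<in> N n" for u v
      using that by blast
    obtain a where a: "a \<in> F n" "y \<in> M n a" using F(2)[of n] by blast
    have "z \<in> V" if "z \<in> M n a" for z
    proof -
      have "\<phi> (x + (- a + y), x + (- a + z)) = z"
        by (simp add: \<phi>_def minus_add add.assoc)
      with *[of "x + (- a + y)" "x + (- a + z)"] a(2) that show ?thesis
        by (simp add: M_def)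
    qed
    with a show ?thesis by (auto simp: B_def)
  qed
  ultimately show ?thesis
    using M by (intro exI[of _ B]) (auto simp: B_def)
qed

text \<open>A predicate on the type, because \<open>G\<close> has a countable base only as a consequence of the hypotheses on
\<open>\<theta>\<close> and \<open>\<psi>\<close>.\<close>

definition has_countable_base :: "'a::topological_space itself \<Rightarrow> bool" where
  "has_countable_base _ \<longleftrightarrow> (\<exists>B :: 'a set set. countable B \<and> (\<forall>b\<in>B. open b)
     \<and> (\<forall>V y. open V \<longrightarrow> y \<in> V \<longrightarrow> (\<exists>b\<in>B. y \<in> b \<and> b \<subseteq> V)))"

text \<open>A set of a product \<open>\<sigma>\<close>-algebra is generated by countably many rectangles, so countably many sets
of the first factor decide all its sections.\<close>

lemma pair_sets_sections_countable:
  assumes "E \<in> sets (M \<Otimes>\<^sub>M N)"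
  shows "\<exists>\<A>. countable \<A> \<and> \<A> \<subseteq> sets M \<and> (\<forall>x\<in>space M. \<forall>x'\<in>space M.
     (\<forall>A\<in>\<A>. x \<in> A \<longleftrightarrow> x' \<in> A) \<longrightarrow> (\<forall>y\<in>space N. (x, y) \<in> E \<longleftrightarrow> (x', y) \<in> E))"
proof -
  have "E \<in> sigma_sets (space M \<times> space N) {a \<times> b |a b. a \<in> sets M \<and> b \<in> sets N}"
    using assms by (simp add: sets_pair_measure)
  then show ?thesis
  proof induction
    case (Basic E)
    then obtain a b where "E = a \<times> b" "a \<in> sets M" by auto
    then show ?case by (intro exI[of _ "{a}"]) auto
  next
    case Empty
    show ?case by (intro exI[of _ "{}"]) auto
  next
    case (Compl E)
    from Compl.IH obtain \<A> where \<A>: "countable \<A>" "\<A> \<subseteq> sets M"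
      and sec: "\<And>x x' y. x \<in> space M \<Longrightarrow> x' \<in> space M \<Longrightarrow> (\<forall>A\<in>\<A>. x \<in> A \<longleftrightarrow> x' \<in> A) \<Longrightarrow>
        y \<in> space N \<Longrightarrow> (x, y) \<in> E \<longleftrightarrow> (x', y) \<in> E"
      by metis
    have "(x, y) \<in> space M \<times> space N - E \<longleftrightarrow> (x', y) \<in> space M \<times> space N - E"
      if "x \<in> space M" "x' \<in> space M" "\<forall>A\<in>\<A>. x \<in> A \<longleftrightarrow> x' \<in> A" "y \<in> space N" for x x' y
      using sec[OF that] that(1,2,4) by blast
    with \<A> show ?case
      by (intro exI[of _ \<A>] conjI ballI impI) assumption+
  next
    case (Union E)
    then have "\<forall>i. \<exists>\<A>. countable \<A> \<and> \<A> \<subseteq> sets M \<and> (\<forall>x\<in>space M. \<forall>x'\<in>space M.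
      (\<forall>A\<in>\<A>. x \<in> A \<longleftrightarrow> x' \<in> A) \<longrightarrow> (\<forall>y\<in>space N. (x, y) \<in> E i \<longleftrightarrow> (x', y) \<in> E i))"
      by blast
    then obtain \<A> where \<A>: "\<And>i. countable (\<A> i)" "\<And>i. \<A> i \<subseteq> sets M"
      and sec: "\<And>i x x' y. x \<in> space M \<Longrightarrow> x' \<in> space M \<Longrightarrow> (\<forall>A\<in>\<A> i. x \<in> A \<longleftrightarrow> x' \<in> A) \<Longrightarrow>
        y \<in> space N \<Longrightarrow> (x, y) \<in> E i \<longleftrightarrow> (x', y) \<in> E i"
      by metis
    define \<B> where "\<B> = (\<Union>i. \<A> i)"
    have "\<forall>x\<in>space M. \<forall>x'\<in>space M. (\<forall>A\<in>\<B>. x \<in> A \<longleftrightarrow> x' \<in> A) \<longrightarrow>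
        (\<forall>y\<in>space N. (x, y) \<in> (\<Union>i. E i) \<longleftrightarrow> (x', y) \<in> (\<Union>i. E i))"
    proof (intro ballI impI)
      fix x x' y assume "x \<in> space M" "x' \<in> space M" "y \<in> space N" "\<forall>A\<in>\<B>. x \<in> A \<longleftrightarrow> x' \<in> A"
      then have "(x, y) \<in> E i \<longleftrightarrow> (x', y) \<in> E i" for i
        by (intro sec) (auto simp: \<B>_def)
      then show "(x, y) \<in> (\<Union>i. E i) \<longleftrightarrow> (x', y) \<in> (\<Union>i. E i)" by simp
    qed
    moreover have "countable \<B>"
      unfolding \<B>_def using \<A>(1) by (intro countable_UN) auto
    moreover have "\<B> \<subseteq> sets M"
      unfolding \<B>_def using \<A>(2) by blast
    ultimately show ?case by (intro exI[of _ \<B>] conjI)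
  qed
qed

text \<open>As \<open>\<theta>\<close> is onto, the sections of the measurable set \<open>{(g, s). g + \<theta> s = 0}\<close> are all the singletons of
\<open>G\<close>. Hence countably many Borel sets separate the points of \<open>G\<close>.\<close>

lemma countable_base_if_action_measurable:
  fixes \<theta> :: "'s::topological_space \<Rightarrow> 'g::{topological_group_add, t2_space}"
  assumes cpt: "compact (UNIV :: 'g set)"
    and meas: "(\<lambda>(g, s). g + \<theta> s) \<in> borel \<Otimes>\<^sub>M borel \<rightarrow>\<^sub>M borel"
    and surj: "surj \<theta>"
  shows "has_countable_base TYPE('g)"
proof -
  define E where "E = (\<lambda>(g, s). g + \<theta> s) -` {0} \<inter> space (borel \<Otimes>\<^sub>M borel)"
  have E: "(g, s) \<in> E \<longleftrightarrow> g + \<theta> s = 0" for g s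
    by (simp add: E_def space_pair_measure)
  have "E \<in> sets (borel \<Otimes>\<^sub>M borel)"
    unfolding E_def using measurable_sets[OF meas, of "{0}"] by simp
  from pair_sets_sections_countable[OF this]
  obtain \<A> :: "'g set set" where \<A>: "countable \<A>" "\<A> \<subseteq> sets borel"
    and sep: "\<And>g g' s. (\<forall>A\<in>\<A>. g \<in> A \<longleftrightarrow> g' \<in> A) \<Longrightarrow> g + \<theta> s = 0 \<longleftrightarrow> g' + \<theta> s = 0"
    unfolding space_borel E by auto
  define A where "A = from_nat_into (insert {} \<A>)"
  have rA: "range A = insert {} \<A>"
    unfolding A_def using \<A>(1) by (simp add: range_from_nat_into)
  have "\<exists>(x::'g) N. (\<forall>n::nat. open (N n) \<and> x \<in> N n) \<and> (\<forall>V. open V \<longrightarrow> x \<in> V \<longrightarrow> (\<exists>n. N n \<subseteq> V))"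
  proof (rule point_of_countable_character[OF cpt])
    show "A n \<in> sets borel" for n
      using rA \<A>(2) by (metis insertE rangeI sets.empty_sets subsetD)
    fix g g' assume "\<And>n. g \<in> A n \<longleftrightarrow> g' \<in> A n"
    then have "\<forall>A\<in>\<A>. g \<in> A \<longleftrightarrow> g' \<in> A" using rA by (metis insertI2 rangeE)
    moreover obtain s where "\<theta> s = - g" using surj by (metis surjD)
    ultimately show "g = g'"
      using sep[of g g' s] by (simp add: eq_neg_iff_add_eq_0[symmetric])
  qed
  then obtain x :: 'g and N where "\<And>n::nat. open (N n)" "\<And>n. x \<in> N n"
    "\<And>V. open V \<Longrightarrow> x \<in> V \<Longrightarrow> \<exists>n. N n \<subseteq> V"
    by blast
  from group_countable_base[OF cpt this] show ?thesis
    unfolding has_countable_base_def .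
qed

lemma add_measurable_if_countable_base:
  assumes "has_countable_base TYPE('g::topological_group_add)"
  shows "(\<lambda>(g, h). g + h :: 'g) \<in> borel \<Otimes>\<^sub>M borel \<rightarrow>\<^sub>M borel"
proof (rule borel_measurableI)
  fix V :: "'g set" assume V: "open V"
  obtain B :: "'g set set" where B: "countable B" "\<And>b. b \<in> B \<Longrightarrow> open b"
    "\<And>V y. open V \<Longrightarrow> y \<in> V \<Longrightarrow> \<exists>b\<in>B. y \<in> b \<and> b \<subseteq> V"
    using assms unfolding has_countable_base_def by blast
  let ?f = "\<lambda>(g, h). g + h :: 'g"
  have op: "open (?f -` V)"
    unfolding split_beta by (intro open_vimage V continuous_intros)
  have "?f -` V = (\<Union>(b, c)\<in>{(b, c)\<in>B \<times> B. b \<times> c \<subseteq> ?f -` V}. b \<times> c)"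
  proof (intro equalityI subsetI)
    fix p assume p: "p \<in> ?f -` V"
    obtain P Q where PQ: "open P" "open Q" "p \<in> P \<times> Q" "P \<times> Q \<subseteq> ?f -` V"
      using open_prod_elim[OF op p] by blast
    have "fst p \<in> P" "snd p \<in> Q" using PQ(3) by (auto simp: mem_Times_iff)
    then obtain b c where bc: "b \<in> B" "fst p \<in> b" "b \<subseteq> P" "c \<in> B" "snd p \<in> c" "c \<subseteq> Q"
      using B(3)[OF PQ(1)] B(3)[OF PQ(2)] by metis
    then have "b \<times> c \<subseteq> ?f -` V"
      using PQ(4) by (meson Sigma_mono subset_trans)
    with bc show "p \<in> (\<Union>(b, c)\<in>{(b, c)\<in>B \<times> B. b \<times> c \<subseteq> ?f -` V}. b \<times> c)"
      by (intro UN_I[of "(b, c)"]) (auto simp: mem_Times_iff)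
  qed auto
  also have "\<dots> \<in> sets (borel \<Otimes>\<^sub>M borel)"
  proof (rule sets.countable_UN'')
    show "countable {(b, c)\<in>B \<times> B. b \<times> c \<subseteq> ?f -` V}"
      by (rule countable_subset[OF _ countable_SIGMA[OF B(1), of "\<lambda>_. B"]]) (use B(1) in auto)
    show "(case p of (b, c) \<Rightarrow> b \<times> c) \<in> sets (borel \<Otimes>\<^sub>M borel)"
      if "p \<in> {(b, c)\<in>B \<times> B. b \<times> c \<subseteq> ?f -` V}" for p
      using that B(2) by (auto intro!: pair_measureI borel_open)
  qed
  finally show "?f -` V \<inter> space (borel \<Otimes>\<^sub>M borel) \<in> sets (borel \<Otimes>\<^sub>M borel)"
    by (simp add: space_pair_measure)
qed

text \<open>The complement of \<open>C\<close> is a countable union of closed sets \<open>K n\<close>, and Urysohn functions that are 1 on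
\<open>C\<close> and 0 on \<open>K n\<close> converge pointwise.\<close>

lemma closed_indicator_limit_continuous:
  fixes C :: "'a::t2_space set"
  assumes cpt: "compact (UNIV :: 'a set)" and cb: "has_countable_base TYPE('a)" and C: "closed C"
  shows "\<exists>f :: nat \<Rightarrow> 'a \<Rightarrow> real. (\<forall>n. continuous_on UNIV (f n)) \<and> (\<forall>n x. f n x \<in> {0..1})
    \<and> (\<forall>x. (\<lambda>n. f n x) \<longlonglongrightarrow> indicator C x)"
proof -
  obtain B :: "'a set set" where B: "countable B" "\<And>b. b \<in> B \<Longrightarrow> open b"
    "\<And>V y. open V \<Longrightarrow> y \<in> V \<Longrightarrow> \<exists>b\<in>B. y \<in> b \<and> b \<subseteq> V"
    using cb unfolding has_countable_base_def by blast
  define B' where "B' = insert {} {b\<in>B. closure b \<subseteq> - C}"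
  have B': "countable B'" "B' \<noteq> {}"
    using B(1) by (auto simp: B'_def)
  define K where "K n = (\<Union>i\<le>n. closure (from_nat_into B' i))" for n :: nat
  have clK: "closed (K n)" for n unfolding K_def by (intro closed_UN) auto
  have disj: "disjnt (K n) C" for n
  proof -
    have "closure b \<subseteq> - C" if "b \<in> B'" for b using that by (auto simp: B'_def)
    then have "closure (from_nat_into B' i) \<inter> C = {}" for i
      using from_nat_into[OF B'(2), of i] by blast
    then show ?thesis
      unfolding K_def disjnt_def by blast
  qed
  have "\<exists>n. x \<in> K n" if x: "x \<notin> C" for x
  proof -
    obtain U where U: "open U" "x \<in> U" "closure U \<subseteq> - C"
      using compact_shrink_open[OF cpt, of "- C" x] C x by auto
    then obtain b where "b \<in> B" "x \<in> b" "b \<subseteq> U" using B(3) by blast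
    with U have "b \<in> B'" "x \<in> closure b"
      using closure_mono[of b U] closure_subset[of b] by (auto simp: B'_def)
    moreover obtain i where "from_nat_into B' i = b"
      using from_nat_into_surj[OF B'(1) \<open>b \<in> B'\<close>] by blast
    ultimately show ?thesis unfolding K_def by blast
  qed
  then have inK: "\<exists>n. \<forall>m\<ge>n. x \<in> K m" if "x \<notin> C" for x
    using that unfolding K_def by (meson UN_iff atMost_iff le_trans)
  have normal: "normal_space (euclidean :: 'a topology)"
    using cpt by (intro compact_Hausdorff_or_regular_imp_normal_space) (auto simp: compact_space_def Hausdorff_space_euclidean_t2)
  have "\<exists>f :: 'a \<Rightarrow> real. continuous_on UNIV f \<and> (\<forall>x. f x \<in> {0..1}) \<and> f ` K n \<subseteq> {0} \<and> f ` C \<subseteq> {1}" for n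
  proof -
    obtain f where "continuous_map euclidean (top_of_set {0..1::real}) f" "f ` K n \<subseteq> {0}" "f ` C \<subseteq> {1}"
      by (rule Urysohn_lemma[OF normal, of "K n" C 0 1]) (use clK C disj in auto)
    then show ?thesis
      by (intro exI[of _ f]) (auto simp: continuous_map_in_subtopology)
  qed
  then obtain f :: "nat \<Rightarrow> 'a \<Rightarrow> real" where f: "\<And>n. continuous_on UNIV (f n)" "\<And>n x. f n x \<in> {0..1}"
    "\<And>n. f n ` K n \<subseteq> {0}" "\<And>n. f n ` C \<subseteq> {1}"
    by metis
  have "(\<lambda>n. f n x) \<longlonglongrightarrow> indicator C x" for x
  proof (cases "x \<in> C")
    case True
    then have "f n x = 1" for n using f(4)[of n] by auto
    with True show ?thesis by simp
  next
    case False
    then obtain n where n: "\<And>m. m \<ge> n \<Longrightarrow> x \<in> K m" using inK by blast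
    have "f m x = 0" if "m \<ge> n" for m using f(3)[of m] n[OF that] by auto
    then have "\<forall>\<^sub>F m in sequentially. f m x = indicator C x"
      using False by (auto simp: eventually_sequentially)
    then show ?thesis by (rule tendsto_eventually)
  qed
  with f(1,2) show ?thesis by blast
qed

lemma measure_eq_if_continuous_integral_eq:
  fixes P Q :: "'a::t2_space measure"
  assumes cpt: "compact (UNIV :: 'a set)" and cb: "has_countable_base TYPE('a)"
    and P: "prob_space P" "sets P = sets borel" and Q: "prob_space Q" "sets Q = sets borel"
    and eq: "\<And>f :: 'a \<Rightarrow> real. continuous_on UNIV f \<Longrightarrow> (\<And>x. f x \<in> {0..1}) \<Longrightarrow> (\<integral>x. f x \<partial>P) = (\<integral>x. f x \<partial>Q)"
  shows "P = Q"
proof -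
  interpret P: prob_space P by fact
  interpret Q: prob_space Q by fact
  note [measurable_cong] = P(2) Q(2)
  have "measure P C = measure Q C" if C: "closed C" for C
  proof -
    obtain f :: "nat \<Rightarrow> 'a \<Rightarrow> real" where f: "\<And>n. continuous_on UNIV (f n)" "\<And>n x. f n x \<in> {0..1}"
      and lim: "\<And>x. (\<lambda>n. f n x) \<longlonglongrightarrow> indicator C x"
      using closed_indicator_limit_continuous[OF cpt cb C] by metis
    have [measurable]: "f n \<in> borel_measurable borel" for n
      using f(1) by (rule borel_measurable_continuous_onI)
    have [measurable]: "C \<in> sets borel" using C by simp
    have "(\<lambda>n. \<integral>x. f n x \<partial>P) \<longlonglongrightarrow> (\<integral>x. indicator C x \<partial>P)"
      by (rule integral_dominated_convergence[where w="\<lambda>_. 1"]) (use f(2) lim in auto)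
    moreover have "(\<lambda>n. \<integral>x. f n x \<partial>Q) \<longlonglongrightarrow> (\<integral>x. indicator C x \<partial>Q)"
      by (rule integral_dominated_convergence[where w="\<lambda>_. 1"]) (use f(2) lim in auto)
    moreover have "(\<integral>x. f n x \<partial>P) = (\<integral>x. f n x \<partial>Q)" for n
      using eq f by blast
    ultimately show ?thesis
      using LIMSEQ_unique sets_eq_imp_space_eq[OF P(2)] sets_eq_imp_space_eq[OF Q(2)] by simp
  qed
  then show ?thesis
    by (intro measure_eqI_generator_eq[where \<Omega>=UNIV and E="Collect closed" and A="\<lambda>_. UNIV"])
      (auto simp: Int_stable_def P(2) Q(2) borel_eq_closed P.emeasure_eq_measure Q.emeasure_eq_measure)
qed

lemma left_translation_equicontinuous:
  fixes f :: "'g::topological_monoid_add \<Rightarrow> real"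
  assumes cpt: "compact (UNIV :: 'g set)" and f: "continuous_on UNIV f" and e: "0 < e"
  shows "\<exists>N. open N \<and> z \<in> N \<and> (\<forall>w\<in>N. \<forall>x. \<bar>f (w + x) - f (z + x)\<bar> < e)"
proof -
  define h where "h p = \<bar>f (fst p + snd p) - f (z + snd p)\<bar>" for p
  have "continuous_on UNIV h"
    unfolding h_def by (intro continuous_intros continuous_on_compose2[OF f]) auto
  then have "open (h -` {..<e})"
    by (intro open_vimage) auto
  moreover have "{z} \<times> UNIV \<subseteq> h -` {..<e}" using e by (auto simp: h_def)
  ultimately obtain N where "open N" "z \<in> N" "N \<times> UNIV \<subseteq> h -` {..<e}"
    using Elementary_Topology.tube_lemma[OF cpt, of "h -` {..<e}" z] by blast
  moreover have "\<bar>f (w + x) - f (z + x)\<bar> < e" if "w \<in> N" for w x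
  proof -
    have "(w, x) \<in> h -` {..<e}" using that calculation by blast
    then show ?thesis by (simp add: h_def)
  qed
  ultimately show ?thesis by blast
qed

section \<open>Path space\<close>

lemma coord_measurable [measurable]: "k \<le> 0 \<Longrightarrow> (\<lambda>\<eta>. \<eta> k) \<in> path_space \<rightarrow>\<^sub>M borel"
  unfolding path_space_def by (rule measurable_component_singleton) simp

definition past_algebra ::
  "(int \<Rightarrow> (int \<Rightarrow> 'x::topological_space) \<Rightarrow> 'x) \<Rightarrow> int \<Rightarrow> (int \<Rightarrow> 'x) measure" where
  "past_algebra X k = sigma (space path_space)
     {X j -` A \<inter> space path_space | j A. j \<le> k \<and> A \<in> sets borel}"

lemma space_past_algebra [simp]: "space (past_algebra X k) = space path_space"
  unfolding past_algebra_def by (rule space_measure_of) auto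

lemma sets_past_algebra: "sets (past_algebra X k) = past X k"
  unfolding past_algebra_def past_def by (rule sets_measure_of) auto

lemma measurable_past_algebra:
  assumes "j \<le> k"
  shows "X j \<in> past_algebra X k \<rightarrow>\<^sub>M borel"
proof (rule measurableI)
  fix A :: "'a set" assume "A \<in> sets borel"
  then show "X j -` A \<inter> space (past_algebra X k) \<in> sets (past_algebra X k)"
    unfolding sets_past_algebra past_def space_past_algebra
    using assms by (intro sigma_sets.Basic) blast
qed simp

lemma coord_measurable_past: "j \<le> k \<Longrightarrow> (\<lambda>\<eta>. \<eta> j) \<in> past_algebra coord k \<rightarrow>\<^sub>M borel"
  using measurable_past_algebra[of j k coord] by (simp add: coord_def[abs_def])

lemma measurable_into_past_algebra:
  assumes "T \<in> space M \<rightarrow> space path_space" "\<And>j. j \<le> k \<Longrightarrow> (\<lambda>x. X j (T x)) \<in> M \<rightarrow>\<^sub>M borel"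
  shows "T \<in> M \<rightarrow>\<^sub>M past_algebra X k"
  unfolding past_algebra_def
proof (rule measurable_measure_of)
  fix Y assume "Y \<in> {X j -` A \<inter> space path_space |j A. j \<le> k \<and> A \<in> sets borel}"
  then obtain j A where Y: "Y = X j -` A \<inter> space path_space" "j \<le> k" "A \<in> sets borel"
    by blast
  have "T -` Y \<inter> space M = (\<lambda>x. X j (T x)) -` A \<inter> space M"
    using assms(1) unfolding Y(1) by auto
  with measurable_sets[OF assms(2)[OF Y(2)] Y(3)] show "T -` Y \<inter> space M \<in> sets M" by simp
qed (use assms(1) in auto)

lemma past_mono: "j \<le> k \<Longrightarrow> past X j \<subseteq> past X k"
  unfolding past_def by (intro sigma_sets_mono') fastforce

lemma past_subset_path_space:
  assumes "\<And>j. j \<le> k \<Longrightarrow> X j \<in> path_space \<rightarrow>\<^sub>M borel"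
  shows "past X k \<subseteq> sets path_space"
  unfolding past_def by (rule sets.sigma_sets_subset) (use measurable_sets[OF assms] in blast)

lemma past_coord_subset: "k \<le> 0 \<Longrightarrow> past coord k \<subseteq> sets path_space"
  by (rule past_subset_path_space) (simp add: coord_def[abs_def] coord_measurable)

text \<open>A generator of the past that is closed under intersections, so that independence of the past need only
be checked on it.\<close>

definition boxes :: "int \<Rightarrow> (int \<Rightarrow> 'x::topological_space) set set" where
  "boxes k = {{\<eta> \<in> space path_space. \<forall>j\<in>{n..k}. \<eta> j \<in> C j} | n C. n \<le> k \<and> (\<forall>j. C j \<in> sets borel)}"

lemma Int_stable_boxes: "Int_stable (boxes k)"
proof (rule Int_stableI)
  fix a b :: "(int \<Rightarrow> 'a) set" assume "a \<in> boxes k" "b \<in> boxes k"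
  then obtain n C m D where
    a: "a = {\<eta> \<in> space path_space. \<forall>j\<in>{n..k}. \<eta> j \<in> C j}" "n \<le> k" "\<And>j. C j \<in> sets borel" and
    b: "b = {\<eta> \<in> space path_space. \<forall>j\<in>{m..k}. \<eta> j \<in> D j}" "m \<le> k" "\<And>j. D j \<in> sets borel"
    unfolding boxes_def by blast
  define E where "E j = (if n \<le> j then C j else UNIV) \<inter> (if m \<le> j then D j else UNIV)" for j
  have "a \<inter> b = {\<eta> \<in> space path_space. \<forall>j\<in>{min n m..k}. \<eta> j \<in> E j}"
  proof (intro equalityI subsetI)
    fix \<eta> assume "\<eta> \<in> {\<eta> \<in> space path_space. \<forall>j\<in>{min n m..k}. \<eta> j \<in> E j}"
    then have sp: "\<eta> \<in> space path_space" and *: "\<And>j. min n m \<le> j \<Longrightarrow> j \<le> k \<Longrightarrow> \<eta> j \<in> E j" by auto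
    have "\<eta> j \<in> C j" if "n \<le> j" "j \<le> k" for j
      using *[of j] that by (simp add: E_def split: if_splits)
    moreover have "\<eta> j \<in> D j" if "m \<le> j" "j \<le> k" for j
      using *[of j] that by (simp add: E_def split: if_splits)
    ultimately show "\<eta> \<in> a \<inter> b" unfolding a b using sp by simp
  next
    fix \<eta> assume "\<eta> \<in> a \<inter> b"
    then show "\<eta> \<in> {\<eta> \<in> space path_space. \<forall>j\<in>{min n m..k}. \<eta> j \<in> E j}"
      unfolding a b E_def by auto
  qed
  moreover have "E j \<in> sets borel" for j
    using a b by (auto simp: E_def intro!: sets.Int)
  ultimately show "a \<inter> b \<in> boxes k"
    unfolding boxes_def using a(2) by (intro CollectI exI[of _ "min n m"] exI[of _ E]) auto
qed

lemma past_coord_eq_boxes: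
  "past (coord :: int \<Rightarrow> (int \<Rightarrow> 'a::topological_space) \<Rightarrow> 'a) k = sigma_sets (space path_space) (boxes k)"
    (is "?L = ?R")
proof
  show "?L \<subseteq> ?R"
    unfolding past_def
  proof (rule sigma_sets_mono, rule subsetI)
    fix Y :: "(int \<Rightarrow> 'a) set"
    assume "Y \<in> {coord j -` A \<inter> space path_space |j A. j \<le> k \<and> A \<in> sets borel}"
    then obtain j A where Y: "Y = coord j -` A \<inter> space path_space" "j \<le> k" "A \<in> sets borel"
      by blast
    have "Y = {\<eta> \<in> space path_space. \<forall>i\<in>{j..k}. \<eta> i \<in> (if i = j then A else UNIV)}"
      unfolding Y(1) coord_def using Y(2) by auto
    moreover have "\<forall>i. (if i = j then A else UNIV) \<in> sets borel" using Y(3) by simp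
    ultimately have "Y \<in> boxes k"
      unfolding boxes_def using Y(2)
      by (intro CollectI exI[of _ j] exI[of _ "\<lambda>i. if i = j then A else UNIV"] conjI)
    then show "Y \<in> sigma_sets (space path_space) (boxes k)" by (rule sigma_sets.Basic)
  qed
  have "boxes k \<subseteq> sets (past_algebra (coord :: int \<Rightarrow> (int \<Rightarrow> 'a) \<Rightarrow> 'a) k)"
  proof (rule subsetI)
    fix Y :: "(int \<Rightarrow> 'a) set" assume "Y \<in> boxes k"
    then obtain n C where Y: "Y = {\<eta> \<in> space path_space. \<forall>j\<in>{n..k}. \<eta> j \<in> C j}"
      and C: "\<And>j. C j \<in> sets borel"
      unfolding boxes_def by blast
    have "{\<eta> \<in> space (past_algebra coord k). \<forall>j\<in>{n..k}. \<eta> j \<in> C j} \<in> sets (past_algebra coord k)"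
    proof (rule sets.sets_Collect_finite_All)
      fix j assume "j \<in> {n..k}"
      then have "(\<lambda>\<eta>. \<eta> j) -` C j \<inter> space (past_algebra coord k) \<in> sets (past_algebra coord k)"
        by (intro measurable_sets[OF coord_measurable_past C]) auto
      then show "{\<eta> \<in> space (past_algebra coord k). \<eta> j \<in> C j} \<in> sets (past_algebra coord k)"
        by (simp add: vimage_def Int_def conj_commute)
    qed auto
    then show "Y \<in> sets (past_algebra coord k)" by (simp add: Y)
  qed
  from sets.sigma_sets_subset[OF this]
  show "?R \<subseteq> ?L"
    by (simp add: sets_past_algebra)
qed

section \<open>Solutions of the Tsirelson--Yor equation\<close>

locale tsirelson_yor =
  fixes \<theta> :: "'s::topological_space \<Rightarrow> 'g::topological_group_add"
    and \<psi> \<psi>inv :: "'g \<Rightarrow> 's \<Rightarrow> 's"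
    and \<mu> :: "int \<Rightarrow> 's measure"
  assumes \<theta>_measurable [measurable]: "\<theta> \<in> borel \<rightarrow>\<^sub>M borel"
    and \<psi>_measurable: "case_prod \<psi> \<in> borel \<Otimes>\<^sub>M borel \<rightarrow>\<^sub>M borel"
    and \<psi>inv_measurable: "case_prod \<psi>inv \<in> borel \<Otimes>\<^sub>M borel \<rightarrow>\<^sub>M borel"
    and add_measurable: "(\<lambda>(g, h). g + h :: 'g) \<in> borel \<Otimes>\<^sub>M borel \<rightarrow>\<^sub>M borel"
    and \<psi>inv_\<psi> [simp]: "\<psi>inv g (\<psi> g s) = s"
    and \<psi>_\<psi>inv [simp]: "\<psi> g (\<psi>inv g s) = s"
    and \<theta>_\<psi>: "\<theta> (\<psi> g s) = g + \<theta> s"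
    and \<mu>_space: "k \<le> 0 \<Longrightarrow> \<mu> k \<in> space (prob_algebra borel)"
begin

abbreviation \<xi> :: "int \<Rightarrow> (int \<Rightarrow> 's) \<Rightarrow> 's" where
  "\<xi> \<equiv> tye_noise \<theta> \<psi>inv"

lemmas measurable_\<psi> [measurable (raw)] = measurable_Pair_compose_split[OF \<psi>_measurable]
lemmas measurable_\<psi>inv [measurable (raw)] = measurable_Pair_compose_split[OF \<psi>inv_measurable]
lemmas measurable_add [measurable (raw)] = measurable_Pair_compose_split[OF add_measurable]

lemma prob_space_\<mu>: "k \<le> 0 \<Longrightarrow> prob_space (\<mu> k)"
  and sets_\<mu>: "k \<le> 0 \<Longrightarrow> sets (\<mu> k) = sets borel"
  using \<mu>_space[of k] by (auto simp: space_prob_algebra)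

lemma space_\<mu>: "k \<le> 0 \<Longrightarrow> space (\<mu> k) = UNIV"
  using sets_eq_imp_space_eq[OF sets_\<mu>] by simp

lemma \<xi>_measurable [measurable]: "k \<le> 0 \<Longrightarrow> \<xi> k \<in> path_space \<rightarrow>\<^sub>M borel"
  unfolding tye_noise_def[abs_def] by (intro measurable_\<psi>inv measurable_compose[OF _ \<theta>_measurable] coord_measurable) auto

lemma noise_event:
  assumes "k \<le> 0" "A \<in> sets borel"
  shows "{\<eta> \<in> space path_space. \<xi> k \<eta> \<in> A} \<in> sets path_space"
  using measurable_sets[OF \<xi>_measurable[OF assms(1)] assms(2)] by (simp add: vimage_def Int_def conj_commute)

lemma \<xi>_measurable_past: "j \<le> k \<Longrightarrow> \<xi> j \<in> past_algebra coord k \<rightarrow>\<^sub>M borel"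
  unfolding tye_noise_def[abs_def]
  by (intro measurable_\<psi>inv measurable_compose[OF _ \<theta>_measurable] coord_measurable_past) auto

lemma tye: "\<eta> k = \<psi> (\<theta> (\<eta> (k - 1))) (\<xi> k \<eta>)"
  by (simp add: tye_noise_def)

lemma \<theta>_step: "\<theta> (\<eta> k) = \<theta> (\<eta> (k - 1)) + \<theta> (\<xi> k \<eta>)"
  by (subst tye) (rule \<theta>_\<psi>)

lemma solutions_iff:
  "P \<in> solutions \<xi> \<mu> \<longleftrightarrow> sets P = sets path_space \<and> prob_space P \<and>
    (\<forall>k\<le>0. \<forall>A\<in>sets borel. \<forall>B\<in>past coord (k - 1).
      measure P ({\<eta> \<in> space path_space. \<xi> k \<eta> \<in> A} \<inter> B) = measure (\<mu> k) A * measure P B)"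
    (is "_ \<longleftrightarrow> _ \<and> _ \<and> (\<forall>k\<le>0. ?I k)")
proof -
  have "prob_space.indep_set P {\<xi> k -` A \<inter> space path_space | A. A \<in> sets borel} (past coord (k - 1))
         \<and> distr P borel (\<xi> k) = \<mu> k \<longleftrightarrow> ?I k"
    if P: "sets P = sets path_space" "prob_space P" and k: "k \<le> 0" for k
  proof -
    interpret P: prob_space P by fact
    have sp: "space P = space path_space" using P(1) by (rule sets_eq_imp_space_eq)
    have m: "\<xi> k \<in> P \<rightarrow>\<^sub>M borel"
      using \<xi>_measurable[OF k] P(1) by (simp cong: measurable_cong_sets)
    have ev: "\<xi> k -` A \<inter> space path_space \<in> P.events" if "A \<in> sets borel" for A
      using measurable_sets[OF m that] by (simp add: sp)
    have eq: "\<xi> k -` A \<inter> space path_space = {\<eta> \<in> space path_space. \<xi> k \<eta> \<in> A}" for A by auto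
    have past: "past coord (k - 1) \<subseteq> P.events"
      unfolding P(1) using k by (intro past_coord_subset) simp
    have law: "measure (distr P borel (\<xi> k)) A = P.prob {\<eta> \<in> space path_space. \<xi> k \<eta> \<in> A}"
      if "A \<in> sets borel" for A
      using measure_distr[OF m that] by (simp add: sp eq)
    show ?thesis
    proof
      assume L: "P.indep_set {\<xi> k -` A \<inter> space path_space | A. A \<in> sets borel} (past coord (k - 1))
         \<and> distr P borel (\<xi> k) = \<mu> k"
      show "?I k"
      proof (intro ballI)
        fix A :: "'s set" and B :: "(int \<Rightarrow> 's) set" assume A: "A \<in> sets borel" and B: "B \<in> past coord (k - 1)"
        have "P.prob (\<xi> k -` A \<inter> space path_space \<inter> B)
            = P.prob (\<xi> k -` A \<inter> space path_space) * P.prob B"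
          using L A B by (intro P.indep_setD[of _ "past coord (k - 1)"]) auto
        with L law[OF A] show "P.prob ({\<eta> \<in> space path_space. \<xi> k \<eta> \<in> A} \<inter> B) = measure (\<mu> k) A * P.prob B"
          by (simp add: eq)
      qed
    next
      assume R: "?I k"
      have top: "space path_space \<in> past coord (k - 1)"
        unfolding past_def by (rule sigma_sets_top)
      have "P.prob ({\<eta> \<in> space path_space. \<xi> k \<eta> \<in> A}) = measure (\<mu> k) A" if "A \<in> sets borel" for A
      proof -
        have "{\<eta> \<in> space path_space. \<xi> k \<eta> \<in> A} \<inter> space path_space = {\<eta> \<in> space path_space. \<xi> k \<eta> \<in> A}"
          by auto
        with bspec[OF bspec[OF R that] top] show ?thesis
          using P.prob_space by (simp add: sp)
      qed
      note 1 = this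
      interpret \<mu>: prob_space "\<mu> k" using k by (rule prob_space_\<mu>)
      interpret d: prob_space "distr P borel (\<xi> k)" using m by (rule P.prob_space_distr)
      have "distr P borel (\<xi> k) = \<mu> k"
      proof (rule measure_eqI)
        fix A assume "A \<in> sets (distr P borel (\<xi> k))"
        then have "A \<in> sets borel" by simp
        then show "emeasure (distr P borel (\<xi> k)) A = emeasure (\<mu> k) A"
          using law[of A] 1[of A] by (simp add: \<mu>.emeasure_eq_measure d.emeasure_eq_measure)
      qed (simp add: sets_\<mu>[OF k])
      moreover have "P.indep_set {\<xi> k -` A \<inter> space path_space | A. A \<in> sets borel} (past coord (k - 1))"
        unfolding P.indep_sets2_eq
      proof (intro conjI ballI)
        show "{\<xi> k -` A \<inter> space path_space | A. A \<in> sets borel} \<subseteq> P.events" using ev by blast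
        show "past coord (k - 1) \<subseteq> P.events" by (rule past)
        fix a and B :: "(int \<Rightarrow> 's) set" assume "a \<in> {\<xi> k -` A \<inter> space path_space | A. A \<in> sets borel}" and B: "B \<in> past coord (k - 1)"
        then obtain A where "a = {\<eta> \<in> space path_space. \<xi> k \<eta> \<in> A}" "A \<in> sets borel"
          unfolding eq by blast
        then show "P.prob (a \<inter> B) = P.prob a * P.prob B"
          using R B 1 by simp
      qed
      ultimately show "P.indep_set {\<xi> k -` A \<inter> space path_space | A. A \<in> sets borel} (past coord (k - 1))
         \<and> distr P borel (\<xi> k) = \<mu> k" by simp
    qed
  qed
  then show ?thesis
    unfolding solutions_def space_prob_algebra by auto
qed

lemma solution_sets: "P \<in> solutions \<xi> \<mu> \<Longrightarrow> sets P = sets path_space"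
  and solution_prob_space: "P \<in> solutions \<xi> \<mu> \<Longrightarrow> prob_space P"
  by (auto simp: solutions_iff)

lemma solution_space: "P \<in> solutions \<xi> \<mu> \<Longrightarrow> space P = space path_space"
  by (rule sets_eq_imp_space_eq, rule solution_sets)

text \<open>The form of independence that feeds Fubini's theorem. With \<open>Y\<close> the identity it computes conditional
expectations given the past, with \<open>Y = \<theta> (\<eta> (k - 1))\<close> the transition from \<open>k - 1\<close> to \<open>k\<close>.\<close>

lemma solution_noise_independent:
  assumes P: "P \<in> solutions \<xi> \<mu>" and k: "k \<le> 0"
    and Y: "Y \<in> past_algebra coord (k - 1) \<rightarrow>\<^sub>M N"
  shows "distr P (N \<Otimes>\<^sub>M borel) (\<lambda>\<eta>. (Y \<eta>, \<xi> k \<eta>)) = distr P N Y \<Otimes>\<^sub>M \<mu> k"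
proof -
  interpret P: prob_space P by (rule solution_prob_space[OF P])
  interpret \<mu>: prob_space "\<mu> k" using k by (rule prob_space_\<mu>)
  note sets = solution_sets[OF P] and sp = solution_space[OF P]
  have past: "past coord (k - 1) \<subseteq> sets P"
    unfolding sets using k by (intro past_coord_subset) simp
  have mY: "Y \<in> P \<rightarrow>\<^sub>M N"
    using Y past by (auto simp: measurable_def sets_past_algebra sp)
  have m: "\<xi> k \<in> P \<rightarrow>\<^sub>M borel"
    using \<xi>_measurable[OF k] sets by (simp cong: measurable_cong_sets)
  have mp: "(\<lambda>\<eta>. (Y \<eta>, \<xi> k \<eta>)) \<in> P \<rightarrow>\<^sub>M N \<Otimes>\<^sub>M borel"
    using mY m by (rule measurable_Pair)
  interpret Y: prob_space "distr P N Y" using mY by (rule P.prob_space_distr)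
  show ?thesis
  proof (rule pair_measure_eqI[symmetric])
    show "sigma_finite_measure (distr P N Y)" "sigma_finite_measure (\<mu> k)" by unfold_locales
    show "sets (distr P N Y \<Otimes>\<^sub>M \<mu> k) = sets (distr P (N \<Otimes>\<^sub>M borel) (\<lambda>\<eta>. (Y \<eta>, \<xi> k \<eta>)))"
      unfolding sets_distr by (intro sets_pair_measure_cong) (simp_all add: sets_\<mu>[OF k])
    fix B A assume B: "B \<in> sets (distr P N Y)" and A: "A \<in> sets (\<mu> k)"
    then have B': "B \<in> sets N" and A': "A \<in> sets borel" using sets_\<mu>[OF k] by auto
    have pre: "Y -` B \<inter> space path_space \<in> past coord (k - 1)"
      using measurable_sets[OF Y B'] by (simp add: sets_past_algebra)
    have "(\<lambda>\<eta>. (Y \<eta>, \<xi> k \<eta>)) -` (B \<times> A) \<inter> space P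
        = {\<eta> \<in> space path_space. \<xi> k \<eta> \<in> A} \<inter> (Y -` B \<inter> space path_space)"
      by (auto simp: sp)
    moreover have "P.prob ({\<eta> \<in> space path_space. \<xi> k \<eta> \<in> A} \<inter> (Y -` B \<inter> space path_space))
        = measure (\<mu> k) A * P.prob (Y -` B \<inter> space path_space)"
      using P k A' pre by (auto simp: solutions_iff)
    ultimately show "emeasure (distr P N Y) B * emeasure (\<mu> k) A
        = emeasure (distr P (N \<Otimes>\<^sub>M borel) (\<lambda>\<eta>. (Y \<eta>, \<xi> k \<eta>))) (B \<times> A)"
      using A' B' mY mp
      by (subst (1 2) emeasure_distr)
        (auto simp: sp P.emeasure_eq_measure \<mu>.emeasure_eq_measure mult.commute ennreal_mult[symmetric])
  qed
qed

definition theta_at :: "(int \<Rightarrow> 's) measure \<Rightarrow> int \<Rightarrow> 'g measure" where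
  "theta_at P n = distr P borel (\<lambda>\<eta>. \<theta> (\<eta> n))"

lemma theta_past_measurable: "j \<le> k \<Longrightarrow> (\<lambda>\<eta>. \<theta> (\<eta> j)) \<in> past_algebra coord k \<rightarrow>\<^sub>M borel"
  by (intro measurable_compose[OF _ \<theta>_measurable] coord_measurable_past)

lemma measurable_from_solution:
  assumes "P \<in> solutions \<xi> \<mu>"
  shows "f \<in> P \<rightarrow>\<^sub>M N \<longleftrightarrow> f \<in> path_space \<rightarrow>\<^sub>M N"
  by (simp only: measurable_cong_sets[OF solution_sets[OF assms] refl])

lemma measurable_from_past:
  assumes "f \<in> past_algebra coord k \<rightarrow>\<^sub>M N" "k \<le> 0"
  shows "f \<in> path_space \<rightarrow>\<^sub>M N"
  using assms past_coord_subset[of k] by (auto simp: measurable_def sets_past_algebra)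

lemma distr_coord_step:
  assumes P: "P \<in> solutions \<xi> \<mu>" and n: "n \<le> 0"
  shows "distr P borel (\<lambda>\<eta>. \<eta> n) = distr (theta_at P (n - 1) \<Otimes>\<^sub>M \<mu> n) borel (case_prod \<psi>)"
proof -
  have m: "(\<lambda>\<eta>. (\<theta> (\<eta> (n - 1)), \<xi> n \<eta>)) \<in> P \<rightarrow>\<^sub>M borel \<Otimes>\<^sub>M borel"
    unfolding measurable_from_solution[OF P] using n
    by (intro measurable_Pair \<xi>_measurable measurable_compose[OF _ \<theta>_measurable] coord_measurable) auto
  have "theta_at P (n - 1) \<Otimes>\<^sub>M \<mu> n = distr P (borel \<Otimes>\<^sub>M borel) (\<lambda>\<eta>. (\<theta> (\<eta> (n - 1)), \<xi> n \<eta>))"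
    unfolding theta_at_def
    by (rule solution_noise_independent[OF P n theta_past_measurable, symmetric]) simp
  then have "distr (theta_at P (n - 1) \<Otimes>\<^sub>M \<mu> n) borel (case_prod \<psi>)
      = distr P borel (case_prod \<psi> \<circ> (\<lambda>\<eta>. (\<theta> (\<eta> (n - 1)), \<xi> n \<eta>)))"
    using distr_distr[OF \<psi>_measurable m] by simp
  also have "case_prod \<psi> \<circ> (\<lambda>\<eta>. (\<theta> (\<eta> (n - 1)), \<xi> n \<eta>)) = (\<lambda>\<eta>. \<eta> n)"
    by (rule ext) (simp add: tye[symmetric])
  finally show ?thesis by simp
qed

end

section \<open>A solution is determined by the laws of its group components\<close>

text \<open>The value at time \<open>n + m\<close> of the path that starts at time \<open>n\<close> with \<open>x n\<close> and is driven by the noise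
\<open>x (n + 1), x (n + 2), \<dots>\<close>.\<close>

primrec run :: "('s \<Rightarrow> 'g) \<Rightarrow> ('g \<Rightarrow> 's \<Rightarrow> 's) \<Rightarrow> int \<Rightarrow> (int \<Rightarrow> 's) \<Rightarrow> nat \<Rightarrow> 's" where
  "run \<theta> \<psi> n x 0 = x n"
| "run \<theta> \<psi> n x (Suc m) = \<psi> (\<theta> (run \<theta> \<psi> n x m)) (x (n + int (Suc m)))"

context tsirelson_yor
begin

text \<open>The code of a window consists of its first coordinate and the later noise. The coordinates of the
code are independent, so that its law is a product measure.\<close>

definition encode :: "int \<Rightarrow> (int \<Rightarrow> 's) \<Rightarrow> int \<Rightarrow> 's" where
  "encode n \<eta> = (\<lambda>j\<in>{n..0}. if j = n then \<eta> n else \<xi> j \<eta>)"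

definition decode :: "int \<Rightarrow> (int \<Rightarrow> 's) \<Rightarrow> int \<Rightarrow> 's" where
  "decode n x = (\<lambda>j\<in>{n..0}. run \<theta> \<psi> n x (nat (j - n)))"

definition window_laws :: "int \<Rightarrow> 's measure \<Rightarrow> int \<Rightarrow> 's measure" where
  "window_laws n \<nu> j = (if n < j \<and> j \<le> 0 then \<mu> j else \<nu>)"

lemma run_encode:
  assumes "n + int m \<le> 0"
  shows "run \<theta> \<psi> n (encode n \<eta>) m = \<eta> (n + int m)"
  using assms
proof (induction m)
  case 0
  then show ?case by (simp add: encode_def)
next
  case (Suc m)
  then have "run \<theta> \<psi> n (encode n \<eta>) m = \<eta> (n + int m)" by simp
  moreover have "encode n \<eta> (n + int (Suc m)) = \<xi> (n + int (Suc m)) \<eta>"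
    using Suc.prems by (simp add: encode_def)
  ultimately show ?case
    using tye[of \<eta> "n + int (Suc m)"] by simp
qed

lemma decode_encode: "decode n (encode n \<eta>) = restrict \<eta> {n..0}"
  unfolding decode_def by (rule restrict_ext) (simp add: run_encode)

lemma run_measurable:
  assumes "n + int m \<le> 0"
  shows "(\<lambda>x. run \<theta> \<psi> n x m) \<in> PiM {n..0} (\<lambda>_. borel) \<rightarrow>\<^sub>M borel"
  using assms
proof (induction m)
  case 0
  then show ?case by (simp add: measurable_component_singleton)
next
  case (Suc m)
  have "(\<lambda>x. x (n + int (Suc m))) \<in> PiM {n..0} (\<lambda>_. borel :: 's measure) \<rightarrow>\<^sub>M borel"
    using Suc.prems by (intro measurable_component_singleton) simp
  with Suc show ?case
    by (auto simp del: of_nat_Suc intro!: measurable_\<psi> measurable_compose[OF _ \<theta>_measurable])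
qed

lemma decode_measurable: "decode n \<in> PiM {n..0} (\<lambda>_. borel) \<rightarrow>\<^sub>M PiM {n..0} (\<lambda>_. borel)"
  unfolding decode_def[abs_def]
  by (rule measurable_restrict) (rule run_measurable, simp)

lemma encode_measurable: "n \<le> 0 \<Longrightarrow> encode n \<in> path_space \<rightarrow>\<^sub>M PiM {n..0} (\<lambda>_. borel)"
  unfolding encode_def[abs_def]
  by (rule measurable_restrict) (auto intro: \<xi>_measurable coord_measurable)

lemma restrict_measurable_path: "n \<le> 0 \<Longrightarrow> (\<lambda>\<eta>. restrict \<eta> {n..0}) \<in> path_space \<rightarrow>\<^sub>M PiM {n..0} (\<lambda>_. borel)"
  unfolding path_space_def by (rule measurable_restrict_subset) simp

lemma prob_space_window_laws: "prob_space \<nu> \<Longrightarrow> prob_space (window_laws n \<nu> j)"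
  by (simp add: window_laws_def prob_space_\<mu>)

lemma sets_window_laws: "sets \<nu> = sets borel \<Longrightarrow> sets (window_laws n \<nu> j) = sets borel"
  by (simp add: window_laws_def sets_\<mu>)

lemma product_prob_space_window_laws: "prob_space \<nu> \<Longrightarrow> product_prob_space (window_laws n \<nu>)"
  by (intro product_prob_spaceI prob_space_window_laws)

lemma sets_PiM_window_laws:
  "sets \<nu> = sets borel \<Longrightarrow> sets (PiM {n..0} (window_laws n \<nu>)) = sets (PiM {n..0} (\<lambda>_. borel))"
  by (intro sets_PiM_cong refl sets_window_laws)

text \<open>By induction on the upper end of the window, the newest noise variable being independent of the rest.\<close>

lemma prob_encode_box:
  assumes P: "P \<in> solutions \<xi> \<mu>" and nm: "n \<le> m" "m \<le> 0" and A: "\<And>j. A j \<in> sets borel"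
  shows "measure P {\<eta> \<in> space path_space. \<eta> n \<in> A n \<and> (\<forall>j\<in>{n<..m}. \<xi> j \<eta> \<in> A j)}
    = measure P {\<eta> \<in> space path_space. \<eta> n \<in> A n} * (\<Prod>j\<in>{n<..m}. measure (\<mu> j) (A j))"
  using nm
proof (induction m rule: int_ge_induct)
  case base
  then show ?case by simp
next
  case (step m)
  let ?B = "{\<eta> \<in> space path_space. \<eta> n \<in> A n \<and> (\<forall>j\<in>{n<..m}. \<xi> j \<eta> \<in> A j)}"
  have Collect: "{\<eta> \<in> space path_space. f \<eta> \<in> X} \<in> past coord m"
    if "f \<in> past_algebra coord m \<rightarrow>\<^sub>M borel" "X \<in> sets borel" for f :: "(int \<Rightarrow> 's) \<Rightarrow> 's" and X
    using measurable_sets[OF that] by (simp add: sets_past_algebra vimage_def Int_def conj_commute)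
  have "?B = {\<eta> \<in> space (past_algebra coord m). (\<eta> n \<in> A n) \<and> (\<forall>j\<in>{n<..m}. \<xi> j \<eta> \<in> A j)}"
    by simp
  also have "\<dots> \<in> sets (past_algebra coord m)"
  proof (intro sets.sets_Collect_conj sets.sets_Collect_finite_All)
    show "{\<eta> \<in> space (past_algebra coord m). \<eta> n \<in> A n} \<in> sets (past_algebra coord m)"
      using Collect[OF coord_measurable_past[OF step.hyps(1)] A] by (simp add: sets_past_algebra)
    fix j assume "j \<in> {n<..m}"
    then have "\<xi> j \<in> past_algebra coord m \<rightarrow>\<^sub>M borel" by (intro \<xi>_measurable_past) simp
    from Collect[OF this A]
    show "{\<eta> \<in> space (past_algebra coord m). \<xi> j \<eta> \<in> A j} \<in> sets (past_algebra coord m)"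
      by (simp add: sets_past_algebra)
  qed auto
  finally have B: "?B \<in> past coord (m + 1 - 1)" by (simp add: sets_past_algebra)
  have ivl: "{n<..m + 1} = insert (m + 1) {n<..m}" using step.hyps by auto
  have "measure P ({\<eta> \<in> space path_space. \<xi> (m + 1) \<eta> \<in> A (m + 1)} \<inter> ?B)
      = measure (\<mu> (m + 1)) (A (m + 1)) * measure P ?B"
    using P step.prems A B unfolding solutions_iff by blast
  moreover have "{\<eta> \<in> space path_space. \<xi> (m + 1) \<eta> \<in> A (m + 1)} \<inter> ?B
      = {\<eta> \<in> space path_space. \<eta> n \<in> A n \<and> (\<forall>j\<in>{n<..m + 1}. \<xi> j \<eta> \<in> A j)}"
    unfolding ivl by auto
  moreover have "measure P ?B
      = measure P {\<eta> \<in> space path_space. \<eta> n \<in> A n} * (\<Prod>j\<in>{n<..m}. measure (\<mu> j) (A j))"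
    using step by simp
  ultimately show ?case
    unfolding ivl by simp
qed

lemma distr_encode:
  assumes P: "P \<in> solutions \<xi> \<mu>" and n: "n \<le> 0"
  shows "distr P (PiM {n..0} (\<lambda>_. borel)) (encode n)
    = PiM {n..0} (window_laws n (distr P borel (\<lambda>\<eta>. \<eta> n)))" (is "?D = PiM _ (window_laws n ?\<nu>)")
proof -
  interpret P: prob_space P by (rule solution_prob_space[OF P])
  note sp = solution_space[OF P]
  have mn: "(\<lambda>\<eta>. \<eta> n) \<in> P \<rightarrow>\<^sub>M borel"
    unfolding measurable_from_solution[OF P] using n by (rule coord_measurable)
  have me: "encode n \<in> P \<rightarrow>\<^sub>M PiM {n..0} (\<lambda>_. borel)"
    unfolding measurable_from_solution[OF P] using n by (rule encode_measurable)
  interpret \<nu>: prob_space ?\<nu> using mn by (rule P.prob_space_distr)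
  interpret W: product_prob_space "window_laws n ?\<nu>"
    by (rule product_prob_space_window_laws) unfold_locales
  show ?thesis
  proof (rule W.PiM_eqI)
    show "sets ?D = sets (PiM {n..0} (window_laws n ?\<nu>))"
      by (simp add: sets_PiM_window_laws)
    fix A' assume h: "\<And>j. j \<in> {n..0} \<Longrightarrow> A' j \<in> sets (window_laws n ?\<nu> j)"
    then have A': "A' j \<in> sets borel" if "j \<in> {n..0}" for j
    proof -
      from h[OF that] have "A' j \<in> sets (window_laws n ?\<nu> j)" .
      then show ?thesis by (simp only: sets_window_laws[OF sets_distr])
    qed
    define A where "A j = (if j \<in> {n..0} then A' j else {})" for j
    have A: "A j \<in> sets borel" for j using A'[of j] by (simp add: A_def)
    have box: "Pi\<^sub>E {n..0} A' = Pi\<^sub>E {n..0} A" by (rule PiE_cong) (simp add: A_def)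
    have box_sets: "Pi\<^sub>E {n..0} A \<in> sets (PiM {n..0} (\<lambda>_. borel))"
      using A by (intro sets_PiM_I_finite) auto
    have ivl: "{n..0} = insert n {n<..0}" using n by auto
    have "encode n -` Pi\<^sub>E {n..0} A \<inter> space P
        = {\<eta> \<in> space path_space. \<eta> n \<in> A n \<and> (\<forall>j\<in>{n<..0}. \<xi> j \<eta> \<in> A j)}"
      unfolding sp encode_def vimage_def mem_Collect_eq restrict_PiE_iff ivl by auto
    then have "measure P (encode n -` Pi\<^sub>E {n..0} A \<inter> space P)
        = measure P {\<eta> \<in> space path_space. \<eta> n \<in> A n} * (\<Prod>j\<in>{n<..0}. measure (\<mu> j) (A j))"
      using prob_encode_box[OF P n _ A] by simp
    also have "measure P {\<eta> \<in> space path_space. \<eta> n \<in> A n} = measure ?\<nu> (A n)"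
      using A mn by (subst measure_distr) (auto simp: sp intro!: arg_cong[where f="measure P"])
    also have "\<dots> * (\<Prod>j\<in>{n<..0}. measure (\<mu> j) (A j)) = (\<Prod>j\<in>{n..0}. measure (window_laws n ?\<nu> j) (A j))"
      unfolding ivl by (subst prod.insert) (auto simp: window_laws_def intro!: prod.cong)
    finally have "emeasure ?D (Pi\<^sub>E {n..0} A) = (\<Prod>j\<in>{n..0}. emeasure (window_laws n ?\<nu> j) (A j))"
      by (simp only: emeasure_distr[OF me box_sets] P.emeasure_eq_measure W.M.emeasure_eq_measure
          prod_ennreal[OF measure_nonneg])
    also have "\<dots> = (\<Prod>j\<in>{n..0}. emeasure (window_laws n ?\<nu> j) (A' j))"
      by (rule prod.cong) (simp_all add: A_def)
    finally show "emeasure ?D (Pi\<^sub>E {n..0} A') = (\<Prod>j\<in>{n..0}. emeasure (window_laws n ?\<nu> j) (A' j))"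
      unfolding box .
  qed simp
qed

lemma distr_window:
  assumes P: "P \<in> solutions \<xi> \<mu>" and n: "n \<le> 0"
  shows "distr P (PiM {n..0} (\<lambda>_. borel)) (\<lambda>\<eta>. restrict \<eta> {n..0})
    = distr (PiM {n..0} (window_laws n (distr P borel (\<lambda>\<eta>. \<eta> n)))) (PiM {n..0} (\<lambda>_. borel)) (decode n)"
proof -
  have me: "encode n \<in> P \<rightarrow>\<^sub>M PiM {n..0} (\<lambda>_. borel)"
    unfolding measurable_from_solution[OF P] using n by (rule encode_measurable)
  show ?thesis
    unfolding distr_encode[OF P n, symmetric] distr_distr[OF decode_measurable me]
    by (simp add: comp_def decode_encode)
qed

lemma measure_path_space_eqI:
  fixes P Q :: "(int \<Rightarrow> 's) measure"
  assumes P: "prob_space P" "sets P = sets path_space" and Q: "sets Q = sets path_space"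
    and eq: "\<And>n. n \<le> 0 \<Longrightarrow> distr P (PiM {n..0} (\<lambda>_. borel)) (\<lambda>\<eta>. restrict \<eta> {n..0})
      = distr Q (PiM {n..0} (\<lambda>_. borel)) (\<lambda>\<eta>. restrict \<eta> {n..0})"
  shows "P = Q"
proof (rule measure_eqI_PiM_infinite)
  show "sets P = sets (PiM {..0} (\<lambda>_. borel))" "sets Q = sets (PiM {..0} (\<lambda>_. borel))"
    using P Q by (simp_all add: path_space_def)
  show "finite_measure P" using P(1) by (rule prob_space.finite_measure)
  fix A :: "int \<Rightarrow> 's set" and J :: "int set"
  assume J: "finite J" "J \<subseteq> {..0}" and A: "\<And>i. i \<in> J \<Longrightarrow> A i \<in> sets borel"
  define n where "n = Min (insert 0 J)"
  have n: "n \<le> 0" "J \<subseteq> {n..0}" using J by (auto simp: n_def)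
  let ?W = "PiM {n..0} (\<lambda>_. borel) :: (int \<Rightarrow> 's) measure"
  have box: "prod_emb {n..0} (\<lambda>_. borel) J (Pi\<^sub>E J A) \<in> sets ?W"
    using J A n by (intro measurable_prod_emb sets_PiM_I_finite) auto
  have pre: "(\<lambda>\<eta>. restrict \<eta> {n..0}) -` prod_emb {n..0} (\<lambda>_. borel) J (Pi\<^sub>E J A) \<inter> space path_space
      = prod_emb {..0} (\<lambda>_. borel) J (Pi\<^sub>E J A)"
    using n by (auto simp: prod_emb_def path_space_def space_PiM Int_absorb1 PiE_iff)
  have m: "(\<lambda>\<eta>. restrict \<eta> {n..0}) \<in> M \<rightarrow>\<^sub>M ?W" if "sets M = sets path_space" for M
    using restrict_measurable_path[OF n(1)] measurable_cong_sets[OF that refl] by blast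
  have "emeasure M (prod_emb {..0} (\<lambda>_. borel) J (Pi\<^sub>E J A))
      = emeasure (distr M ?W (\<lambda>\<eta>. restrict \<eta> {n..0})) (prod_emb {n..0} (\<lambda>_. borel) J (Pi\<^sub>E J A))"
    if "sets M = sets path_space" for M
    unfolding emeasure_distr[OF m[OF that] box] sets_eq_imp_space_eq[OF that] pre ..
  then show "emeasure P (prod_emb {..0} (\<lambda>_. borel) J (Pi\<^sub>E J A))
      = emeasure Q (prod_emb {..0} (\<lambda>_. borel) J (Pi\<^sub>E J A))"
    using P Q eq[OF n(1)] by simp
qed

text \<open>By \<open>distr_coord_step\<close> the law of \<open>\<theta> (\<eta> (n - 1))\<close> gives that of \<open>\<eta> n\<close>, by \<open>distr_window\<close> this gives
the law of the window from \<open>n\<close> on, and the windows generate path space.\<close>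

theorem solution_unique:
  assumes P: "P \<in> solutions \<xi> \<mu>" and Q: "Q \<in> solutions \<xi> \<mu>"
    and eq: "\<And>n. n \<le> 0 \<Longrightarrow> theta_at P n = theta_at Q n"
  shows "P = Q"
proof (rule measure_path_space_eqI)
  show "prob_space P" "sets P = sets path_space" "sets Q = sets path_space"
    using P Q by (simp_all add: solutions_iff)
  fix n :: int assume n: "n \<le> 0"
  then have "distr P borel (\<lambda>\<eta>. \<eta> n) = distr Q borel (\<lambda>\<eta>. \<eta> n)"
    using eq[of "n - 1"] by (simp add: distr_coord_step[OF P n] distr_coord_step[OF Q n])
  then show "distr P (PiM {n..0} (\<lambda>_. borel)) (\<lambda>\<eta>. restrict \<eta> {n..0})
      = distr Q (PiM {n..0} (\<lambda>_. borel)) (\<lambda>\<eta>. restrict \<eta> {n..0})"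
    by (simp add: distr_window[OF P n] distr_window[OF Q n])
qed

end

section \<open>Existence\<close>

text \<open>A coordinate of a product measure is independent of any event that does not depend on it. The event is
given by a predicate, because in the applications it is a condition on \<open>decode n x\<close>.\<close>

lemma (in product_prob_space) emeasure_PiM_coordinate_independent:
  assumes I: "finite J" "i \<notin> J" and A: "A \<in> sets (M i)"
    and Q: "{x \<in> space (PiM (insert i J) M). Q x} \<in> sets (PiM (insert i J) M)"
    and indep: "\<And>x y. Q (x(i := y)) = Q x"
  shows "emeasure (PiM (insert i J) M) {x \<in> space (PiM (insert i J) M). x i \<in> A \<and> Q x}
    = emeasure (M i) A * emeasure (PiM (insert i J) M) {x \<in> space (PiM (insert i J) M). Q x}"
proof -
  let ?P = "PiM (insert i J) M"
  define c where "c = (\<integral>\<^sup>+x. indicator {x. Q x} x \<partial>PiM J M)"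
  have *: "emeasure ?P {x \<in> space ?P. x i \<in> A \<and> Q x} = emeasure (M i) A * c" if A: "A \<in> sets (M i)" for A
  proof -
    have "{x \<in> space ?P. x i \<in> A} \<in> sets ?P"
      using measurable_sets[OF measurable_component_singleton[of i "insert i J" M] A]
      by (simp add: vimage_def Int_def conj_commute)
    from sets.Int[OF this Q] have S: "{x \<in> space ?P. x i \<in> A \<and> Q x} \<in> sets ?P"
      by (simp add: Int_def conj_ac cong: conj_cong)
    have "emeasure ?P {x \<in> space ?P. x i \<in> A \<and> Q x}
        = (\<integral>\<^sup>+x. indicator {x \<in> space ?P. x i \<in> A \<and> Q x} x \<partial>?P)"
      using S by simp
    also have "\<dots> = (\<integral>\<^sup>+y. (\<integral>\<^sup>+x. indicator {x \<in> space ?P. x i \<in> A \<and> Q x} (x(i := y)) \<partial>PiM J M) \<partial>M i)"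
      using S by (intro product_nn_integral_insert_rev I) simp
    also have "\<dots> = (\<integral>\<^sup>+y. (\<integral>\<^sup>+x. indicator A y * indicator {x. Q x} x \<partial>PiM J M) \<partial>M i)"
    proof (intro nn_integral_cong)
      fix y x assume "y \<in> space (M i)" "x \<in> space (PiM J M)"
      then have "x(i := y) \<in> space ?P"
        by (auto simp: space_PiM PiE_iff extensional_def)
      then show "indicator {x \<in> space ?P. x i \<in> A \<and> Q x} (x(i := y))
          = (indicator A y * indicator {x. Q x} x :: ennreal)"
        by (auto simp: indep split: split_indicator)
    qed
    also have "\<dots> = (\<integral>\<^sup>+y. indicator A y * c \<partial>M i)"
    proof (rule nn_integral_cong)
      fix y assume y: "y \<in> space (M i)"
      show "(\<integral>\<^sup>+x. indicator A y * indicator {x. Q x} x \<partial>PiM J M) = indicator A y * c"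
        unfolding c_def by (cases "y \<in> A") simp_all
    qed
    also have "\<dots> = emeasure (M i) A * c"
      using A by (subst nn_integral_multc) auto
    finally show ?thesis .
  qed
  have "{x \<in> space ?P. x i \<in> space (M i) \<and> Q x} = {x \<in> space ?P. Q x}"
    by (auto simp: space_PiM)
  with *[OF sets.top] have "emeasure ?P {x \<in> space ?P. Q x} = c"
    using M.emeasure_space_1[of i] by simp
  with *[OF A] show ?thesis by simp
qed

context tsirelson_yor
begin

text \<open>The law that \<open>\<eta> n\<close> must have if \<open>\<theta> (\<eta> (n - 1))\<close> has law \<open>\<Lambda> (n - 1)\<close>, cf. \<open>distr_coord_step\<close>.\<close>

definition start_law :: "(int \<Rightarrow> 'g measure) \<Rightarrow> int \<Rightarrow> 's measure" where
  "start_law \<Lambda> n = distr (\<Lambda> (n - 1) \<Otimes>\<^sub>M \<mu> n) borel (case_prod \<psi>)"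

definition window :: "(int \<Rightarrow> 'g measure) \<Rightarrow> int \<Rightarrow> (int \<Rightarrow> 's) measure" where
  "window \<Lambda> n = distr (PiM {n..0} (window_laws n (start_law \<Lambda> n))) (PiM {n..0} (\<lambda>_. borel)) (decode n)"

text \<open>The necessary condition on the laws of the group components of a solution; \<open>solution_exists\<close> shows
that it is sufficient.\<close>

definition consistent_laws :: "(int \<Rightarrow> 'g measure) \<Rightarrow> bool" where
  "consistent_laws \<Lambda> \<longleftrightarrow> (\<forall>n\<le>0. sets (\<Lambda> n) = sets borel \<and> prob_space (\<Lambda> n)
     \<and> \<Lambda> n = distr (\<Lambda> (n - 1) \<Otimes>\<^sub>M \<mu> n) borel (\<lambda>(g, s). g + \<theta> s))"

lemma consistent_lawsD:
  assumes "consistent_laws \<Lambda>" "n \<le> 0"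
  shows "sets (\<Lambda> n) = sets borel" "prob_space (\<Lambda> n)"
    "distr (\<Lambda> (n - 1) \<Otimes>\<^sub>M \<mu> n) borel (\<lambda>(g, s). g + \<theta> s) = \<Lambda> n"
  using assms unfolding consistent_laws_def by (blast, blast, metis)

lemma consistent_pair:
  assumes "consistent_laws \<Lambda>" "n \<le> 0"
  shows "sets (\<Lambda> (n - 1) \<Otimes>\<^sub>M \<mu> n) = sets (borel \<Otimes>\<^sub>M borel)" "prob_space (\<Lambda> (n - 1) \<Otimes>\<^sub>M \<mu> n)"
proof -
  have "sets (\<Lambda> (n - 1)) = sets borel" and p: "prob_space (\<Lambda> (n - 1))"
    using consistent_lawsD[OF assms(1), of "n - 1"] assms(2) by simp_all
  then show "sets (\<Lambda> (n - 1) \<Otimes>\<^sub>M \<mu> n) = sets (borel \<Otimes>\<^sub>M borel)"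
    using assms(2) by (intro sets_pair_measure_cong sets_\<mu>)
  interpret a: prob_space "\<Lambda> (n - 1)" by (rule p)
  interpret b: prob_space "\<mu> n" by (rule prob_space_\<mu>[OF assms(2)])
  interpret pair_prob_space "\<Lambda> (n - 1)" "\<mu> n" ..
  show "prob_space (\<Lambda> (n - 1) \<Otimes>\<^sub>M \<mu> n)" by unfold_locales
qed

lemma start_law_props:
  assumes "consistent_laws \<Lambda>" "n \<le> 0"
  shows "prob_space (start_law \<Lambda> n)" "sets (start_law \<Lambda> n) = sets borel"
    "distr (start_law \<Lambda> n) borel \<theta> = \<Lambda> n"
proof -
  note pair = consistent_pair[OF assms]
  have m: "case_prod \<psi> \<in> (\<Lambda> (n - 1) \<Otimes>\<^sub>M \<mu> n) \<rightarrow>\<^sub>M borel"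
    using \<psi>_measurable by (simp only: measurable_cong_sets[OF pair(1) refl])
  show "prob_space (start_law \<Lambda> n)"
    unfolding start_law_def using pair(2) m by (rule prob_space.prob_space_distr)
  show "sets (start_law \<Lambda> n) = sets borel" by (simp add: start_law_def)
  have "distr (start_law \<Lambda> n) borel \<theta> = distr (\<Lambda> (n - 1) \<Otimes>\<^sub>M \<mu> n) borel (\<theta> \<circ> case_prod \<psi>)"
    unfolding start_law_def using m by (rule distr_distr[OF \<theta>_measurable])
  also have "\<theta> \<circ> case_prod \<psi> = (\<lambda>(g, s). g + \<theta> s)" by (auto simp: \<theta>_\<psi>)
  also have "distr (\<Lambda> (n - 1) \<Otimes>\<^sub>M \<mu> n) borel (\<lambda>(g, s). g + \<theta> s) = \<Lambda> n"
    by (rule consistent_lawsD(3)[OF assms])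
  finally show "distr (start_law \<Lambda> n) borel \<theta> = \<Lambda> n" .
qed

lemma product_prob_space_start_law:
  "consistent_laws \<Lambda> \<Longrightarrow> n \<le> 0 \<Longrightarrow> product_prob_space (window_laws n (start_law \<Lambda> n))"
  by (intro product_prob_space_window_laws start_law_props)

lemma decode_measurable_window:
  assumes "consistent_laws \<Lambda>" "n \<le> 0"
  shows "decode n \<in> PiM {n..0} (window_laws n (start_law \<Lambda> n)) \<rightarrow>\<^sub>M PiM {n..0} (\<lambda>_. borel)"
  using decode_measurable[of n]
  by (simp only: measurable_cong_sets[OF sets_PiM_window_laws[OF start_law_props(2)[OF assms]] refl])

lemma prob_space_window:
  assumes "consistent_laws \<Lambda>" "n \<le> 0"
  shows "prob_space (window \<Lambda> n)"
proof -
  have "prob_space (PiM {n..0} (window_laws n (start_law \<Lambda> n)))"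
    by (intro prob_space_PiM prob_space_window_laws start_law_props assms)
  then show ?thesis
    unfolding window_def using decode_measurable_window[OF assms] by (rule prob_space.prob_space_distr)
qed

lemma sets_window: "sets (window \<Lambda> n) = sets (PiM {n..0} (\<lambda>_. borel))"
  by (simp add: window_def)

text \<open>Running the equation for one step turns the code of a window from time \<open>n - 1\<close> on into that of the
window from time \<open>n\<close> on.\<close>

definition advance :: "int \<Rightarrow> (int \<Rightarrow> 's) \<Rightarrow> int \<Rightarrow> 's" where
  "advance n x = (\<lambda>j\<in>{n..0}. if j = n then \<psi> (\<theta> (x (n - 1))) (x n) else x j)"

lemma run_advance:
  assumes "n + int m \<le> 0"
  shows "run \<theta> \<psi> n (advance n x) m = run \<theta> \<psi> (n - 1) x (Suc m)"
  using assms
proof (induction m)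
  case 0
  then show ?case by (simp add: advance_def)
next
  case (Suc m)
  have eq: "n - 1 + int (Suc (Suc m)) = n + int (Suc m)" by simp
  have "advance n x (n + int (Suc m)) = x (n - 1 + int (Suc (Suc m)))"
    unfolding eq using Suc.prems by (simp add: advance_def del: of_nat_Suc)
  moreover have "run \<theta> \<psi> n (advance n x) m = run \<theta> \<psi> (n - 1) x (Suc m)"
    using Suc by simp
  ultimately show ?case
    by (simp only: run.simps(2))
qed

lemma decode_advance:
  assumes "n \<le> 0"
  shows "restrict (decode (n - 1) x) {n..0} = decode n (advance n x)"
proof (rule ext)
  fix j
  show "restrict (decode (n - 1) x) {n..0} j = decode n (advance n x) j"
  proof (cases "j \<in> {n..0}")
    case True
    then have "nat (j - (n - 1)) = Suc (nat (j - n))" "n + int (nat (j - n)) \<le> 0" by auto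
    with True show ?thesis by (simp add: decode_def run_advance del: run.simps)
  qed (auto simp: decode_def)
qed

lemma advance_measurable:
  assumes "n \<le> 0"
  shows "advance n \<in> PiM {n - 1..0} (\<lambda>_. borel) \<rightarrow>\<^sub>M PiM {n..0} (\<lambda>_. borel)"
  unfolding advance_def[abs_def]
proof (rule measurable_restrict)
  fix j assume j: "j \<in> {n..0}"
  have m: "(\<lambda>x. x i) \<in> PiM {n - 1..0} (\<lambda>_. borel :: 's measure) \<rightarrow>\<^sub>M borel" if "i \<in> {n - 1..0}" for i
    using that by (rule measurable_component_singleton)
  show "(\<lambda>x. if j = n then \<psi> (\<theta> (x (n - 1))) (x n) else x j) \<in> PiM {n - 1..0} (\<lambda>_. borel) \<rightarrow>\<^sub>M borel"
    using j assms by (cases "j = n") (auto intro!: measurable_\<psi> measurable_compose[OF _ \<theta>_measurable] m)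
qed

text \<open>The first two coordinates of the code have the laws \<open>start_law \<Lambda> (n - 1)\<close>, with image \<open>\<Lambda> (n - 1)\<close>
under \<open>\<theta>\<close>, and \<open>\<mu> n\<close>; so they merge into a variable with law \<open>start_law \<Lambda> n\<close>. The other coordinates
are untouched and independent of them.\<close>

lemma distr_advance:
  assumes \<Lambda>: "consistent_laws \<Lambda>" and n: "n \<le> 0"
  shows "distr (PiM {n - 1..0} (window_laws (n - 1) (start_law \<Lambda> (n - 1)))) (PiM {n..0} (\<lambda>_. borel)) (advance n)
    = PiM {n..0} (window_laws n (start_law \<Lambda> n))" (is "?D = ?R")
proof -
  let ?\<nu>' = "start_law \<Lambda> (n - 1)" and ?\<nu> = "start_law \<Lambda> n"
  let ?M = "window_laws (n - 1) ?\<nu>'"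
  have n': "n - 1 \<le> 0" using n by simp
  interpret V: product_prob_space ?M by (rule product_prob_space_start_law[OF \<Lambda> n'])
  interpret W: product_prob_space "window_laws n ?\<nu>" by (rule product_prob_space_start_law[OF \<Lambda> n])
  interpret \<nu>: prob_space ?\<nu> by (rule start_law_props(1)[OF \<Lambda> n])
  note sM = sets_window_laws[OF start_law_props(2)[OF \<Lambda> n'], of "n - 1"]
  note sP = sets_PiM_window_laws[OF start_law_props(2)[OF \<Lambda> n'], of "n - 1"]
  have mJ: "advance n \<in> PiM {n - 1..0} ?M \<rightarrow>\<^sub>M PiM {n..0} (\<lambda>_. borel)"
    using advance_measurable[OF n] by (simp only: measurable_cong_sets[OF sP refl])
  let ?I = "{n - 1, n}" and ?J = "{n<..0}"
  have ivl: "{n - 1..0} = ?I \<union> ?J" "{n..0} = insert n ?J" using n by auto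
  have step: "distr (?M (n - 1) \<Otimes>\<^sub>M ?M n) borel (\<lambda>(x, y). \<psi> (\<theta> x) y) = ?\<nu>"
  proof -
    have M: "?M (n - 1) = ?\<nu>'" "?M n = \<mu> n" using n by (auto simp: window_laws_def)
    interpret a: prob_space ?\<nu>' by (rule start_law_props(1)[OF \<Lambda> n'])
    interpret b: prob_space "\<mu> n" by (rule prob_space_\<mu>[OF n])
    have s: "sets (?\<nu>' \<Otimes>\<^sub>M \<mu> n) = sets (borel \<Otimes>\<^sub>M borel)"
      using n by (intro sets_pair_measure_cong sets_\<mu> start_law_props(2)[OF \<Lambda> n'])
    have \<theta>': "\<theta> \<in> ?\<nu>' \<rightarrow>\<^sub>M borel"
      using \<theta>_measurable by (simp only: measurable_cong_sets[OF start_law_props(2)[OF \<Lambda> n'] refl])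
    have eq: "\<Lambda> (n - 1) \<Otimes>\<^sub>M \<mu> n = distr (?\<nu>' \<Otimes>\<^sub>M \<mu> n) (borel \<Otimes>\<^sub>M \<mu> n) (\<lambda>(x, y). (\<theta> x, y))"
    proof -
      interpret l: prob_space "distr ?\<nu>' borel \<theta>" using \<theta>' by (rule a.prob_space_distr)
      have "distr ?\<nu>' borel \<theta> \<Otimes>\<^sub>M distr (\<mu> n) (\<mu> n) (\<lambda>y. y)
          = distr (?\<nu>' \<Otimes>\<^sub>M \<mu> n) (borel \<Otimes>\<^sub>M \<mu> n) (\<lambda>(x, y). (\<theta> x, y))"
        by (rule pair_measure_distr[OF \<theta>']) (simp_all add: distr_id b.sigma_finite_measure_axioms)
      then show ?thesis by (simp add: start_law_props(3)[OF \<Lambda> n'] distr_id)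
    qed
    have m1: "(\<lambda>(x, y). (\<theta> x, y)) \<in> ?\<nu>' \<Otimes>\<^sub>M \<mu> n \<rightarrow>\<^sub>M borel \<Otimes>\<^sub>M \<mu> n"
      unfolding split_beta
      by (intro measurable_Pair measurable_compose[OF measurable_fst \<theta>'] measurable_snd)
    have m2: "case_prod \<psi> \<in> borel \<Otimes>\<^sub>M \<mu> n \<rightarrow>\<^sub>M borel"
      using \<psi>_measurable
      by (simp only: measurable_cong_sets[OF sets_pair_measure_cong[OF refl sets_\<mu>[OF n]] refl])
    show ?thesis
      unfolding M start_law_def[of _ n] eq distr_distr[OF m2 m1]
      by (rule arg_cong[where f="distr _ _"]) (auto simp: fun_eq_iff)
  qed
  show ?thesis
  proof (rule W.PiM_eqI)
    show "sets ?D = sets ?R" by (simp add: sets_PiM_window_laws start_law_props(2)[OF \<Lambda> n])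
    fix A assume h: "\<And>j. j \<in> {n..0} \<Longrightarrow> A j \<in> sets (window_laws n ?\<nu> j)"
    have A: "A j \<in> sets borel" if "j \<in> {n..0}" for j
      using h[OF that] sets_window_laws[OF start_law_props(2)[OF \<Lambda> n], of n j] by blast
    define X where "X = {x \<in> space (PiM ?I ?M). \<psi> (\<theta> (x (n - 1))) (x n) \<in> A n}"
    define Y where "Y = Pi\<^sub>E ?J A"
    have box: "Pi\<^sub>E {n..0} A \<in> sets (PiM {n..0} (\<lambda>_. borel))"
      using A by (intro sets_PiM_I_finite) auto
    have mc: "(\<lambda>x. x i) \<in> PiM ?I ?M \<rightarrow>\<^sub>M borel" if "i \<in> ?I" for i
      using measurable_component_singleton[OF that, of ?M] measurable_cong_sets[OF refl sM] by blast
    have mX: "(\<lambda>x. \<psi> (\<theta> (x (n - 1))) (x n)) \<in> PiM ?I ?M \<rightarrow>\<^sub>M borel"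
      by (intro measurable_\<psi> measurable_compose[OF _ \<theta>_measurable] mc) auto
    have An: "A n \<in> sets borel" using n by (intro A) simp
    have X: "X \<in> sets (PiM ?I ?M)"
      using measurable_sets[OF mX An] by (simp add: X_def vimage_def Int_def conj_commute)
    have Y: "Y \<in> sets (PiM ?J ?M)"
      unfolding Y_def using A sM by (intro sets_PiM_I_finite) auto
    have EY: "emeasure (PiM ?J ?M) Y = (\<Prod>j\<in>?J. emeasure (?M j) (A j))"
      unfolding Y_def using A sM by (intro V.emeasure_PiM) auto
    have EX: "emeasure (PiM ?I ?M) X = emeasure ?\<nu> (A n)"
    proof -
      have m: "(\<lambda>(x, y). \<psi> (\<theta> x) y) \<in> ?M (n - 1) \<Otimes>\<^sub>M ?M n \<rightarrow>\<^sub>M borel"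
      proof -
        have "(\<lambda>(x, y). \<psi> (\<theta> x) y) \<in> borel \<Otimes>\<^sub>M borel \<rightarrow>\<^sub>M borel"
          unfolding split_beta
          by (intro measurable_\<psi> measurable_compose[OF measurable_fst \<theta>_measurable] measurable_snd)
        then show ?thesis
          by (simp only: measurable_cong_sets[OF sets_pair_measure_cong[OF sM sM] refl])
      qed
      define f :: "'s \<Rightarrow> 's \<Rightarrow> ennreal" where "f x y = indicator (A n) (\<psi> (\<theta> x) y)" for x y
      have fm: "case_prod f \<in> borel_measurable (?M (n - 1) \<Otimes>\<^sub>M ?M n)"
      proof -
        have "case_prod f = (\<lambda>z. indicator (A n) ((\<lambda>(x, y). \<psi> (\<theta> x) y) z))"
          by (auto simp: fun_eq_iff f_def)
        then show ?thesis
          using measurable_compose[OF m borel_measurable_indicator[OF An]] by (simp only:)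
      qed
      have "emeasure (PiM ?I ?M) X = (\<integral>\<^sup>+x. indicator X x \<partial>PiM ?I ?M)" using X by simp
      also have "\<dots> = (\<integral>\<^sup>+x. f (x (n - 1)) (x n) \<partial>PiM ?I ?M)"
        by (intro nn_integral_cong) (auto simp: X_def f_def split: split_indicator)
      also have "\<dots> = (\<integral>\<^sup>+z. f (fst z) (snd z) \<partial>(?M (n - 1) \<Otimes>\<^sub>M ?M n))"
        by (rule V.product_nn_integral_pair[OF fm]) simp
      also have "\<dots> = (\<integral>\<^sup>+z. indicator (A n) z \<partial>?\<nu>)"
        unfolding step[symmetric] using An
        by (subst nn_integral_distr[OF m]) (auto simp: f_def split_beta)
      also have "\<dots> = emeasure ?\<nu> (A n)" using An start_law_props(2)[OF \<Lambda> n] by simp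
      finally show ?thesis .
    qed
    have "emeasure ?D (Pi\<^sub>E {n..0} A)
        = emeasure (PiM (?I \<union> ?J) ?M) (advance n -` Pi\<^sub>E {n..0} A \<inter> space (PiM (?I \<union> ?J) ?M))"
      using mJ box unfolding ivl(1)[symmetric] by (rule emeasure_distr)
    also have "\<dots> = emeasure (PiM ?I ?M \<Otimes>\<^sub>M PiM ?J ?M)
        (merge ?I ?J -` (advance n -` Pi\<^sub>E {n..0} A \<inter> space (PiM (?I \<union> ?J) ?M))
          \<inter> space (PiM ?I ?M \<Otimes>\<^sub>M PiM ?J ?M))"
    proof -
      have mm: "merge ?I ?J \<in> PiM ?I ?M \<Otimes>\<^sub>M PiM ?J ?M \<rightarrow>\<^sub>M PiM (?I \<union> ?J) ?M"
        by (rule measurable_merge)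
      have E: "advance n -` Pi\<^sub>E {n..0} A \<inter> space (PiM (?I \<union> ?J) ?M) \<in> sets (PiM (?I \<union> ?J) ?M)"
        using measurable_sets[OF mJ box] unfolding ivl(1) .
      have "PiM (?I \<union> ?J) ?M = distr (PiM ?I ?M \<Otimes>\<^sub>M PiM ?J ?M) (PiM (?I \<union> ?J) ?M) (merge ?I ?J)"
        by (rule V.distr_merge[symmetric]) auto
      from arg_cong[where f="\<lambda>M. emeasure M (advance n -` Pi\<^sub>E {n..0} A \<inter> space (PiM (?I \<union> ?J) ?M))", OF this]
      show ?thesis unfolding emeasure_distr[OF mm E] .
    qed
    also have "merge ?I ?J -` (advance n -` Pi\<^sub>E {n..0} A \<inter> space (PiM (?I \<union> ?J) ?M))
          \<inter> space (PiM ?I ?M \<Otimes>\<^sub>M PiM ?J ?M) = X \<times> Y"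
    proof (rule Set.set_eqI)
      fix p :: "(int \<Rightarrow> 's) \<times> (int \<Rightarrow> 's)"
      obtain x y where p: "p = (x, y)" by (cases p)
      have Aspace: "z \<in> space (?M j)" for z j
        using sets_eq_imp_space_eq[OF sM, of j] by simp
      show "p \<in> merge ?I ?J -` (advance n -` Pi\<^sub>E {n..0} A \<inter> space (PiM (?I \<union> ?J) ?M))
          \<inter> space (PiM ?I ?M \<Otimes>\<^sub>M PiM ?J ?M) \<longleftrightarrow> p \<in> X \<times> Y"
      proof (cases "x \<in> space (PiM ?I ?M) \<and> y \<in> space (PiM ?J ?M)")
        case True
        then have mem: "merge ?I ?J (x, y) \<in> space (PiM (?I \<union> ?J) ?M)"
          using measurable_space[OF measurable_merge[of ?I ?J ?M], of "(x, y)"] by (simp add: space_pair_measure)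
        have ext: "y \<in> extensional ?J" using True by (auto simp: space_PiM PiE_iff)
        have v: "merge ?I ?J (x, y) (n - 1) = x (n - 1)" "merge ?I ?J (x, y) n = x n"
          "\<And>j. j \<in> ?J \<Longrightarrow> merge ?I ?J (x, y) j = y j"
          by (auto simp: merge_def)
        have "advance n (merge ?I ?J (x, y)) \<in> Pi\<^sub>E {n..0} A \<longleftrightarrow>
            \<psi> (\<theta> (x (n - 1))) (x n) \<in> A n \<and> (\<forall>j\<in>?J. y j \<in> A j)"
          unfolding PiE_iff ivl(2) advance_def using v n by (auto simp: extensional_def)
        then show ?thesis
          using True mem ext unfolding p
          by (simp add: X_def Y_def PiE_iff space_pair_measure vimage_def del: Un_insert_left Un_insert_right)
      next
        case False
        then show ?thesis
          using Aspace unfolding p by (auto simp: X_def Y_def space_pair_measure space_PiM PiE_iff)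
      qed
    qed
    also have "emeasure (PiM ?I ?M \<Otimes>\<^sub>M PiM ?J ?M) (X \<times> Y) = emeasure ?\<nu> (A n) * (\<Prod>j\<in>?J. emeasure (?M j) (A j))"
    proof -
      interpret J: prob_space "PiM ?J ?M"
        by (intro prob_space_PiM prob_space_window_laws start_law_props[OF \<Lambda> n'])
      show ?thesis using J.emeasure_pair_measure_Times[OF X Y] EX EY by simp
    qed
    also have "\<dots> = (\<Prod>j\<in>{n..0}. emeasure (window_laws n ?\<nu> j) (A j))"
      unfolding ivl(2) by (subst prod.insert) (auto simp: window_laws_def intro!: prod.cong arg_cong2[where f="(*)"])
    finally show "emeasure ?D (Pi\<^sub>E {n..0} A) = (\<Prod>j\<in>{n..0}. emeasure (window_laws n ?\<nu> j) (A j))" .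
  qed simp
qed

lemma distr_window_step:
  assumes \<Lambda>: "consistent_laws \<Lambda>" and n: "n \<le> 0"
  shows "distr (window \<Lambda> (n - 1)) (PiM {n..0} (\<lambda>_. borel)) (\<lambda>x. restrict x {n..0}) = window \<Lambda> n"
proof -
  have n': "n - 1 \<le> 0" using n by simp
  let ?W = "PiM {n - 1..0} (window_laws (n - 1) (start_law \<Lambda> (n - 1)))"
  have m: "(\<lambda>x. restrict x {n..0}) \<in> PiM {n - 1..0} (\<lambda>_. borel) \<rightarrow>\<^sub>M PiM {n..0} (\<lambda>_. borel :: 's measure)"
    by (rule measurable_restrict_subset) simp
  have ma: "advance n \<in> ?W \<rightarrow>\<^sub>M PiM {n..0} (\<lambda>_. borel)"
    using advance_measurable[OF n]
    by (simp only: measurable_cong_sets[OF sets_PiM_window_laws[OF start_law_props(2)[OF \<Lambda> n']] refl])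
  have "distr (window \<Lambda> (n - 1)) (PiM {n..0} (\<lambda>_. borel)) (\<lambda>x. restrict x {n..0})
      = distr ?W (PiM {n..0} (\<lambda>_. borel)) ((\<lambda>x. restrict x {n..0}) \<circ> decode (n - 1))"
    unfolding window_def by (rule distr_distr[OF m decode_measurable_window[OF \<Lambda> n']])
  also have "(\<lambda>x. restrict x {n..0}) \<circ> decode (n - 1) = decode n \<circ> advance n"
    by (rule ext) (simp add: decode_advance[OF n])
  also have "distr ?W (PiM {n..0} (\<lambda>_. borel)) (decode n \<circ> advance n)
      = distr (distr ?W (PiM {n..0} (\<lambda>_. borel)) (advance n)) (PiM {n..0} (\<lambda>_. borel)) (decode n)"
    by (rule distr_distr[OF decode_measurable ma, symmetric])
  finally show ?thesis
    unfolding distr_advance[OF \<Lambda> n] window_def .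
qed

lemma distr_window_restrict:
  assumes \<Lambda>: "consistent_laws \<Lambda>" and "m \<le> n" "n \<le> 0"
  shows "distr (window \<Lambda> m) (PiM {n..0} (\<lambda>_. borel)) (\<lambda>x. restrict x {n..0}) = window \<Lambda> n"
  using assms(2)
proof (induction m rule: int_le_induct)
  case base
  have "distr (window \<Lambda> n) (PiM {n..0} (\<lambda>_. borel)) (\<lambda>x. restrict x {n..0})
      = distr (window \<Lambda> n) (window \<Lambda> n) (\<lambda>x. x)"
    by (rule distr_cong)
      (auto simp: sets_window sets_eq_imp_space_eq[OF sets_window] space_PiM PiE_def extensional_restrict)
  then show ?case by (simp only: distr_id)
next
  case (step m)
  have r: "(\<lambda>x. restrict x {n..0}) \<in> PiM {m..0} (\<lambda>_. borel) \<rightarrow>\<^sub>M PiM {n..0} (\<lambda>_. borel :: 's measure)"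
    using step.hyps by (intro measurable_restrict_subset) auto
  have r': "(\<lambda>x. restrict x {m..0}) \<in> window \<Lambda> (m - 1) \<rightarrow>\<^sub>M PiM {m..0} (\<lambda>_. borel :: 's measure)"
    unfolding measurable_cong_sets[OF sets_window refl]
    by (intro measurable_restrict_subset) auto
  have "distr (window \<Lambda> (m - 1)) (PiM {n..0} (\<lambda>_. borel)) (\<lambda>x. restrict x {n..0})
      = distr (window \<Lambda> (m - 1)) (PiM {n..0} (\<lambda>_. borel)) ((\<lambda>x. restrict x {n..0}) \<circ> (\<lambda>x. restrict x {m..0}))"
    using step.hyps by (intro arg_cong[where f="distr _ _"]) (auto simp: fun_eq_iff restrict_def)
  also have "\<dots> = distr (distr (window \<Lambda> (m - 1)) (PiM {m..0} (\<lambda>_. borel)) (\<lambda>x. restrict x {m..0}))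
      (PiM {n..0} (\<lambda>_. borel)) (\<lambda>x. restrict x {n..0})"
    by (rule distr_distr[OF r r', symmetric])
  also have "\<dots> = window \<Lambda> n"
  proof -
    have "m \<le> 0" using step.hyps assms(3) by simp
    then show ?thesis unfolding distr_window_step[OF \<Lambda> \<open>m \<le> 0\<close>] by (intro step.IH)
  qed
  finally show ?case .
qed

lemma window_box_sets:
  fixes A :: "'s set" and C :: "int \<Rightarrow> 's set"
  assumes nk: "n < k" "k \<le> 0" and A: "A \<in> sets borel" and C: "\<And>j. C j \<in> sets borel"
  defines "S \<equiv> space (PiM {n..0} (\<lambda>_. borel :: 's measure))"
  shows "{x \<in> S. \<forall>j\<in>{n..k - 1}. x j \<in> C j} \<in> sets (PiM {n..0} (\<lambda>_. borel))"
    and "{x \<in> S. \<xi> k x \<in> A \<and> (\<forall>j\<in>{n..k - 1}. x j \<in> C j)} \<in> sets (PiM {n..0} (\<lambda>_. borel))"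
proof -
  let ?B = "PiM {n..0} (\<lambda>_. borel) :: (int \<Rightarrow> 's) measure"
  have mc: "(\<lambda>x. x j) \<in> ?B \<rightarrow>\<^sub>M borel" if "j \<in> {n..0}" for j
    using that by (rule measurable_component_singleton)
  have m\<xi>: "\<xi> k \<in> ?B \<rightarrow>\<^sub>M borel"
    unfolding tye_noise_def[abs_def] using nk
    by (intro measurable_\<psi>inv measurable_compose[OF _ \<theta>_measurable] mc) auto
  have Collect: "{x \<in> S. f x \<in> X} \<in> sets ?B" if "f \<in> ?B \<rightarrow>\<^sub>M borel" "X \<in> sets borel"
    for f :: "(int \<Rightarrow> 's) \<Rightarrow> 's" and X
    using measurable_sets[OF that] by (simp add: S_def vimage_def Int_def conj_commute)
  show s2: "{x \<in> S. \<forall>j\<in>{n..k - 1}. x j \<in> C j} \<in> sets ?B"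
    unfolding S_def
  proof (rule sets.sets_Collect_finite_All)
    fix j assume "j \<in> {n..k - 1}"
    then show "{x \<in> space ?B. x j \<in> C j} \<in> sets ?B"
      using Collect[OF mc C, of j] nk by (simp add: S_def)
  qed simp
  show "{x \<in> S. \<xi> k x \<in> A \<and> (\<forall>j\<in>{n..k - 1}. x j \<in> C j)} \<in> sets ?B"
    using sets.Int[OF Collect[OF m\<xi> A] s2] by (simp add: Int_def conj_ac cong: conj_cong)
qed

text \<open>In the code of a window the noise at time \<open>k\<close> is one coordinate, and the path before \<open>k\<close> is a function
of the other ones.\<close>

lemma window_noise_independent:
  assumes \<Lambda>: "consistent_laws \<Lambda>" and nk: "n < k" "k \<le> 0" and A: "A \<in> sets borel" and C: "\<And>j. C j \<in> sets borel"
  defines "S \<equiv> space (PiM {n..0} (\<lambda>_. borel :: 's measure))"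
  shows "emeasure (window \<Lambda> n) {x \<in> S. \<xi> k x \<in> A \<and> (\<forall>j\<in>{n..k - 1}. x j \<in> C j)}
    = emeasure (\<mu> k) A * emeasure (window \<Lambda> n) {x \<in> S. \<forall>j\<in>{n..k - 1}. x j \<in> C j}"
proof -
  have n: "n \<le> 0" using nk by simp
  let ?M = "window_laws n (start_law \<Lambda> n)" and ?B = "PiM {n..0} (\<lambda>_. borel) :: (int \<Rightarrow> 's) measure"
  interpret W: product_prob_space ?M by (rule product_prob_space_start_law[OF \<Lambda> n])
  note sP = sets_PiM_window_laws[OF start_law_props(2)[OF \<Lambda> n], of n]
  have spP: "space (PiM {n..0} ?M) = S" unfolding S_def by (rule sets_eq_imp_space_eq[OF sP])
  note s1 = window_box_sets(2)[where C=C, OF nk A C, folded S_def]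
    and s2 = window_box_sets(1)[where C=C, OF nk A C, folded S_def]
  have run_upd: "run \<theta> \<psi> n (x(k := y)) m = run \<theta> \<psi> n x m" if "n + int m < k" for x y m
    using that by (induction m) auto
  have dec_upd: "decode n (x(k := y)) j = decode n x j" if "j \<in> {n..k - 1}" for x y j
    using that nk by (simp add: decode_def run_upd)
  have dec_k: "\<xi> k (decode n x) = x k" for x
  proof -
    define m where "m = nat (k - 1 - n)"
    have m: "n + int (Suc m) = k" "nat (k - n) = Suc m" "nat (k - 1 - n) = m" using nk by (auto simp: m_def)
    have "decode n x (k - 1) = run \<theta> \<psi> n x m" using nk by (simp add: decode_def m(3))
    moreover have "decode n x k = \<psi> (\<theta> (run \<theta> \<psi> n x m)) (x k)"
      using nk by (simp add: decode_def m(2) m(1)[symmetric] del: of_nat_Suc)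
    ultimately show ?thesis by (simp add: tye_noise_def)
  qed
  note md = decode_measurable_window[OF \<Lambda> n]
  have dS: "decode n x \<in> S" for x
    unfolding S_def by (auto simp: decode_def space_PiM)
  define Q where "Q x \<longleftrightarrow> (\<forall>j\<in>{n..k - 1}. decode n x j \<in> C j)" for x
  have ins: "insert k ({n..0} - {k}) = {n..0}" using nk by auto
  have pre2: "decode n -` {x \<in> S. \<forall>j\<in>{n..k - 1}. x j \<in> C j} \<inter> space (PiM {n..0} ?M) = {x \<in> space (PiM {n..0} ?M). Q x}"
    using dS by (auto simp: Q_def)
  have pre1: "decode n -` {x \<in> S. \<xi> k x \<in> A \<and> (\<forall>j\<in>{n..k - 1}. x j \<in> C j)} \<inter> space (PiM {n..0} ?M)
      = {x \<in> space (PiM {n..0} ?M). x k \<in> A \<and> Q x}"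
    using dS by (auto simp: Q_def dec_k)
  have Mk: "?M k = \<mu> k" using nk by (simp add: window_laws_def)
  have QS: "{x \<in> space (PiM {n..0} ?M). Q x} \<in> sets (PiM {n..0} ?M)"
    using measurable_sets[OF md s2] by (simp only: pre2)
  have "emeasure (PiM {n..0} ?M) {x \<in> space (PiM {n..0} ?M). x k \<in> A \<and> Q x}
      = emeasure (?M k) A * emeasure (PiM {n..0} ?M) {x \<in> space (PiM {n..0} ?M). Q x}"
  proof (rule W.emeasure_PiM_coordinate_independent[of "{n..0} - {k}" k A Q, unfolded ins])
    show "A \<in> sets (?M k)" unfolding Mk sets_\<mu>[OF nk(2)] by (rule A)
    show "Q (x(k := y)) = Q x" for x y unfolding Q_def by (rule ball_cong) (simp_all only: dec_upd)
  qed (use QS in auto)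
  then show ?thesis
    unfolding window_def emeasure_distr[OF md s1] emeasure_distr[OF md s2] pre1 pre2 Mk .
qed

end

theorem (in tsirelson_yor) solution_if_windows:
  assumes \<Lambda>: "consistent_laws \<Lambda>" and P: "prob_space P" "sets P = sets path_space"
    and win: "\<And>n. n \<le> 0 \<Longrightarrow> distr P (PiM {n..0} (\<lambda>_. borel)) (\<lambda>x. restrict x {n..0}) = window \<Lambda> n"
  shows "P \<in> solutions \<xi> \<mu>" "n \<le> 0 \<Longrightarrow> theta_at P n = \<Lambda> n"
proof -
  interpret P: prob_space P by fact
  have sp: "space P = space path_space" using P(2) by (rule sets_eq_imp_space_eq)
  have mr: "(\<lambda>x. restrict x {n..0}) \<in> P \<rightarrow>\<^sub>M PiM {n..0} (\<lambda>_. borel :: 's measure)" if "n \<le> 0" for n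
    using restrict_measurable_path[OF that] by (simp only: measurable_cong_sets[OF P(2) refl])
  have mem: "restrict \<eta> {n..0} \<in> space (PiM {n..0} (\<lambda>_. borel :: 's measure))" for \<eta> :: "int \<Rightarrow> 's" and n
    by (simp add: space_PiM)
  have EP: "emeasure P {\<eta> \<in> space path_space. R \<eta>}
      = emeasure (window \<Lambda> n) {x \<in> space (PiM {n..0} (\<lambda>_. borel)). R x}"
    if n: "n \<le> 0" and S: "{x \<in> space (PiM {n..0} (\<lambda>_. borel)). R x} \<in> sets (PiM {n..0} (\<lambda>_. borel))"
      and R: "\<And>\<eta>. R (restrict \<eta> {n..0}) = R \<eta>" for R n
  proof -
    have "(\<lambda>x. restrict x {n..0}) -` {x \<in> space (PiM {n..0} (\<lambda>_. borel)). R x} \<inter> space P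
        = {\<eta> \<in> space path_space. R \<eta>}"
      using R mem by (auto simp: sp)
    then show ?thesis
      unfolding win[OF n, symmetric] emeasure_distr[OF mr[OF n] S] by simp
  qed
  show "P \<in> solutions \<xi> \<mu>"
    unfolding solutions_iff
  proof (intro conjI allI impI ballI P)
    fix k :: int and A :: "'s set" and B :: "(int \<Rightarrow> 's) set"
    assume k: "k \<le> 0" and A: "A \<in> sets borel" and B: "B \<in> past coord (k - 1)"
    interpret \<mu>: prob_space "\<mu> k" using k by (rule prob_space_\<mu>)
    have m: "\<xi> k \<in> P \<rightarrow>\<^sub>M borel"
      using \<xi>_measurable[OF k] by (simp only: measurable_cong_sets[OF P(2) refl])
    have box: "P.prob ({\<eta> \<in> space path_space. \<xi> k \<eta> \<in> X} \<inter> b) = measure (\<mu> k) X * P.prob b"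
      if X: "X \<in> sets borel" and b: "b \<in> boxes (k - 1)" for X b
    proof -
      obtain n C where n: "n \<le> k - 1" and C: "\<And>j. C j \<in> sets borel"
        and b_eq: "b = {\<eta> \<in> space path_space. \<forall>j\<in>{n..k - 1}. \<eta> j \<in> C j}"
        using b unfolding boxes_def by blast
      have nk: "n < k" "n \<le> 0" using n k by auto
      have "emeasure P {\<eta> \<in> space path_space. \<xi> k \<eta> \<in> X \<and> (\<forall>j\<in>{n..k - 1}. \<eta> j \<in> C j)}
          = emeasure (window \<Lambda> n) {x \<in> space (PiM {n..0} (\<lambda>_. borel)). \<xi> k x \<in> X \<and> (\<forall>j\<in>{n..k - 1}. x j \<in> C j)}"
        using window_box_sets(2)[where C=C, OF nk(1) k X C] nk k by (intro EP) (auto simp: tye_noise_def)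
      also have "\<dots> = emeasure (\<mu> k) X * emeasure (window \<Lambda> n) {x \<in> space (PiM {n..0} (\<lambda>_. borel)). \<forall>j\<in>{n..k - 1}. x j \<in> C j}"
        by (rule window_noise_independent[where C=C, OF \<Lambda> nk(1) k X C])
      also have "emeasure (window \<Lambda> n) {x \<in> space (PiM {n..0} (\<lambda>_. borel)). \<forall>j\<in>{n..k - 1}. x j \<in> C j} = emeasure P b"
        unfolding b_eq using window_box_sets(1)[where C=C, OF nk(1) k X C] nk k by (intro EP[symmetric]) auto
      finally have "emeasure P ({\<eta> \<in> space path_space. \<xi> k \<eta> \<in> X} \<inter> b) = emeasure (\<mu> k) X * emeasure P b"
        unfolding b_eq by (simp add: Int_def conj_ac cong: conj_cong)
      then show ?thesis
        by (simp add: P.emeasure_eq_measure \<mu>.emeasure_eq_measure ennreal_mult[symmetric])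
    qed
    have "space path_space = {\<eta> \<in> space path_space. \<forall>j\<in>{k - 1..k - 1}. \<eta> j \<in> (UNIV :: 's set)}" by auto
    then have top: "space path_space \<in> (boxes (k - 1) :: (int \<Rightarrow> 's) set set)"
      unfolding boxes_def by (intro CollectI exI[of _ "k - 1"] exI[of _ "\<lambda>_. UNIV"] conjI) auto
    have law: "P.prob {\<eta> \<in> space path_space. \<xi> k \<eta> \<in> X} = measure (\<mu> k) X" if "X \<in> sets borel" for X
      using box[OF that top] P.prob_space by (simp add: sp Int_absorb2)
    let ?N = "{{\<eta> \<in> space path_space. \<xi> k \<eta> \<in> X} | X. X \<in> sets borel}"
    have "P.indep_set ?N (boxes (k - 1))"
      unfolding P.indep_sets2_eq
    proof (intro conjI ballI)
      show "?N \<subseteq> P.events"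
        using measurable_sets[OF m] by (auto simp: sp vimage_def Int_def conj_commute)
      have "boxes (k - 1) \<subseteq> past (coord :: int \<Rightarrow> (int \<Rightarrow> 's) \<Rightarrow> 's) (k - 1)"
        unfolding past_coord_eq_boxes by blast
      also have "\<dots> \<subseteq> P.events" unfolding P(2) using k by (intro past_coord_subset) simp
      finally show "boxes (k - 1) \<subseteq> P.events" .
      fix a b :: "(int \<Rightarrow> 's) set" assume "a \<in> ?N" and b: "b \<in> boxes (k - 1)"
      then obtain X where "a = {\<eta> \<in> space path_space. \<xi> k \<eta> \<in> X}" "X \<in> sets borel" by blast
      then show "P.prob (a \<inter> b) = P.prob a * P.prob b"
        using box[OF _ b] law by simp
    qed
    moreover have "Int_stable ?N"
    proof (rule Int_stableI)
      fix a b :: "(int \<Rightarrow> 's) set" assume "a \<in> ?N" "b \<in> ?N"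
      then obtain X Y where "a = {\<eta> \<in> space path_space. \<xi> k \<eta> \<in> X}" "X \<in> sets borel"
        "b = {\<eta> \<in> space path_space. \<xi> k \<eta> \<in> Y}" "Y \<in> sets borel"
        by blast
      then show "a \<inter> b \<in> ?N"
        by (intro CollectI exI[of _ "X \<inter> Y"]) auto
    qed
    ultimately have "P.indep_set (sigma_sets (space P) ?N) (sigma_sets (space P) (boxes (k - 1)))"
      using Int_stable_boxes by (rule P.indep_set_sigma_sets)
    moreover have "{\<eta> \<in> space path_space. \<xi> k \<eta> \<in> A} \<in> sigma_sets (space P) ?N"
      using A by (intro sigma_sets.Basic) blast
    moreover have "B \<in> sigma_sets (space P) (boxes (k - 1))"
      using B by (simp only: sp past_coord_eq_boxes)
    ultimately show "P.prob ({\<eta> \<in> space path_space. \<xi> k \<eta> \<in> A} \<inter> B) = measure (\<mu> k) A * P.prob B"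
      using law[OF A] by (simp add: P.indep_setD)
  qed
  show "theta_at P n = \<Lambda> n" if n: "n \<le> 0" for n
  proof -
    let ?M = "window_laws n (start_law \<Lambda> n)"
    have Mn: "?M n = start_law \<Lambda> n" by (simp add: window_laws_def)
    have in_n: "n \<in> {n..0}" using n by simp
    have m\<theta>: "(\<lambda>x. \<theta> (x n)) \<in> PiM {n..0} (\<lambda>_. borel) \<rightarrow>\<^sub>M borel"
      by (rule measurable_compose[OF measurable_component_singleton[OF in_n] \<theta>_measurable])
    have mn: "(\<lambda>x. x n) \<in> PiM {n..0} ?M \<rightarrow>\<^sub>M start_law \<Lambda> n"
      using measurable_component_singleton[OF in_n, of ?M] by (simp only: Mn)
    have m\<theta>': "\<theta> \<in> start_law \<Lambda> n \<rightarrow>\<^sub>M borel"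
      using \<theta>_measurable by (simp only: measurable_cong_sets[OF start_law_props(2)[OF \<Lambda> n] refl])
    have "theta_at P n = distr P borel ((\<lambda>x. \<theta> (x n)) \<circ> (\<lambda>x. restrict x {n..0}))"
      unfolding theta_at_def using n by (intro arg_cong[where f="distr _ _"]) (auto simp: fun_eq_iff)
    also have "\<dots> = distr (window \<Lambda> n) borel (\<lambda>x. \<theta> (x n))"
      unfolding distr_distr[OF m\<theta> mr[OF n], symmetric] win[OF n] ..
    also have "\<dots> = distr (PiM {n..0} ?M) borel ((\<lambda>x. \<theta> (x n)) \<circ> decode n)"
      unfolding window_def by (rule distr_distr[OF m\<theta> decode_measurable_window[OF \<Lambda> n]])
    also have "(\<lambda>x. \<theta> (x n)) \<circ> decode n = \<theta> \<circ> (\<lambda>x. x n)"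
      using n by (auto simp: fun_eq_iff decode_def)
    also have "distr (PiM {n..0} ?M) borel (\<theta> \<circ> (\<lambda>x. x n))
        = distr (distr (PiM {n..0} ?M) (start_law \<Lambda> n) (\<lambda>x. x n)) borel \<theta>"
      by (rule distr_distr[OF m\<theta>' mn, symmetric])
    also have "distr (PiM {n..0} ?M) (start_law \<Lambda> n) (\<lambda>x. x n) = start_law \<Lambda> n"
      using distr_PiM_component[of "{n..0}" ?M n] in_n prob_space_window_laws[OF start_law_props(1)[OF \<Lambda> n]]
      by (simp add: Mn)
    also have "distr (start_law \<Lambda> n) borel \<theta> = \<Lambda> n" by (rule start_law_props(3)[OF \<Lambda> n])
    finally show ?thesis .
  qed
qed

text \<open>By \<open>distr_window_restrict\<close> the window laws are a projective family. A path is observed at a finite set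
\<open>J\<close> of times through the window from \<open>lo J\<close> on.\<close>

theorem solution_exists:
  fixes \<theta> :: "'s::polish_space \<Rightarrow> 'g::topological_group_add"
  assumes "tsirelson_yor \<theta> \<psi> \<psi>inv \<mu>"
    and \<Lambda>: "tsirelson_yor.consistent_laws \<theta> \<mu> \<Lambda>"
  shows "\<exists>P \<in> solutions (tye_noise \<theta> \<psi>inv) \<mu>. \<forall>n\<le>0. tsirelson_yor.theta_at \<theta> P n = \<Lambda> n"
proof -
  interpret tsirelson_yor \<theta> \<psi> \<psi>inv \<mu> by fact
  define lo where "lo J = Min (insert (0::int) J)" for J
  have lo: "lo J \<le> 0" "J \<subseteq> {..0} \<Longrightarrow> J \<subseteq> {lo J..0}" if "finite J" for J
    using that by (auto simp: lo_def)
  define F where "F J = distr (window \<Lambda> (lo J)) (PiM J (\<lambda>_. borel)) (\<lambda>x. restrict x J)" for J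
  have mr: "(\<lambda>x. restrict x J) \<in> window \<Lambda> n \<rightarrow>\<^sub>M PiM J (\<lambda>_. borel :: 's measure)" if "J \<subseteq> {n..0}" for J n
    unfolding measurable_cong_sets[OF sets_window refl] using that by (rule measurable_restrict_subset)
  have mr': "(\<lambda>x. restrict x J) \<in> PiM H (\<lambda>_. borel) \<rightarrow>\<^sub>M PiM J (\<lambda>_. borel :: 's measure)" if "J \<subseteq> H" for J H :: "int set"
    using that by (rule measurable_restrict_subset)
  have "projective_family {..0} F (\<lambda>_. borel)"
  proof (rule projective_family.intro, goal_cases)
    case (2 J)
    then show ?case
      unfolding F_def using lo[of J] by (intro prob_space.prob_space_distr prob_space_window \<Lambda> mr) auto
  next
    case (1 J H)
    note JH = 1
    then have J: "finite J" "J \<subseteq> {..0}" by (auto intro: finite_subset)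
    have le: "lo H \<le> lo J" unfolding lo_def using JH J by (intro Min_antimono) auto
    have subH: "J \<subseteq> {lo H..0}" "H \<subseteq> {lo H..0}" using lo(2)[of H] JH by auto
    have subJ: "J \<subseteq> {lo J..0}" using lo(2) J by blast
    have "distr (F H) (PiM J (\<lambda>_. borel)) (\<lambda>x. restrict x J)
        = distr (window \<Lambda> (lo H)) (PiM J (\<lambda>_. borel)) ((\<lambda>x. restrict x J) \<circ> (\<lambda>x. restrict x H))"
      unfolding F_def by (rule distr_distr[OF mr'[OF JH(1)] mr[OF subH(2)]])
    also have "(\<lambda>x. restrict x J) \<circ> (\<lambda>x. restrict x H) = (\<lambda>x. restrict x J) \<circ> (\<lambda>x::int\<Rightarrow>'s. restrict x {lo J..0})"
      using JH(1) subJ by (auto simp: fun_eq_iff restrict_def)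
    also have "distr (window \<Lambda> (lo H)) (PiM J (\<lambda>_. borel)) ((\<lambda>x. restrict x J) \<circ> (\<lambda>x. restrict x {lo J..0}))
        = distr (distr (window \<Lambda> (lo H)) (PiM {lo J..0} (\<lambda>_. borel)) (\<lambda>x. restrict x {lo J..0}))
            (PiM J (\<lambda>_. borel)) (\<lambda>x. restrict x J)"
      using le by (intro distr_distr[symmetric] mr' mr subJ) auto
    also have "\<dots> = F J"
      unfolding F_def using distr_window_restrict[OF \<Lambda> le] lo(1)[OF J(1)] by simp
    finally show ?case ..
  qed
  then interpret F: polish_projective "{..0::int}" F
    by (simp add: polish_projective_def)
  have sets: "sets F.lim = sets path_space" by (simp add: path_space_def)
  have "distr F.lim (PiM {n..0} (\<lambda>_. borel)) (\<lambda>x. restrict x {n..0}) = window \<Lambda> n" if n: "n \<le> 0" for n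
  proof (rule measure_eqI)
    fix X assume "X \<in> sets (distr F.lim (PiM {n..0} (\<lambda>_. borel)) (\<lambda>x. restrict x {n..0}))"
    then have X: "X \<in> sets (PiM {n..0} (\<lambda>_. borel))" by simp
    have lo_n: "lo {n..0} = n" unfolding lo_def using n by (intro Min_eqI) auto
    have m: "(\<lambda>x. restrict x {n..0}) \<in> F.lim \<rightarrow>\<^sub>M PiM {n..0} (\<lambda>_. borel)"
      using restrict_measurable_path[OF n] by (simp only: measurable_cong_sets[OF sets refl])
    have "emeasure (distr F.lim (PiM {n..0} (\<lambda>_. borel)) (\<lambda>x. restrict x {n..0})) X
        = emeasure F.lim (prod_emb {..0} (\<lambda>_. borel) {n..0} X)"
      unfolding emeasure_distr[OF m X] by (simp add: prod_emb_def space_PiM)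
    also have "\<dots> = emeasure (F {n..0}) X"
      using X by (intro F.emeasure_lim_emb) auto
    also have "F {n..0} = window \<Lambda> n"
      unfolding F_def lo_n using distr_window_restrict[OF \<Lambda> order_refl n] .
    finally show "emeasure (distr F.lim (PiM {n..0} (\<lambda>_. borel)) (\<lambda>x. restrict x {n..0})) X = emeasure (window \<Lambda> n) X" .
  qed (simp add: sets_window)
  note sol = solution_if_windows[OF \<Lambda> F.P.prob_space_axioms sets this]
  then show ?thesis by blast
qed

section \<open>Mixtures and extremal points\<close>

text \<open>The condition under which \<open>extremal_points\<close> calls \<open>P\<close> a convex combination of \<open>Q\<close> and \<open>R\<close>.\<close>

definition mixes :: "real \<Rightarrow> 'a measure \<Rightarrow> 'a measure \<Rightarrow> 'a measure \<Rightarrow> bool" where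
  "mixes t P Q R \<longleftrightarrow> (\<forall>A\<in>sets P. measure P A = (1 - t) * measure Q A + t * measure R A)"

lemma extremal_points_iff:
  "P \<in> extremal_points K \<longleftrightarrow>
    P \<in> K \<and> (\<forall>Q\<in>K. \<forall>R\<in>K. \<forall>t. 0 < t \<and> t < 1 \<and> mixes t P Q R \<longrightarrow> Q = R)"
  unfolding extremal_points_def mixes_def by blast

lemma extremal_points_bij_betw:
  assumes bij: "bij_betw \<Phi> K K'"
    and mix: "\<And>P Q R t. P \<in> K \<Longrightarrow> Q \<in> K \<Longrightarrow> R \<in> K \<Longrightarrow> 0 < t \<Longrightarrow> t < 1 \<Longrightarrow>
      mixes t (\<Phi> P) (\<Phi> Q) (\<Phi> R) \<longleftrightarrow> mixes t P Q R"
    and P: "P \<in> K"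
  shows "\<Phi> P \<in> extremal_points K' \<longleftrightarrow> P \<in> extremal_points K"
proof -
  have K': "K' = \<Phi> ` K" and inj: "inj_on \<Phi> K" using bij by (auto simp: bij_betw_def)
  have "(\<forall>Q\<in>K'. \<forall>R\<in>K'. \<forall>t. 0 < t \<and> t < 1 \<and> mixes t (\<Phi> P) Q R \<longrightarrow> Q = R)
    \<longleftrightarrow> (\<forall>Q\<in>K. \<forall>R\<in>K. \<forall>t. 0 < t \<and> t < 1 \<and> mixes t (\<Phi> P) (\<Phi> Q) (\<Phi> R) \<longrightarrow> \<Phi> Q = \<Phi> R)"
    unfolding K' by simp
  also have "\<dots> \<longleftrightarrow> (\<forall>Q\<in>K. \<forall>R\<in>K. \<forall>t. 0 < t \<and> t < 1 \<and> mixes t P Q R \<longrightarrow> Q = R)"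
    using mix[OF P] inj_on_eq_iff[OF inj] by (intro ball_cong refl) blast
  finally have eq: "(\<forall>Q\<in>K'. \<forall>R\<in>K'. \<forall>t. 0 < t \<and> t < 1 \<and> mixes t (\<Phi> P) Q R \<longrightarrow> Q = R)
    \<longleftrightarrow> (\<forall>Q\<in>K. \<forall>R\<in>K. \<forall>t. 0 < t \<and> t < 1 \<and> mixes t P Q R \<longrightarrow> Q = R)" .
  have "\<Phi> P \<in> K'" using P K' by blast
  with P show ?thesis by (simp only: extremal_points_iff eq)
qed

lemma mixture_exists:
  assumes Q: "prob_space Q" and R: "prob_space R" "sets R = sets Q" and t: "0 \<le> t" "t \<le> 1"
  shows "\<exists>M. prob_space M \<and> sets M = sets Q \<and> (\<forall>A\<in>sets Q. measure M A = (1 - t) * measure Q A + t * measure R A)"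
proof -
  interpret Q: prob_space Q by fact
  interpret R: prob_space R by fact
  define M where "M = measure_pmf (bernoulli_pmf t) \<bind> (\<lambda>b. if b then R else Q)"
  have k: "(\<lambda>b. if b then R else Q) \<in> measure_pmf (bernoulli_pmf t) \<rightarrow>\<^sub>M subprob_algebra Q"
    using R by (auto simp: space_subprob_algebra prob_space_imp_subprob_space Q.prob_space_axioms)
  have sets: "sets M = sets Q"
    unfolding M_def by (rule sets_bind[where N=Q]) (use R in auto)
  have em: "emeasure M A = ennreal ((1 - t) * measure Q A + t * measure R A)" if A: "A \<in> sets Q" for A
  proof -
    have "emeasure M A = (\<integral>\<^sup>+b. emeasure (if b then R else Q) A \<partial>measure_pmf (bernoulli_pmf t))"
      unfolding M_def by (rule emeasure_bind[OF _ k A]) simp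
    also have "\<dots> = emeasure R A * ennreal t + emeasure Q A * ennreal (1 - t)"
      using t by (simp add: nn_integral_bernoulli_pmf)
    also have "\<dots> = ennreal ((1 - t) * measure Q A + t * measure R A)"
      using t by (simp add: Q.emeasure_eq_measure R.emeasure_eq_measure ennreal_mult[symmetric]
          ennreal_plus[symmetric] mult_ac add_ac del: ennreal_plus)
    finally show ?thesis .
  qed
  have meas: "measure M A = (1 - t) * measure Q A + t * measure R A" if A: "A \<in> sets Q" for A
    unfolding measure_def[of M] em[OF A]
    by (rule enn2real_ennreal) (use t in \<open>auto intro!: add_nonneg_nonneg mult_nonneg_nonneg\<close>)
  have spR: "space R = space Q" using R(2) by (rule sets_eq_imp_space_eq)
  have "emeasure M (space M) = 1"
    unfolding sets_eq_imp_space_eq[OF sets] em[OF sets.top]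
    using Q.prob_space R.prob_space by (simp add: spR)
  then have "prob_space M" by (rule prob_spaceI)
  with sets meas show ?thesis by blast
qed

lemma mixes_distr:
  assumes "mixes t P Q R" "f \<in> P \<rightarrow>\<^sub>M N" "sets Q = sets P" "sets R = sets P"
  shows "mixes t (distr P N f) (distr Q N f) (distr R N f)"
  unfolding mixes_def
proof
  fix A assume "A \<in> sets (distr P N f)"
  then have A: "A \<in> sets N" by simp
  have f: "f \<in> Q \<rightarrow>\<^sub>M N" "f \<in> R \<rightarrow>\<^sub>M N"
    using assms(2) by (simp_all only: measurable_cong_sets[OF assms(3) refl] measurable_cong_sets[OF assms(4) refl])
  have sp: "space Q = space P" "space R = space P" by (intro sets_eq_imp_space_eq assms)+
  show "measure (distr P N f) A = (1 - t) * measure (distr Q N f) A + t * measure (distr R N f) A"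
    using assms(1) measurable_sets[OF assms(2) A]
    unfolding measure_distr[OF assms(2) A] measure_distr[OF f(1) A] measure_distr[OF f(2) A] sp mixes_def
    by blast
qed

lemma measure_eqI_mixes:
  assumes "mixes t P Q R" "mixes t P' Q R" "prob_space P" "prob_space P'" "sets P' = sets P"
  shows "P = P'"
proof (rule measure_eqI)
  interpret P: prob_space P by fact
  interpret P': prob_space P' by fact
  fix A assume "A \<in> sets P"
  then show "emeasure P A = emeasure P' A"
    using assms by (simp add: mixes_def P.emeasure_eq_measure P'.emeasure_eq_measure)
qed (use assms in simp)

lemma group_action_of_typeI:
  fixes act :: "'g::group_add \<Rightarrow> 'm \<Rightarrow> 'm"
  assumes cl: "\<And>g x. x \<in> E \<Longrightarrow> act g x \<in> E"
    and add: "\<And>g h x. x \<in> E \<Longrightarrow> act g (act h x) = act (g + h) x"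
    and zero: "\<And>x. x \<in> E \<Longrightarrow> act 0 x = x"
  shows "group_action group_of_type E (\<lambda>g. restrict (act g) E)"
proof -
  have "group (group_of_type :: 'g monoid)"
  proof (rule groupI)
    fix x :: 'g
    show "\<exists>y\<in>carrier group_of_type. y \<otimes>\<^bsub>group_of_type\<^esub> x = \<one>\<^bsub>group_of_type\<^esub>"
      by (rule bexI[of _ "- x"]) (auto simp: group_of_type_def)
  qed (auto simp: group_of_type_def add.assoc)
  moreover have bij: "restrict (act g) E \<in> Bij E" for g
  proof -
    have "bij_betw (act g) E E"
      by (rule bij_betw_byWitness[where f'="act (- g)"]) (auto simp: cl add zero)
    then show ?thesis
      unfolding Bij_def using bij_betw_cong[of E "restrict (act g) E" "act g" E] by simp
  qed
  moreover have "(\<lambda>g. restrict (act g) E) \<in> hom group_of_type (BijGroup E)"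
    unfolding hom_def BijGroup_def
    using bij by (auto simp: group_of_type_def compose_def fun_eq_iff add cl restrict_def)
  ultimately show ?thesis
    unfolding group_action_def group_hom_def group_hom_axioms_def using group_BijGroup by blast
qed

context tsirelson_yor
begin

text \<open>For a fixed noise law, being a solution is a linear condition on \<open>P\<close>: in \<open>solutions_iff\<close> the factor
\<open>measure (\<mu> k) A\<close> is the same for all solutions.\<close>

lemma solutions_convex:
  assumes Q: "Q \<in> solutions \<xi> \<mu>" and R: "R \<in> solutions \<xi> \<mu>"
    and M: "prob_space M" "sets M = sets path_space" "mixes t M Q R"
  shows "M \<in> solutions \<xi> \<mu>"
  unfolding solutions_iff
proof (intro conjI allI impI ballI M)
  fix k :: int and A :: "'s set" and B :: "(int \<Rightarrow> 's) set"
  assume k: "k \<le> 0" and A: "A \<in> sets borel" and B: "B \<in> past coord (k - 1)"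
  let ?E = "{\<eta> \<in> space path_space. \<xi> k \<eta> \<in> A} \<inter> B"
  have B': "B \<in> sets M" using past_coord_subset[of "k - 1"] B k M(2) by auto
  have "{\<eta> \<in> space path_space. \<xi> k \<eta> \<in> A} \<in> sets M"
    using measurable_sets[OF \<xi>_measurable[OF k] A] M(2) by (simp add: vimage_def Int_def conj_commute)
  with B' have E: "?E \<in> sets M" by (rule sets.Int[rotated])
  have QR: "measure Q ?E = measure (\<mu> k) A * measure Q B" "measure R ?E = measure (\<mu> k) A * measure R B"
    using Q R k A B unfolding solutions_iff by blast+
  have mix: "measure M X = (1 - t) * measure Q X + t * measure R X" if "X \<in> sets M" for X
    using M(3) that unfolding mixes_def by blast
  show "measure M ?E = measure (\<mu> k) A * measure M B"
    unfolding mix[OF E] mix[OF B'] QR by (simp add: algebra_simps)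
qed

lemma mixture_solution_exists:
  assumes Q: "Q \<in> solutions \<xi> \<mu>" and R: "R \<in> solutions \<xi> \<mu>" and t: "0 \<le> t" "t \<le> 1"
  shows "\<exists>M \<in> solutions \<xi> \<mu>. mixes t M Q R"
proof -
  have sRQ: "sets R = sets Q" using Q R by (simp add: solutions_iff)
  obtain M where M: "prob_space M" "sets M = sets Q"
    "\<forall>A\<in>sets Q. measure M A = (1 - t) * measure Q A + t * measure R A"
    using mixture_exists[OF solution_prob_space[OF Q] solution_prob_space[OF R] sRQ t] by blast
  then have "mixes t M Q R" by (simp add: mixes_def)
  moreover have "M \<in> solutions \<xi> \<mu>"
    using M solution_sets[OF Q] calculation by (intro solutions_convex[OF Q R]) auto
  ultimately show ?thesis by blast
qed

section \<open>The group action\<close>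

text \<open>The map of paths behind \<open>translate\<close>; it commutes with the noise (\<open>\<xi>_shift\<close>) and acts on the group
components by left translation (\<open>\<theta>_shift\<close>).\<close>

definition shift :: "'g \<Rightarrow> (int \<Rightarrow> 's) \<Rightarrow> int \<Rightarrow> 's" where
  "shift g \<eta> = (\<lambda>k\<in>{..0}. \<psi> (g + \<theta> (\<eta> (k - 1))) (\<xi> k \<eta>))"

lemma translate_eq: "translate \<theta> \<psi> \<psi>inv g P = distr P path_space (shift g)"
  unfolding translate_def shift_def[abs_def] ..

lemma \<theta>_shift: "k \<le> 0 \<Longrightarrow> \<theta> (shift g \<eta> k) = g + \<theta> (\<eta> k)"
  using \<theta>_step[of \<eta> k] by (simp add: shift_def add.assoc \<theta>_\<psi>)

lemma \<xi>_shift: "k \<le> 0 \<Longrightarrow> \<xi> k (shift g \<eta>) = \<xi> k \<eta>"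
  using \<theta>_shift[of "k - 1" g \<eta>] by (simp add: tye_noise_def shift_def)

lemma shift_coord_measurable:
  assumes "j \<le> k" "k \<le> 0"
  shows "(\<lambda>\<eta>. shift g \<eta> j) \<in> past_algebra coord k \<rightarrow>\<^sub>M borel"
proof -
  have eq: "(\<lambda>\<eta>. shift g \<eta> j) = (\<lambda>\<eta>. \<psi> (g + \<theta> (\<eta> (j - 1))) (\<xi> j \<eta>))"
    using assms by (simp add: shift_def)
  show ?thesis
    unfolding eq using assms
    by (intro measurable_\<psi> measurable_add \<xi>_measurable_past theta_past_measurable) auto
qed

lemma space_shift: "shift g \<eta> \<in> space path_space"
  by (simp add: shift_def path_space_def space_PiM)

lemma shift_measurable: "shift g \<in> path_space \<rightarrow>\<^sub>M path_space"
  unfolding path_space_def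
proof (rule measurable_PiM_single')
  fix j :: int assume "j \<in> {..0}"
  then show "(\<lambda>\<eta>. shift g \<eta> j) \<in> PiM {..0} (\<lambda>_. borel) \<rightarrow>\<^sub>M borel"
    using measurable_from_past[OF shift_coord_measurable[of j 0]] by (simp add: path_space_def)
qed (use space_shift in \<open>auto simp: path_space_def space_PiM\<close>)

lemma shift_measurable_past: "k \<le> 0 \<Longrightarrow> shift g \<in> past_algebra coord k \<rightarrow>\<^sub>M past_algebra coord k"
  by (rule measurable_into_past_algebra) (auto simp: space_shift coord_def intro!: shift_coord_measurable)

lemma translate_solution:
  assumes P: "P \<in> solutions \<xi> \<mu>"
  shows "translate \<theta> \<psi> \<psi>inv g P \<in> solutions \<xi> \<mu>"
proof -
  interpret P: prob_space P by (rule solution_prob_space[OF P])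
  have m: "shift g \<in> P \<rightarrow>\<^sub>M path_space"
    unfolding measurable_from_solution[OF P] by (rule shift_measurable)
  have sp: "space P = space path_space" by (rule solution_space[OF P])
  show ?thesis
    unfolding translate_eq solutions_iff
  proof (intro conjI allI impI ballI P.prob_space_distr m)
    fix k :: int and A :: "'s set" and B :: "(int \<Rightarrow> 's) set"
    assume k: "k \<le> 0" and A: "A \<in> sets borel" and B: "B \<in> past coord (k - 1)"
    have k': "k - 1 \<le> 0" using k by simp
    have B': "B \<in> sets path_space" using past_coord_subset[OF k'] B by blast
    have N: "{\<eta> \<in> space path_space. \<xi> k \<eta> \<in> A} \<in> sets path_space"
      by (rule noise_event[OF k A])
    have B'': "shift g -` B \<inter> space path_space \<in> past coord (k - 1)"
      using measurable_sets[OF shift_measurable_past[OF k'], of B g] B by (simp add: sets_past_algebra)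
    have "shift g -` ({\<eta> \<in> space path_space. \<xi> k \<eta> \<in> A} \<inter> B) \<inter> space path_space
        = {\<eta> \<in> space path_space. \<xi> k \<eta> \<in> A} \<inter> (shift g -` B \<inter> space path_space)"
      using k by (auto simp: \<xi>_shift space_shift)
    then show "measure (distr P path_space (shift g)) ({\<eta> \<in> space path_space. \<xi> k \<eta> \<in> A} \<inter> B)
        = measure (\<mu> k) A * measure (distr P path_space (shift g)) B"
      unfolding measure_distr[OF m sets.Int[OF N B']] measure_distr[OF m B'] sp
      using P k A B'' unfolding solutions_iff by simp
  qed simp
qed

lemma theta_at_translate:
  assumes P: "P \<in> solutions \<xi> \<mu>" and n: "n \<le> 0"
  shows "theta_at (translate \<theta> \<psi> \<psi>inv g P) n = distr (theta_at P n) borel ((+) g)"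
proof -
  have m: "shift g \<in> P \<rightarrow>\<^sub>M path_space" "(\<lambda>\<eta>. \<theta> (\<eta> n)) \<in> P \<rightarrow>\<^sub>M borel"
    unfolding measurable_from_solution[OF P]
    using n by (auto intro: shift_measurable measurable_compose[OF coord_measurable \<theta>_measurable])
  have g: "(+) g \<in> borel \<rightarrow>\<^sub>M borel" by (intro measurable_add) auto
  have mp: "(\<lambda>\<eta>. \<theta> (\<eta> n)) \<in> path_space \<rightarrow>\<^sub>M borel"
    using m(2) unfolding measurable_from_solution[OF P] .
  show ?thesis
    unfolding theta_at_def translate_eq distr_distr[OF mp m(1)] distr_distr[OF g m(2)]
    using n by (intro arg_cong[where f="distr _ _"]) (simp add: fun_eq_iff \<theta>_shift)
qed

lemma theta_at_props:
  assumes P: "P \<in> solutions \<xi> \<mu>" and n: "n \<le> 0"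
  shows "sets (theta_at P n) = sets borel" "prob_space (theta_at P n)"
proof -
  interpret P: prob_space P by (rule solution_prob_space[OF P])
  have "(\<lambda>\<eta>. \<theta> (\<eta> n)) \<in> P \<rightarrow>\<^sub>M borel"
    unfolding measurable_from_solution[OF P]
    using n by (auto intro: measurable_compose[OF coord_measurable \<theta>_measurable])
  then show "prob_space (theta_at P n)" unfolding theta_at_def by (rule P.prob_space_distr)
qed (simp add: theta_at_def)

text \<open>A solution is determined by the laws of its group components, and on these \<open>translate\<close> is left translation.\<close>

lemma translate_add:
  assumes P: "P \<in> solutions \<xi> \<mu>"
  shows "translate \<theta> \<psi> \<psi>inv g (translate \<theta> \<psi> \<psi>inv h P) = translate \<theta> \<psi> \<psi>inv (g + h) P"
proof (rule solution_unique)
  note h = translate_solution[OF P, of h]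
  show "translate \<theta> \<psi> \<psi>inv g (translate \<theta> \<psi> \<psi>inv h P) \<in> solutions \<xi> \<mu>"
    "translate \<theta> \<psi> \<psi>inv (g + h) P \<in> solutions \<xi> \<mu>"
    using P by (auto intro: translate_solution)
  fix n :: int assume n: "n \<le> 0"
  have m: "(+) g \<in> borel \<rightarrow>\<^sub>M borel" for g :: 'g by (intro measurable_add) auto
  have m': "(+) h \<in> theta_at P n \<rightarrow>\<^sub>M borel"
    using m by (simp only: measurable_cong_sets[OF theta_at_props(1)[OF P n] refl])
  show "theta_at (translate \<theta> \<psi> \<psi>inv g (translate \<theta> \<psi> \<psi>inv h P)) n = theta_at (translate \<theta> \<psi> \<psi>inv (g + h) P) n"
    unfolding theta_at_translate[OF h n] theta_at_translate[OF P n] distr_distr[OF m m']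
    by (intro arg_cong[where f="distr _ _"]) (simp add: fun_eq_iff add.assoc)
qed

lemma translate_zero:
  assumes P: "P \<in> solutions \<xi> \<mu>"
  shows "translate \<theta> \<psi> \<psi>inv 0 P = P"
proof (rule solution_unique[OF translate_solution[OF P] P])
  fix n :: int assume n: "n \<le> 0"
  have "theta_at (translate \<theta> \<psi> \<psi>inv 0 P) n = distr (theta_at P n) (theta_at P n) (\<lambda>x. x)"
    unfolding theta_at_translate[OF P n] using theta_at_props[OF P n] by (intro distr_cong) auto
  then show "theta_at (translate \<theta> \<psi> \<psi>inv 0 P) n = theta_at P n" by (simp only: distr_id)
qed

lemma bij_betw_translate: "bij_betw (translate \<theta> \<psi> \<psi>inv g) (solutions \<xi> \<mu>) (solutions \<xi> \<mu>)"
  by (rule bij_betw_byWitness[where f'="translate \<theta> \<psi> \<psi>inv (- g)"])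
    (auto simp: translate_add translate_zero translate_solution)

lemma mixes_translate:
  assumes "P \<in> solutions \<xi> \<mu>" "Q \<in> solutions \<xi> \<mu>" "R \<in> solutions \<xi> \<mu>" "mixes t P Q R"
  shows "mixes t (translate \<theta> \<psi> \<psi>inv g P) (translate \<theta> \<psi> \<psi>inv g Q) (translate \<theta> \<psi> \<psi>inv g R)"
  unfolding translate_eq using assms
  by (intro mixes_distr) (simp_all add: measurable_from_solution shift_measurable solution_sets)

lemma extremal_translate:
  assumes P: "P \<in> solutions \<xi> \<mu>"
  shows "translate \<theta> \<psi> \<psi>inv g P \<in> extremal_points (solutions \<xi> \<mu>) \<longleftrightarrow> P \<in> extremal_points (solutions \<xi> \<mu>)"
proof (rule extremal_points_bij_betw[OF bij_betw_translate _ P])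
  fix P Q R :: "(int \<Rightarrow> 's) measure" and t :: real
  assume s: "P \<in> solutions \<xi> \<mu>" "Q \<in> solutions \<xi> \<mu>" "R \<in> solutions \<xi> \<mu>"
  show "mixes t (translate \<theta> \<psi> \<psi>inv g P) (translate \<theta> \<psi> \<psi>inv g Q) (translate \<theta> \<psi> \<psi>inv g R) \<longleftrightarrow> mixes t P Q R"
  proof
    assume "mixes t (translate \<theta> \<psi> \<psi>inv g P) (translate \<theta> \<psi> \<psi>inv g Q) (translate \<theta> \<psi> \<psi>inv g R)"
    from mixes_translate[OF translate_solution[OF s(1)] translate_solution[OF s(2)] translate_solution[OF s(3)] this, of "- g"]
    show "mixes t P Q R" using s by (simp add: translate_add translate_zero)
  qed (rule mixes_translate[OF s])
qed

end

section \<open>The simple equation as an instance\<close>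

lemma stye_noise_eq: "stye_noise = tye_noise (\<lambda>x. x) (\<lambda>g h. - g + h)"
  by (simp add: fun_eq_iff stye_noise_def tye_noise_def)

text \<open>
  A separate locale for the equation together with its simple equation: as a sublocale of
  \<open>tsirelson_yor\<close> itself, the instance would generate instances of instances without end.
\<close>

locale tsirelson_yor_pair = tsirelson_yor \<theta> \<psi> \<psi>inv \<mu>
  for \<theta> :: "'s::topological_space \<Rightarrow> 'g::topological_group_add" and \<psi> \<psi>inv :: "'g \<Rightarrow> 's \<Rightarrow> 's"
    and \<mu> :: "int \<Rightarrow> 's measure"
begin

definition \<mu>h :: "int \<Rightarrow> 'g measure" where
  "\<mu>h k = distr (\<mu> k) borel \<theta>"

lemma \<theta>_measurable_\<mu>: "k \<le> 0 \<Longrightarrow> \<theta> \<in> \<mu> k \<rightarrow>\<^sub>M borel"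
  using \<theta>_measurable by (simp only: measurable_cong_sets[OF sets_\<mu> refl])

end

sublocale tsirelson_yor_pair \<subseteq> G: tsirelson_yor "\<lambda>x. x" "(+)" "\<lambda>g h. - g + h" \<mu>h
proof
  show "case_prod (+) \<in> borel \<Otimes>\<^sub>M borel \<rightarrow>\<^sub>M (borel :: 'g measure)"
    using add_measurable by simp
  have "uminus \<in> borel \<rightarrow>\<^sub>M (borel :: 'g measure)"
    by (intro borel_measurable_continuous_onI continuous_intros)
  then show "(\<lambda>(g, h). - g + h) \<in> borel \<Otimes>\<^sub>M borel \<rightarrow>\<^sub>M (borel :: 'g measure)"
    unfolding split_beta by (intro measurable_add measurable_compose[OF measurable_fst] measurable_snd)
  show "\<mu>h k \<in> space (prob_algebra borel)" if "k \<le> 0" for k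
    unfolding space_prob_algebra \<mu>h_def
    using prob_space.prob_space_distr[OF prob_space_\<mu> \<theta>_measurable_\<mu>] that by simp
qed (auto simp: add.assoc[symmetric] intro: add_measurable)

context tsirelson_yor_pair
begin

definition group_path :: "(int \<Rightarrow> 's) \<Rightarrow> int \<Rightarrow> 'g" where
  "group_path \<eta> = (\<lambda>k\<in>{..0}. \<theta> (\<eta> k))"

lemma theta_law_eq: "theta_law \<theta> P = distr P path_space group_path"
  unfolding theta_law_def group_path_def[abs_def] ..

lemma space_group_path: "group_path \<eta> \<in> space path_space"
  by (simp add: group_path_def path_space_def space_PiM)

lemma group_noise:
  assumes "k \<le> 0"
  shows "G.\<xi> k (group_path \<eta>) = \<theta> (\<xi> k \<eta>)"
proof -
  have "G.\<xi> k (group_path \<eta>) = - \<theta> (\<eta> (k - 1)) + \<theta> (\<eta> k)"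
    using assms by (simp add: tye_noise_def[of "\<lambda>x. x"] group_path_def)
  also have "\<dots> = \<theta> (\<xi> k \<eta>)"
    unfolding \<theta>_step[of \<eta> k] by (rule minus_add_cancel)
  finally show ?thesis .
qed

lemma group_path_measurable: "group_path \<in> path_space \<rightarrow>\<^sub>M path_space"
  unfolding path_space_def
proof (rule measurable_PiM_single')
  fix j :: int assume "j \<in> {..0}"
  then show "(\<lambda>\<eta>. group_path \<eta> j) \<in> PiM {..0} (\<lambda>_. borel) \<rightarrow>\<^sub>M borel"
    using measurable_compose[OF coord_measurable \<theta>_measurable, of j] by (simp add: path_space_def group_path_def)
qed (use space_group_path in \<open>auto simp: path_space_def space_PiM\<close>)

lemma group_path_measurable_past:
  assumes "k \<le> 0"
  shows "group_path \<in> past_algebra coord k \<rightarrow>\<^sub>M past_algebra coord k"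
proof (rule measurable_into_past_algebra)
  show "group_path \<in> space (past_algebra coord k) \<rightarrow> space path_space"
    using space_group_path by blast
  fix j assume "j \<le> k"
  then have "(\<lambda>\<eta>. coord j (group_path \<eta>)) = (\<lambda>\<eta>. \<theta> (\<eta> j))"
    using assms by (simp add: coord_def group_path_def)
  then show "(\<lambda>\<eta>. coord j (group_path \<eta>)) \<in> past_algebra coord k \<rightarrow>\<^sub>M borel"
    using theta_past_measurable[OF \<open>j \<le> k\<close>] by (simp only:)
qed

lemma theta_law_solution:
  assumes P: "P \<in> solutions \<xi> \<mu>"
  shows "theta_law \<theta> P \<in> solutions G.\<xi> \<mu>h"
proof -
  interpret P: prob_space P by (rule solution_prob_space[OF P])
  have m: "group_path \<in> P \<rightarrow>\<^sub>M path_space"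
    unfolding measurable_from_solution[OF P] by (rule group_path_measurable)
  have sp: "space P = space path_space" by (rule solution_space[OF P])
  show ?thesis
    unfolding theta_law_eq G.solutions_iff
  proof (intro conjI allI impI ballI P.prob_space_distr m)
    fix k :: int and A :: "'g set" and B :: "(int \<Rightarrow> 'g) set"
    assume k: "k \<le> 0" and A: "A \<in> sets borel" and B: "B \<in> past coord (k - 1)"
    have k': "k - 1 \<le> 0" using k by simp
    have B': "B \<in> sets path_space" using past_coord_subset[OF k'] B by blast
    have N: "{\<eta> \<in> space path_space. G.\<xi> k \<eta> \<in> A} \<in> sets path_space"
      by (rule G.noise_event[OF k A])
    have B'': "group_path -` B \<inter> space path_space \<in> past coord (k - 1)"
      using measurable_sets[OF group_path_measurable_past[OF k'], of B] B by (simp add: sets_past_algebra)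
    have A': "\<theta> -` A \<in> sets borel" using measurable_sets[OF \<theta>_measurable A] by simp
    have pre: "group_path -` ({\<eta> \<in> space path_space. G.\<xi> k \<eta> \<in> A} \<inter> B) \<inter> space path_space
        = {\<eta> \<in> space path_space. \<xi> k \<eta> \<in> \<theta> -` A} \<inter> (group_path -` B \<inter> space path_space)"
      using k by (auto simp: group_noise space_group_path)
    have law: "measure (\<mu>h k) A = measure (\<mu> k) (\<theta> -` A)"
      unfolding \<mu>h_def measure_distr[OF \<theta>_measurable_\<mu>[OF k] A] by (simp add: space_\<mu>[OF k])
    have "P.prob ({\<eta> \<in> space path_space. \<xi> k \<eta> \<in> \<theta> -` A} \<inter> (group_path -` B \<inter> space path_space))
        = measure (\<mu> k) (\<theta> -` A) * P.prob (group_path -` B \<inter> space path_space)"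
      using P k A' B'' unfolding solutions_iff by blast
    then show "measure (distr P path_space group_path) ({\<eta> \<in> space path_space. G.\<xi> k \<eta> \<in> A} \<inter> B)
        = measure (\<mu>h k) A * measure (distr P path_space group_path) B"
      unfolding measure_distr[OF m sets.Int[OF N B']] measure_distr[OF m B'] sp pre law .
  qed simp
qed

lemma theta_at_theta_law:
  assumes P: "P \<in> solutions \<xi> \<mu>" and n: "n \<le> 0"
  shows "G.theta_at (theta_law \<theta> P) n = theta_at P n"
proof -
  have m: "group_path \<in> P \<rightarrow>\<^sub>M path_space"
    unfolding measurable_from_solution[OF P] by (rule group_path_measurable)
  show ?thesis
    unfolding G.theta_at_def theta_at_def theta_law_eq distr_distr[OF coord_measurable[OF n] m]
    using n by (intro arg_cong[where f="distr _ _"]) (simp add: fun_eq_iff group_path_def)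
qed

lemma inj_on_theta_law: "inj_on (theta_law \<theta>) (solutions \<xi> \<mu>)"
proof (rule inj_onI)
  fix P Q assume *: "P \<in> solutions \<xi> \<mu>" "Q \<in> solutions \<xi> \<mu>" "theta_law \<theta> P = theta_law \<theta> Q"
  show "P = Q"
    by (rule solution_unique[OF *(1,2)])
      (simp add: theta_at_theta_law[OF *(1), symmetric] theta_at_theta_law[OF *(2), symmetric] *(3))
qed

text \<open>Since \<open>\<mu>h n\<close> is the image of \<open>\<mu> n\<close> under \<open>\<theta>\<close>, both equations put the same condition on the laws of
the group components.\<close>

lemma consistent_laws_of_group_solution:
  assumes R: "R \<in> solutions G.\<xi> \<mu>h"
  shows "consistent_laws (G.theta_at R)"
  unfolding consistent_laws_def
proof (intro allI impI conjI G.theta_at_props[OF R])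
  fix n :: int assume n: "n \<le> 0"
  have n': "n - 1 \<le> 0" using n by simp
  let ?L = "G.theta_at R (n - 1)"
  interpret L: prob_space ?L by (rule G.theta_at_props(2)[OF R n'])
  interpret \<mu>h: prob_space "\<mu>h n" by (rule G.prob_space_\<mu>[OF n])
  note m\<theta> = \<theta>_measurable_\<mu>[OF n]
  have "?L \<Otimes>\<^sub>M \<mu>h n = distr ?L ?L (\<lambda>g. g) \<Otimes>\<^sub>M distr (\<mu> n) borel \<theta>"
    unfolding \<mu>h_def by (simp only: distr_id)
  also have "\<dots> = distr (?L \<Otimes>\<^sub>M \<mu> n) (?L \<Otimes>\<^sub>M borel) (\<lambda>(g, s). (g, \<theta> s))"
    by (rule pair_measure_distr[OF _ m\<theta>])
      (use \<mu>h.sigma_finite_measure_axioms in \<open>simp_all add: \<mu>h_def\<close>)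
  finally have pair: "?L \<Otimes>\<^sub>M \<mu>h n = distr (?L \<Otimes>\<^sub>M \<mu> n) (?L \<Otimes>\<^sub>M borel) (\<lambda>(g, s). (g, \<theta> s))" .
  have m1: "(\<lambda>(g, s). (g, \<theta> s)) \<in> ?L \<Otimes>\<^sub>M \<mu> n \<rightarrow>\<^sub>M ?L \<Otimes>\<^sub>M borel"
    unfolding split_beta by (intro measurable_Pair measurable_fst measurable_compose[OF measurable_snd m\<theta>])
  have m2: "case_prod (+) \<in> ?L \<Otimes>\<^sub>M borel \<rightarrow>\<^sub>M borel"
    using add_measurable
    by (simp only: measurable_cong_sets[OF sets_pair_measure_cong[OF G.theta_at_props(1)[OF R n'] refl] refl])
  have "G.theta_at R n = distr (?L \<Otimes>\<^sub>M \<mu>h n) borel (case_prod (+))"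
    using G.distr_coord_step[OF R n] unfolding G.theta_at_def .
  also have "\<dots> = distr (?L \<Otimes>\<^sub>M \<mu> n) borel (\<lambda>(g, s). g + \<theta> s)"
    unfolding pair distr_distr[OF m2 m1]
    by (intro arg_cong[where f="distr _ _"]) (simp add: fun_eq_iff)
  finally show "G.theta_at R n = distr (?L \<Otimes>\<^sub>M \<mu> n) borel (\<lambda>(g, s). g + \<theta> s)" .
qed

text \<open>From right to left the law is an affine function of the measure. For the converse, the mixture of \<open>Q\<close>
and \<open>R\<close> is a solution, and by injectivity it is \<open>P\<close>.\<close>

lemma theta_law_mixes_iff:
  assumes s: "P \<in> solutions \<xi> \<mu>" "Q \<in> solutions \<xi> \<mu>" "R \<in> solutions \<xi> \<mu>" and t: "0 < t" "t < 1"
  shows "mixes t (theta_law \<theta> P) (theta_law \<theta> Q) (theta_law \<theta> R) \<longleftrightarrow> mixes t P Q R"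
proof
  have law: "mixes t (theta_law \<theta> P) (theta_law \<theta> Q) (theta_law \<theta> R)"
    if "P \<in> solutions \<xi> \<mu>" "mixes t P Q R" for P
    unfolding theta_law_eq using s that
    by (intro mixes_distr) (simp_all add: measurable_from_solution group_path_measurable solution_sets)
  then show "mixes t P Q R \<Longrightarrow> mixes t (theta_law \<theta> P) (theta_law \<theta> Q) (theta_law \<theta> R)"
    using s by blast
  assume a: "mixes t (theta_law \<theta> P) (theta_law \<theta> Q) (theta_law \<theta> R)"
  obtain M where M: "M \<in> solutions \<xi> \<mu>" "mixes t M Q R"
    using mixture_solution_exists[OF s(2,3), of t] t by auto
  have "theta_law \<theta> P = theta_law \<theta> M"
    using a law[OF M] theta_law_solution[OF s(1)] theta_law_solution[OF M(1)]
    by (intro measure_eqI_mixes[of t _ "theta_law \<theta> Q" "theta_law \<theta> R"]) (auto simp: G.solutions_iff)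
  then have "P = M" using inj_on_theta_law s(1) M(1) by (auto dest: inj_onD)
  with M show "mixes t P Q R" by simp
qed

end

theorem bij_betw_theta_law:
  fixes \<theta> :: "'s::polish_space \<Rightarrow> 'g::topological_group_add"
  assumes "tsirelson_yor \<theta> \<psi> \<psi>inv \<mu>"
  shows "bij_betw (theta_law \<theta>) (solutions (tye_noise \<theta> \<psi>inv) \<mu>) (solutions stye_noise (\<lambda>k. distr (\<mu> k) borel \<theta>))"
proof -
  interpret tsirelson_yor_pair \<theta> \<psi> \<psi>inv \<mu> using assms by (simp add: tsirelson_yor_pair_def)
  have eq: "solutions stye_noise (\<lambda>k. distr (\<mu> k) borel \<theta>) = solutions G.\<xi> \<mu>h"
    by (simp add: stye_noise_eq \<mu>h_def[abs_def])
  have "theta_law \<theta> ` solutions \<xi> \<mu> = solutions G.\<xi> \<mu>h"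
  proof (intro equalityI subsetI)
    fix R assume R: "R \<in> solutions G.\<xi> \<mu>h"
    obtain P where P: "P \<in> solutions \<xi> \<mu>" and at: "\<forall>n\<le>0. theta_at P n = G.theta_at R n"
      using solution_exists[OF assms consistent_laws_of_group_solution[OF R]] by blast
    have "theta_law \<theta> P = R"
      using at by (intro G.solution_unique theta_law_solution P R) (simp add: theta_at_theta_law[OF P])
    then show "R \<in> theta_law \<theta> ` solutions \<xi> \<mu>" using P by blast
  qed (auto intro: theta_law_solution)
  then show ?thesis
    unfolding eq by (rule bij_betw_imageI[OF inj_on_theta_law])
qed

section \<open>Extremal solutions form one orbit\<close>

lemma integrable_bounded:
  fixes f :: "'a \<Rightarrow> real"
  assumes "prob_space M" "f \<in> borel_measurable M" "\<And>x. x \<in> space M \<Longrightarrow> \<bar>f x\<bar> \<le> B"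
  shows "integrable M f"
proof -
  interpret prob_space M by fact
  show ?thesis by (rule integrable_const_bound[of _ B]) (use assms in auto)
qed

lemma abs_le_of_interval: "x \<in> {a..b} \<Longrightarrow> \<bar>x\<bar> \<le> \<bar>a\<bar> + \<bar>b\<bar>" for x :: real
  by auto

lemma integral_bounds:
  fixes f :: "'a \<Rightarrow> real"
  assumes M: "prob_space M" and f: "f \<in> borel_measurable M" and ab: "\<And>x. x \<in> space M \<Longrightarrow> f x \<in> {a..b}"
  shows "(\<integral>x. f x \<partial>M) \<in> {a..b}"
proof -
  interpret prob_space M by fact
  have int: "integrable M f"
    by (rule integrable_bounded[OF M f abs_le_of_interval[OF ab]])
  have "(\<integral>x. a \<partial>M) \<le> (\<integral>x. f x \<partial>M)"
    by (rule integral_mono[OF integrable_const int]) (use ab in auto)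
  moreover have "(\<integral>x. f x \<partial>M) \<le> (\<integral>x. b \<partial>M)"
    by (rule integral_mono[OF int integrable_const]) (use ab in auto)
  ultimately show ?thesis by (simp add: prob_space)
qed

text \<open>The sum of the absolute increments has finite expectation, hence is finite almost everywhere.\<close>

lemma L1_summable_imp_AE_convergent:
  fixes Y :: "nat \<Rightarrow> 'a \<Rightarrow> real"
  assumes Y: "\<And>i. integrable M (Y i)" and le: "\<And>i. (\<integral>x. \<bar>Y (Suc i) x - Y i x\<bar> \<partial>M) \<le> a i" and a: "summable a"
  shows "AE x in M. convergent (\<lambda>i. Y i x)"
proof -
  let ?d = "\<lambda>i x. \<bar>Y (Suc i) x - Y i x\<bar>"
  have [measurable]: "Y i \<in> borel_measurable M" for i using Y by (rule borel_measurable_integrable)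
  have int: "integrable M (?d i)" for i using Y by (intro integrable_abs Bochner_Integration.integrable_diff)
  have a0: "0 \<le> a i" for i
    by (rule order_trans[OF Bochner_Integration.integral_nonneg le]) simp
  have "(\<integral>\<^sup>+x. (\<Sum>i. ennreal (?d i x)) \<partial>M) = (\<Sum>i. \<integral>\<^sup>+x. ennreal (?d i x) \<partial>M)"
    by (rule nn_integral_suminf) measurable
  also have "\<dots> = (\<Sum>i. ennreal (\<integral>x. ?d i x \<partial>M))"
    by (intro suminf_cong nn_integral_eq_integral int) simp
  also have "\<dots> \<le> (\<Sum>i. ennreal (a i))"
    by (intro suminf_le ennreal_leI le) auto
  also have "\<dots> = ennreal (\<Sum>i. a i)" by (rule suminf_ennreal2[OF a0 a])
  finally have "(\<integral>\<^sup>+x. (\<Sum>i. ennreal (?d i x)) \<partial>M) \<noteq> \<infinity>"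
    by (metis ennreal_neq_top infinity_ennreal_def top.extremum_unique)
  then have "AE x in M. (\<Sum>i. ennreal (?d i x)) \<noteq> \<infinity>"
    by (intro nn_integral_PInf_AE) measurable
  then show ?thesis
  proof eventually_elim
    case (elim x)
    have "summable (\<lambda>i. ?d i x)"
      by (rule summable_suminf_not_top) (use elim in auto)
    then have "summable (\<lambda>i. Y (Suc i) x - Y i x)" by (rule summable_rabs_cancel)
    then have "convergent (\<lambda>n. \<Sum>i<n. Y (Suc i) x - Y i x)" by (simp add: summable_iff_convergent)
    then have "convergent (\<lambda>n. Y n x - Y 0 x)" by (simp only: sum_lessThan_telescope[where f="\<lambda>i. Y i x"])
    then have "convergent (\<lambda>n. (Y n x - Y 0 x) + Y 0 x)" by (intro convergent_add convergent_const)
    then show ?case by simp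
  qed
qed

context tsirelson_yor
begin

lemma noise_integral:
  fixes H :: "(int \<Rightarrow> 's) \<times> 's \<Rightarrow> real"
  assumes P: "P \<in> solutions \<xi> \<mu>" and j: "j \<le> 0"
    and H: "H \<in> borel_measurable (past_algebra coord (j - 1) \<Otimes>\<^sub>M borel)" and B: "\<And>z. \<bar>H z\<bar> \<le> B"
  shows "(\<integral>\<eta>. H (\<eta>, \<xi> j \<eta>) \<partial>P) = (\<integral>\<eta>. (\<integral>s. H (\<eta>, s) \<partial>\<mu> j) \<partial>P)"
proof -
  let ?F = "past_algebra coord (j - 1)"
  interpret P: prob_space P by (rule solution_prob_space[OF P])
  interpret \<mu>: prob_space "\<mu> j" by (rule prob_space_\<mu>[OF j])
  have idF: "(\<lambda>\<eta>. \<eta>) \<in> ?F \<rightarrow>\<^sub>M ?F" by (rule measurable_ident_sets) simp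
  have id: "(\<lambda>\<eta>. \<eta>) \<in> P \<rightarrow>\<^sub>M ?F"
    unfolding measurable_from_solution[OF P] using j by (intro measurable_from_past[OF idF]) simp
  have \<xi>m: "\<xi> j \<in> P \<rightarrow>\<^sub>M borel" unfolding measurable_from_solution[OF P] by (rule \<xi>_measurable[OF j])
  note mp = measurable_Pair[OF id \<xi>m]
  interpret F: prob_space "distr P ?F (\<lambda>\<eta>. \<eta>)" using id by (rule P.prob_space_distr)
  interpret pair: pair_prob_space "distr P ?F (\<lambda>\<eta>. \<eta>)" "\<mu> j" ..
  have sets: "sets (distr P ?F (\<lambda>\<eta>. \<eta>) \<Otimes>\<^sub>M \<mu> j) = sets (?F \<Otimes>\<^sub>M borel)"
    by (intro sets_pair_measure_cong sets_\<mu>[OF j]) simp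
  have Hm: "H \<in> borel_measurable (distr P ?F (\<lambda>\<eta>. \<eta>) \<Otimes>\<^sub>M \<mu> j)"
    using H by (simp only: measurable_cong_sets[OF sets refl])
  have int: "integrable (distr P ?F (\<lambda>\<eta>. \<eta>) \<Otimes>\<^sub>M \<mu> j) H"
    by (rule integrable_bounded[OF _ Hm B]) unfold_locales
  have Hm': "H \<in> borel_measurable (?F \<Otimes>\<^sub>M \<mu> j)"
    using H by (simp only: measurable_cong_sets[OF sets_pair_measure_cong[OF refl sets_\<mu>[OF j]] refl])
  have inner: "(\<lambda>\<eta>. \<integral>s. H (\<eta>, s) \<partial>\<mu> j) \<in> borel_measurable ?F"
    using Hm' by (intro \<mu>.borel_measurable_lebesgue_integral) simp
  have "(\<integral>\<eta>. H (\<eta>, \<xi> j \<eta>) \<partial>P) = (\<integral>z. H z \<partial>distr P (?F \<Otimes>\<^sub>M borel) (\<lambda>\<eta>. (\<eta>, \<xi> j \<eta>)))"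
    by (rule integral_distr[OF mp H, symmetric])
  also have "\<dots> = (\<integral>z. H z \<partial>(distr P ?F (\<lambda>\<eta>. \<eta>) \<Otimes>\<^sub>M \<mu> j))"
    by (simp only: solution_noise_independent[OF P j idF])
  also have "\<dots> = (\<integral>\<eta>. (\<integral>s. H (\<eta>, s) \<partial>\<mu> j) \<partial>distr P ?F (\<lambda>\<eta>. \<eta>))"
    by (rule pair.integral_fst'[OF int, symmetric])
  also have "\<dots> = (\<integral>\<eta>. (\<integral>s. H (\<eta>, s) \<partial>\<mu> j) \<partial>P)"
    by (rule integral_distr[OF id inner])
  finally show ?thesis .
qed

text \<open>\<open>average k f m\<close> at \<open>\<theta> (\<eta> (k - m))\<close> is the conditional expectation of \<open>f (\<theta> (\<eta> k))\<close> given the past of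
\<open>k - m\<close>; see \<open>average_tower\<close>.\<close>

primrec average :: "int \<Rightarrow> ('g \<Rightarrow> real) \<Rightarrow> nat \<Rightarrow> 'g \<Rightarrow> real" where
  "average k f 0 = f"
| "average k f (Suc m) = (\<lambda>g. \<integral>s. average k f m (g + \<theta> s) \<partial>\<mu> (k - int m))"

lemma add_theta_measurable: "(\<lambda>(g, s). g + \<theta> s) \<in> borel \<Otimes>\<^sub>M borel \<rightarrow>\<^sub>M borel"
  unfolding split_beta by (intro measurable_add measurable_compose[OF measurable_snd \<theta>_measurable] measurable_fst)

lemma add_theta_measurable_\<mu>: "j \<le> 0 \<Longrightarrow> (\<lambda>s. g + \<theta> s) \<in> \<mu> j \<rightarrow>\<^sub>M borel"
  by (simp only: measurable_cong_sets[OF sets_\<mu> refl]) (intro measurable_add \<theta>_measurable measurable_const, simp)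

lemma average_measurable:
  assumes "k \<le> 0" "f \<in> borel_measurable borel"
  shows "average k f m \<in> borel_measurable borel"
proof (induction m)
  case 0
  then show ?case using assms by simp
next
  case (Suc m)
  have j: "k - int m \<le> 0" using assms(1) by simp
  interpret \<mu>: prob_space "\<mu> (k - int m)" by (rule prob_space_\<mu>[OF j])
  have "(\<lambda>(g, s). average k f m (g + \<theta> s)) \<in> borel_measurable (borel \<Otimes>\<^sub>M borel)"
    using measurable_compose[OF add_theta_measurable Suc] by (simp add: split_beta)
  then have "(\<lambda>(g, s). average k f m (g + \<theta> s)) \<in> borel_measurable (borel \<Otimes>\<^sub>M \<mu> (k - int m))"
    by (simp only: measurable_cong_sets[OF sets_pair_measure_cong[OF refl sets_\<mu>[OF j]] refl])
  then show ?case
    unfolding average.simps by (rule \<mu>.borel_measurable_lebesgue_integral)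
qed

lemma average_bounds:
  assumes "k \<le> 0" "f \<in> borel_measurable borel" "\<And>g. f g \<in> {a..b}"
  shows "average k f m g \<in> {a..b}"
proof (induction m arbitrary: g)
  case 0
  then show ?case using assms by simp
next
  case (Suc m)
  have j: "k - int m \<le> 0" using assms(1) by simp
  show ?case
    unfolding average.simps
    by (rule integral_bounds[OF prob_space_\<mu>[OF j]
          measurable_compose[OF add_theta_measurable_\<mu>[OF j] average_measurable[OF assms(1,2)]]]) (rule Suc)
qed

lemma average_translate: "average k (\<lambda>x. f (z + x)) m g = average k f m (z + g)"
  by (induction m arbitrary: g) (simp_all add: add.assoc)

lemma average_diff:
  assumes k: "k \<le> 0" and f: "f \<in> borel_measurable borel" "\<And>g. f g \<in> {a..b}"
    and h: "h \<in> borel_measurable borel" "\<And>g. h g \<in> {a..b}"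
    and e: "\<And>g. \<bar>f g - h g\<bar> \<le> e"
  shows "\<bar>average k f m g - average k h m g\<bar> \<le> e"
proof (induction m arbitrary: g)
  case 0
  then show ?case using e by simp
next
  case (Suc m)
  have j: "k - int m \<le> 0" using k by simp
  note pr = prob_space_\<mu>[OF j]
  have m: "(\<lambda>s. average k f' m (g + \<theta> s)) \<in> borel_measurable (\<mu> (k - int m))"
    if "f' \<in> borel_measurable borel" for f'
    by (rule measurable_compose[OF add_theta_measurable_\<mu>[OF j] average_measurable[OF k that]])
  have int: "integrable (\<mu> (k - int m)) (\<lambda>s. average k f' m (g + \<theta> s))"
    if "f' \<in> borel_measurable borel" "\<And>g. f' g \<in> {a..b}" for f'
    by (rule integrable_bounded[OF pr m[OF that(1)] abs_le_of_interval[OF average_bounds[OF k that]]])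
  have "average k f (Suc m) g - average k h (Suc m) g
      = (\<integral>s. average k f m (g + \<theta> s) - average k h m (g + \<theta> s) \<partial>\<mu> (k - int m))"
    unfolding average.simps by (rule Bochner_Integration.integral_diff[symmetric, OF int[OF f] int[OF h]])
  also have "\<dots> \<in> {- e..e}"
  proof (rule integral_bounds[OF pr])
    show "average k f m (g + \<theta> s) - average k h m (g + \<theta> s) \<in> {- e..e}" for s
      using Suc[of "g + \<theta> s"] by (auto simp: abs_le_iff)
  qed (intro borel_measurable_diff m f h)
  finally show ?case by (auto simp: abs_le_iff)
qed

lemma average_tower:
  assumes P: "P \<in> solutions \<xi> \<mu>" and k: "k \<le> 0" and f: "f \<in> borel_measurable borel" "\<And>g. f g \<in> {a..b}"
    and m: "m \<le> m'" and h: "h \<in> borel_measurable (past_algebra coord (k - int m'))" "\<And>\<eta>. \<bar>h \<eta>\<bar> \<le> c"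
  shows "(\<integral>\<eta>. h \<eta> * average k f m (\<theta> (\<eta> (k - int m))) \<partial>P)
    = (\<integral>\<eta>. h \<eta> * average k f m' (\<theta> (\<eta> (k - int m'))) \<partial>P)"
  using m h
proof (induction m' rule: dec_induct)
  case base
  then show ?case by simp
next
  case (step n)
  define j where "j = k - int n"
  have j: "j \<le> 0" "k - int (Suc n) = j - 1" using k by (auto simp: j_def)
  have h: "h \<in> borel_measurable (past_algebra coord (j - 1))" using step.prems(1) by (simp only: j(2))
  have "past coord (j - 1) \<subseteq> past (coord :: int \<Rightarrow> (int \<Rightarrow> 's) \<Rightarrow> 's) j" by (rule past_mono) simp
  with h have "h \<in> borel_measurable (past_algebra coord j)"
    by (auto simp: measurable_def sets_past_algebra)
  then have "(\<integral>\<eta>. h \<eta> * average k f m (\<theta> (\<eta> (k - int m))) \<partial>P)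
      = (\<integral>\<eta>. h \<eta> * average k f n (\<theta> (\<eta> j)) \<partial>P)"
    using step.IH step.prems(2) by (simp only: j_def)
  also have "\<dots> = (\<integral>\<eta>. h \<eta> * average k f n (\<theta> (\<eta> (j - 1)) + \<theta> (\<xi> j \<eta>)) \<partial>P)"
    by (simp only: \<theta>_step[of _ j])
  also have "\<dots> = (\<integral>\<eta>. (\<integral>s. h \<eta> * average k f n (\<theta> (\<eta> (j - 1)) + \<theta> s) \<partial>\<mu> j) \<partial>P)"
  proof -
    define H where "H z = h (fst z) * average k f n (\<theta> (fst z (j - 1)) + \<theta> (snd z))" for z
    have tm: "(\<lambda>\<eta>. \<theta> (\<eta> (j - 1))) \<in> past_algebra coord (j - 1) \<rightarrow>\<^sub>M borel"
      by (rule theta_past_measurable) simp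
    have Hm: "H \<in> borel_measurable (past_algebra coord (j - 1) \<Otimes>\<^sub>M borel)"
      unfolding H_def
      by (intro borel_measurable_times measurable_compose[OF measurable_fst h]
          measurable_compose[OF _ average_measurable[OF k f(1)]] measurable_add
          measurable_compose[OF measurable_fst tm] measurable_compose[OF measurable_snd \<theta>_measurable])
    have "\<bar>H z\<bar> \<le> c * (\<bar>a\<bar> + \<bar>b\<bar>)" for z
      unfolding H_def abs_mult
      using average_bounds[where m=n and g="\<theta> (fst z (j - 1)) + \<theta> (snd z)", OF k f] step.prems(2)[of "fst z"]
      by (intro mult_mono) (auto simp: abs_le_iff)
    from noise_integral[OF P j(1) Hm this] show ?thesis by (simp add: H_def)
  qed
  also have "\<dots> = (\<integral>\<eta>. h \<eta> * average k f (Suc n) (\<theta> (\<eta> (j - 1))) \<partial>P)"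
    by (simp add: j_def)
  finally show ?case by (simp only: j(2))
qed

lemma average_path_measurable:
  assumes "k \<le> 0" "f \<in> borel_measurable borel" "k - int m \<le> l"
  shows "(\<lambda>\<eta>. average k f m (\<theta> (\<eta> (k - int m)))) \<in> borel_measurable (past_algebra coord l)"
  by (rule measurable_compose[OF theta_past_measurable[OF assms(3)] average_measurable[OF assms(1,2)]])

text \<open>Tilting a solution by a density that the noise does not see changes neither the law of the noise nor
its independence of the past.\<close>

lemma density_solution:
  assumes P: "P \<in> solutions \<xi> \<mu>" and u: "u \<in> borel_measurable path_space" "\<And>\<eta>. 0 \<le> u \<eta>" "\<And>\<eta>. u \<eta> \<le> b"
    and one: "(\<integral>\<eta>. u \<eta> \<partial>P) = 1"
    and indep: "\<And>k A B. k \<le> 0 \<Longrightarrow> A \<in> sets borel \<Longrightarrow> B \<in> past coord (k - 1) \<Longrightarrow>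
      (\<integral>\<eta>. indicator ({\<eta> \<in> space path_space. \<xi> k \<eta> \<in> A} \<inter> B) \<eta> * u \<eta> \<partial>P)
        = measure (\<mu> k) A * (\<integral>\<eta>. indicator B \<eta> * u \<eta> \<partial>P)"
  shows "density P u \<in> solutions \<xi> \<mu>" "\<And>A. A \<in> sets P \<Longrightarrow> measure (density P u) A = (\<integral>\<eta>. indicator A \<eta> * u \<eta> \<partial>P)"
proof -
  interpret P: prob_space P by (rule solution_prob_space[OF P])
  have um: "u \<in> borel_measurable P" using u(1) by (simp only: measurable_from_solution[OF P])
  have em: "emeasure (density P u) A = ennreal (\<integral>\<eta>. indicator A \<eta> * u \<eta> \<partial>P)" if A: "A \<in> sets P" for A
  proof -
    have "integrable P (\<lambda>\<eta>. indicator A \<eta> * u \<eta>)"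
      using A um u(2,3) by (intro integrable_bounded[OF P.prob_space_axioms, of _ b])
        (auto split: split_indicator intro: order_trans[OF u(2) u(3)])
    moreover have "emeasure (density P u) A = (\<integral>\<^sup>+\<eta>. ennreal (indicator A \<eta> * u \<eta>) \<partial>P)"
      using A um by (subst emeasure_density) (auto intro!: nn_integral_cong split: split_indicator)
    ultimately show ?thesis
      using u(2) by (simp add: nn_integral_eq_integral)
  qed
  show m: "measure (density P u) A = (\<integral>\<eta>. indicator A \<eta> * u \<eta> \<partial>P)" if "A \<in> sets P" for A
    unfolding measure_def em[OF that] using u(2) by (intro enn2real_ennreal integral_nonneg_AE) auto
  have "emeasure (density P u) (space (density P u)) = 1"
  proof -
    have "(\<integral>\<eta>. indicator (space P) \<eta> * u \<eta> \<partial>P) = (\<integral>\<eta>. u \<eta> \<partial>P)"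
      by (intro Bochner_Integration.integral_cong) auto
    then show ?thesis using em[OF sets.top] one by simp
  qed
  then have pr: "prob_space (density P u)" by (rule prob_spaceI)
  show "density P u \<in> solutions \<xi> \<mu>"
    unfolding solutions_iff
  proof (intro conjI allI impI ballI pr)
    show "sets (density P u) = sets path_space" by (simp add: solution_sets[OF P])
    fix k :: int and A :: "'s set" and B :: "(int \<Rightarrow> 's) set"
    assume k: "k \<le> 0" and A: "A \<in> sets borel" and B: "B \<in> past coord (k - 1)"
    have k': "k - 1 \<le> 0" using k by simp
    have B': "B \<in> sets P" using past_coord_subset[OF k'] B solution_sets[OF P] by blast
    have N: "{\<eta> \<in> space path_space. \<xi> k \<eta> \<in> A} \<in> sets P"
      unfolding solution_sets[OF P]
      by (rule noise_event[OF k A])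
    show "measure (density P u) ({\<eta> \<in> space path_space. \<xi> k \<eta> \<in> A} \<inter> B)
        = measure (\<mu> k) A * measure (density P u) B"
      unfolding m[OF B'] m[OF sets.Int[OF N B']] by (rule indep[OF k A B])
  qed
qed

text \<open>With \<open>c\<close> the mean of \<open>y\<close>, the solution is the mixture with weights \<open>c\<close> and \<open>1 - c\<close> of its tilts by
\<open>y / c\<close> and \<open>(1 - y) / (1 - c)\<close>. Extremality makes the tilts equal, and this forces \<open>y = c\<close>. The
bounds 1/4 and 3/4 keep both denominators away from 0.\<close>

lemma extremal_tail_constant:
  assumes P: "P \<in> extremal_points (solutions \<xi> \<mu>)"
    and y: "y \<in> borel_measurable path_space" "\<And>\<eta>. y \<eta> \<in> {1/4..3/4}"
    and indep: "\<And>k A B. k \<le> 0 \<Longrightarrow> A \<in> sets borel \<Longrightarrow> B \<in> past coord (k - 1) \<Longrightarrow>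
      (\<integral>\<eta>. indicator ({\<eta> \<in> space path_space. \<xi> k \<eta> \<in> A} \<inter> B) \<eta> * y \<eta> \<partial>P)
        = measure (\<mu> k) A * (\<integral>\<eta>. indicator B \<eta> * y \<eta> \<partial>P)"
  shows "AE \<eta> in P. y \<eta> = (\<integral>\<eta>. y \<eta> \<partial>P)"
proof -
  have sol: "P \<in> solutions \<xi> \<mu>" using P by (simp add: extremal_points_iff)
  interpret P: prob_space P by (rule solution_prob_space[OF sol])
  have ym: "y \<in> borel_measurable P" using y(1) by (simp only: measurable_from_solution[OF sol])
  define c where "c = (\<integral>\<eta>. y \<eta> \<partial>P)"
  have c: "c \<in> {1/4..3/4}"
    unfolding c_def by (rule integral_bounds[OF P.prob_space_axioms ym]) (rule y(2))
  have yb: "0 \<le> y \<eta>" "y \<eta> \<le> 1" for \<eta> using y(2)[of \<eta>] by auto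
  have int_ind: "integrable P (\<lambda>\<eta>. indicator A \<eta> * y \<eta>)" "integrable P (indicator A :: _ \<Rightarrow> real)"
    if "A \<in> sets P" for A
    using that ym yb by (auto intro!: integrable_bounded[OF P.prob_space_axioms, of _ 1] split: split_indicator)
  have int_y: "integrable P y" using ym yb by (intro integrable_bounded[OF P.prob_space_axioms, of _ 1]) auto
  define u where "u \<eta> = y \<eta> / c" for \<eta>
  define v where "v \<eta> = (1 - y \<eta>) / (1 - c)" for \<eta>
  have iu: "(\<integral>\<eta>. indicator A \<eta> * u \<eta> \<partial>P) = (\<integral>\<eta>. indicator A \<eta> * y \<eta> \<partial>P) / c" for A
    unfolding u_def by simp
  have iv: "(\<integral>\<eta>. indicator A \<eta> * v \<eta> \<partial>P) = (P.prob A - (\<integral>\<eta>. indicator A \<eta> * y \<eta> \<partial>P)) / (1 - c)"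
    if A: "A \<in> sets P" for A
  proof -
    have "(\<integral>\<eta>. indicator A \<eta> * v \<eta> \<partial>P) = (\<integral>\<eta>. (indicator A \<eta> - indicator A \<eta> * y \<eta>) / (1 - c) \<partial>P)"
      by (intro Bochner_Integration.integral_cong) (auto simp: v_def field_simps split: split_indicator)
    also have "\<dots> = (\<integral>\<eta>. indicator A \<eta> - indicator A \<eta> * y \<eta> \<partial>P) / (1 - c)" by simp
    also have "(\<integral>\<eta>. indicator A \<eta> - indicator A \<eta> * y \<eta> \<partial>P) = P.prob A - (\<integral>\<eta>. indicator A \<eta> * y \<eta> \<partial>P)"
      using int_ind[OF A] A by simp
    finally show ?thesis .
  qed
  have sets: "B \<in> sets P" "{\<eta> \<in> space path_space. \<xi> k \<eta> \<in> A} \<inter> B \<in> sets P"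
    if "k \<le> 0" "A \<in> sets borel" "B \<in> past coord (k - 1)" for k A B
  proof -
    have k': "k - 1 \<le> 0" using that(1) by simp
    show B: "B \<in> sets P" using past_coord_subset[OF k'] that(3) solution_sets[OF sol] by blast
    have "{\<eta> \<in> space path_space. \<xi> k \<eta> \<in> A} \<in> sets P"
      unfolding solution_sets[OF sol]
      by (rule noise_event[OF that(1) that(2)])
    then show "{\<eta> \<in> space path_space. \<xi> k \<eta> \<in> A} \<inter> B \<in> sets P" using B by (rule sets.Int)
  qed
  have "u \<in> borel_measurable path_space" unfolding u_def using y(1) by simp
  moreover have "0 \<le> u \<eta>" "u \<eta> \<le> 4" for \<eta>
    using yb[of \<eta>] c by (simp_all add: u_def field_simps)
  moreover have "(\<integral>\<eta>. u \<eta> \<partial>P) = 1" using c by (simp add: u_def c_def[symmetric])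
  moreover have "(\<integral>\<eta>. indicator ({\<eta> \<in> space path_space. \<xi> k \<eta> \<in> A} \<inter> B) \<eta> * u \<eta> \<partial>P)
      = measure (\<mu> k) A * (\<integral>\<eta>. indicator B \<eta> * u \<eta> \<partial>P)"
    if "k \<le> 0" "A \<in> sets borel" "B \<in> past coord (k - 1)" for k A B
    unfolding iu indep[OF that] by simp
  ultimately have Q: "density P u \<in> solutions \<xi> \<mu>"
    "\<And>A. A \<in> sets P \<Longrightarrow> measure (density P u) A = (\<integral>\<eta>. indicator A \<eta> * u \<eta> \<partial>P)"
    using density_solution[OF sol, of u 4] by blast+
  have "v \<in> borel_measurable path_space" unfolding v_def using y(1) by simp
  moreover have "0 \<le> v \<eta>" "v \<eta> \<le> 4" for \<eta>
    using yb[of \<eta>] c by (simp_all add: v_def field_simps)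
  moreover have "(\<integral>\<eta>. v \<eta> \<partial>P) = 1"
  proof -
    have "(\<integral>\<eta>. 1 - y \<eta> \<partial>P) = 1 - c" using int_y by (simp add: c_def P.prob_space)
    then show ?thesis using c by (simp add: v_def)
  qed
  moreover have "(\<integral>\<eta>. indicator ({\<eta> \<in> space path_space. \<xi> k \<eta> \<in> A} \<inter> B) \<eta> * v \<eta> \<partial>P)
      = measure (\<mu> k) A * (\<integral>\<eta>. indicator B \<eta> * v \<eta> \<partial>P)"
    if *: "k \<le> 0" "A \<in> sets borel" "B \<in> past coord (k - 1)" for k A B
  proof -
    have "P.prob ({\<eta> \<in> space path_space. \<xi> k \<eta> \<in> A} \<inter> B) = measure (\<mu> k) A * P.prob B"
      using sol * unfolding solutions_iff by blast
    then show ?thesis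
      unfolding iv[OF sets(1)[OF *]] iv[OF sets(2)[OF *]] indep[OF *] by (simp add: algebra_simps)
  qed
  ultimately have R: "density P v \<in> solutions \<xi> \<mu>"
    "\<And>A. A \<in> sets P \<Longrightarrow> measure (density P v) A = (\<integral>\<eta>. indicator A \<eta> * v \<eta> \<partial>P)"
    using density_solution[OF sol, of v 4] by blast+
  have "mixes (1 - c) P (density P u) (density P v)"
    unfolding mixes_def
  proof
    fix A assume A: "A \<in> sets P"
    show "P.prob A = (1 - (1 - c)) * measure (density P u) A + (1 - c) * measure (density P v) A"
      unfolding Q(2)[OF A] R(2)[OF A] iu iv[OF A] using c by simp
  qed
  moreover have "0 < 1 - c" "1 - c < 1" using c by auto
  ultimately have "density P u = density P v"
    using P Q(1) R(1) unfolding extremal_points_iff by blast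
  moreover have "(\<lambda>\<eta>. ennreal (u \<eta>)) \<in> borel_measurable P" "(\<lambda>\<eta>. ennreal (v \<eta>)) \<in> borel_measurable P"
    using ym by (simp_all add: u_def v_def)
  ultimately have "AE \<eta> in P. ennreal (u \<eta>) = ennreal (v \<eta>)"
    using P.density_unique_iff by blast
  then show ?thesis
  proof eventually_elim
    case (elim \<eta>)
    moreover have "0 \<le> u \<eta>" "0 \<le> v \<eta>" using yb c by (auto simp: u_def v_def)
    ultimately have "y \<eta> / c = (1 - y \<eta>) / (1 - c)" by (simp add: u_def v_def)
    then have "y \<eta> = c" using c by (simp add: field_simps)
    then show ?case by (simp add: c_def)
  qed
qed

text \<open>The second moments \<open>V m\<close> of the backward martingale \<open>Y m\<close> decrease, and \<open>V m - V m'\<close> is the squared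
L2 distance of \<open>Y m\<close> and \<open>Y m'\<close>. So a subsequence converges almost everywhere. For every time \<open>l\<close>, all
but finitely many \<open>Y m\<close> belong to the past of \<open>l - 1\<close> and are independent of the noise at \<open>l\<close>; thus
\<open>extremal_tail_constant\<close> applies to the limit. As \<open>V\<close> is monotone, the variance tends to 0 along
the whole sequence.\<close>

lemma extremal_average_converges:
  assumes P: "P \<in> extremal_points (solutions \<xi> \<mu>)" and k: "k \<le> 0"
    and f: "f \<in> borel_measurable borel" "\<And>g. f g \<in> {1/4..3/4}" and e: "0 < e"
  defines "c \<equiv> \<integral>g. f g \<partial>theta_at P k"
  shows "\<exists>N. \<forall>m\<ge>N. (\<integral>\<eta>. (average k f m (\<theta> (\<eta> (k - int m))) - c)\<^sup>2 \<partial>P) < e"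
proof -
  have sol: "P \<in> solutions \<xi> \<mu>" using P by (simp add: extremal_points_iff)
  interpret P: prob_space P by (rule solution_prob_space[OF sol])
  define Y where "Y m \<eta> = average k f m (\<theta> (\<eta> (k - int m)))" for m \<eta>
  have Yb: "Y m \<eta> \<in> {1/4..3/4}" for m \<eta> unfolding Y_def by (rule average_bounds[OF k f])
  have Y0: "0 \<le> Y m \<eta>" and Y1: "Y m \<eta> \<le> 1" and Yabs: "\<bar>Y m \<eta>\<bar> \<le> 1" for m \<eta>
    using Yb[of m \<eta>] by auto
  have Ypast: "Y m \<in> borel_measurable (past_algebra coord l)" if "k - int m \<le> l" for m l
    unfolding Y_def[abs_def] by (rule average_path_measurable[OF k f(1) that])
  have Ypath: "Y m \<in> borel_measurable path_space" for m
    using k by (intro measurable_from_past[OF Ypast[OF order_refl]]) simp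
  have Ym [measurable]: "Y m \<in> borel_measurable P" for m
    unfolding measurable_from_solution[OF sol] by (rule Ypath)
  have int: "integrable P g" if "g \<in> borel_measurable P" "\<And>\<eta>. \<bar>g \<eta>\<bar> \<le> B" for g :: "(int \<Rightarrow> 's) \<Rightarrow> real" and B
    by (rule integrable_bounded[OF P.prob_space_axioms that])
  have int_YY: "integrable P (\<lambda>\<eta>. Y m \<eta> * Y n \<eta>)" for m n
    by (rule int[of _ 1]) (auto simp: abs_mult intro!: mult_le_one Yabs)
  have int_Y: "integrable P (Y m)" for m by (rule int[of _ 1]) (auto intro: Yabs)
  have tower: "(\<integral>\<eta>. h \<eta> * Y m \<eta> \<partial>P) = (\<integral>\<eta>. h \<eta> * Y m' \<eta> \<partial>P)"
    if "m \<le> m'" "h \<in> borel_measurable (past_algebra coord (k - int m'))" "\<And>\<eta>. \<bar>h \<eta>\<bar> \<le> 1" for h m m'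
    unfolding Y_def by (rule average_tower[OF sol k f that])
  have mean: "(\<integral>\<eta>. Y m \<eta> \<partial>P) = c" for m
  proof -
    have "(\<integral>\<eta>. Y m \<eta> \<partial>P) = (\<integral>\<eta>. Y 0 \<eta> \<partial>P)"
      using tower[of 0 m "\<lambda>_. 1"] by simp
    also have "\<dots> = c"
      unfolding c_def theta_at_def Y_def average.simps
      using k by (subst integral_distr)
        (auto simp: measurable_from_solution[OF sol] f(1) intro!: measurable_compose[OF coord_measurable \<theta>_measurable])
    finally show ?thesis .
  qed
  define V where "V m = (\<integral>\<eta>. Y m \<eta> * Y m \<eta> \<partial>P)" for m
  have diff: "(\<integral>\<eta>. (Y m \<eta> - Y m' \<eta>)\<^sup>2 \<partial>P) = V m - V m'" if "m \<le> m'" for m m'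
  proof -
    have "(\<integral>\<eta>. (Y m \<eta> - Y m' \<eta>)\<^sup>2 \<partial>P) = (\<integral>\<eta>. Y m \<eta> * Y m \<eta> - 2 * (Y m' \<eta> * Y m \<eta>) + Y m' \<eta> * Y m' \<eta> \<partial>P)"
      by (intro Bochner_Integration.integral_cong) (auto simp: power2_eq_square algebra_simps)
    also have "\<dots> = V m - 2 * (\<integral>\<eta>. Y m' \<eta> * Y m \<eta> \<partial>P) + V m'"
      unfolding V_def by (simp add: int_YY)
    also have "(\<integral>\<eta>. Y m' \<eta> * Y m \<eta> \<partial>P) = V m'"
      unfolding V_def using tower[OF that Ypast[OF order_refl] Yabs] .
    finally show ?thesis by simp
  qed
  have anti: "V m' \<le> V m" if "m \<le> m'" for m m'
    using diff[OF that] Bochner_Integration.integral_nonneg[of P "\<lambda>\<eta>. (Y m \<eta> - Y m' \<eta>)\<^sup>2"] by simp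
  have V0: "0 \<le> V m" for m unfolding V_def by (rule Bochner_Integration.integral_nonneg) simp
  obtain v where v: "V \<longlonglongrightarrow> v" "\<And>m. v \<le> V m"
    using decseq_convergent[of V 0] anti V0 by (auto simp: decseq_def)
  have "\<forall>i. \<exists>N. \<forall>m\<ge>N. V m - v \<le> (1/2)^i * (1/2)^i"
  proof
    fix i :: nat
    have "(\<lambda>m. V m - v) \<longlonglongrightarrow> 0" using v(1) by (simp add: LIM_zero)
    then have "\<forall>\<^sub>F m in sequentially. V m - v < (1/2)^i * (1/2)^i"
      by (rule order_tendstoD) simp
    then show "\<exists>N. \<forall>m\<ge>N. V m - v \<le> (1/2)^i * (1/2)^i"
      unfolding eventually_sequentially using less_imp_le by blast
  qed
  then obtain N where N: "\<And>i m. N i \<le> m \<Longrightarrow> V m - v \<le> (1/2)^i * (1/2)^i" by metis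
  \<comment> \<open>Increasing, and at least \<open>N i\<close> and \<open>i\<close>.\<close>
  define r where "r i = (\<Sum>j\<le>i. N j) + i" for i
  have rN: "N i \<le> r i" for i
    unfolding r_def using member_le_sum[of i "{..i}" N] by simp
  have r_mono: "r i \<le> r (Suc i)" for i by (simp add: r_def)
  have r_ge: "i \<le> r i" for i by (simp add: r_def)
  have L1: "(\<integral>\<eta>. \<bar>Y (r (Suc i)) \<eta> - Y (r i) \<eta>\<bar> \<partial>P) \<le> (1/2)^i" for i
  proof -
    define d :: real where "d = (1/2)^i"
    have d: "0 < d" by (simp add: d_def)
    \<comment> \<open>This bounds the L1 norm by the L2 norm.\<close>
    have am: "\<bar>x\<bar> \<le> (d + x\<^sup>2 / d) / 2" for x :: real
    proof -
      have "0 \<le> (d - \<bar>x\<bar>)\<^sup>2" by simp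
      then have "2 * d * \<bar>x\<bar> \<le> d * d + x\<^sup>2" by (simp add: power2_diff power2_eq_square algebra_simps)
      then show ?thesis using d by (simp add: field_simps power2_eq_square)
    qed
    have i1: "integrable P (\<lambda>\<eta>. \<bar>Y (r (Suc i)) \<eta> - Y (r i) \<eta>\<bar>)"
      by (intro integrable_abs Bochner_Integration.integrable_diff int_Y)
    have i2: "integrable P (\<lambda>\<eta>. (Y (r i) \<eta> - Y (r (Suc i)) \<eta>)\<^sup>2)"
    proof -
      have "(Y a \<eta> - Y b \<eta>)\<^sup>2 = Y a \<eta> * Y a \<eta> - 2 * (Y a \<eta> * Y b \<eta>) + Y b \<eta> * Y b \<eta>" for a b \<eta>
        by (simp add: power2_eq_square algebra_simps)
      then show ?thesis by (simp add: int_YY)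
    qed
    have "(\<integral>\<eta>. \<bar>Y (r (Suc i)) \<eta> - Y (r i) \<eta>\<bar> \<partial>P)
        \<le> (\<integral>\<eta>. (d + (Y (r i) \<eta> - Y (r (Suc i)) \<eta>)\<^sup>2 / d) / 2 \<partial>P)"
    proof (rule integral_mono[OF i1])
      show "integrable P (\<lambda>\<eta>. (d + (Y (r i) \<eta> - Y (r (Suc i)) \<eta>)\<^sup>2 / d) / 2)" using i2 by simp
      show "\<bar>Y (r (Suc i)) \<eta> - Y (r i) \<eta>\<bar> \<le> (d + (Y (r i) \<eta> - Y (r (Suc i)) \<eta>)\<^sup>2 / d) / 2" for \<eta>
        using am[of "Y (r i) \<eta> - Y (r (Suc i)) \<eta>"] by (simp add: abs_minus_commute)
    qed
    also have "\<dots> = (d + (V (r i) - V (r (Suc i))) / d) / 2"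
      using i2 by (simp add: P.prob_space diff[OF r_mono])
    also have "\<dots> \<le> (d + d * d / d) / 2"
      using N[OF rN[of i]] v(2)[of "r (Suc i)"] d
      by (intro divide_right_mono add_left_mono) (auto simp: d_def)
    also have "\<dots> = d" using d by simp
    finally show ?thesis by (simp add: d_def)
  qed
  have "AE \<eta> in P. convergent (\<lambda>i. Y (r i) \<eta>)"
    by (rule L1_summable_imp_AE_convergent[where Y="\<lambda>i. Y (r i)" and a="\<lambda>i. (1/2)^i"])
      (simp_all add: int_Y L1 summable_geometric)
  then have AElim: "AE \<eta> in P. (\<lambda>i. Y (r i) \<eta>) \<longlonglongrightarrow> lim (\<lambda>i. Y (r i) \<eta>)"
    by eventually_elim (simp add: convergent_LIMSEQ_iff)
  \<comment> \<open>Truncated so that the bounds hold also where the limit does not exist.\<close>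
  define y where "y \<eta> = max (1/4) (min (3/4) (lim (\<lambda>i. Y (r i) \<eta>)))" for \<eta>
  have y_lim: "AE \<eta> in P. (\<lambda>i. Y (r i) \<eta>) \<longlonglongrightarrow> y \<eta>"
    using AElim
  proof eventually_elim
    case (elim \<eta>)
    have "(1/4 :: real) \<le> lim (\<lambda>i. Y (r i) \<eta>)" by (rule LIMSEQ_le_const[OF elim]) (use Yb in auto)
    moreover have "lim (\<lambda>i. Y (r i) \<eta>) \<le> 3/4" by (rule LIMSEQ_le_const2[OF elim]) (use Yb in auto)
    ultimately show ?case using elim by (simp add: y_def)
  qed
  have yb: "y \<eta> \<in> {1/4..3/4}" for \<eta> by (simp add: y_def)
  have y_path: "y \<in> borel_measurable path_space"
    unfolding y_def[abs_def]
    by (intro borel_measurable_max borel_measurable_min borel_measurable_const borel_measurable_lim_metric Ypath)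
  have ym [measurable]: "y \<in> borel_measurable P" using y_path by (simp only: measurable_from_solution[OF sol])
  have lim_int: "(\<lambda>i. \<integral>\<eta>. h \<eta> * Y (r i) \<eta> \<partial>P) \<longlonglongrightarrow> (\<integral>\<eta>. h \<eta> * y \<eta> \<partial>P)"
    if [measurable]: "h \<in> borel_measurable P" and hb: "\<And>\<eta>. \<bar>h \<eta>\<bar> \<le> 1" for h
  proof (rule integral_dominated_convergence[where w="\<lambda>_. 1"])
    show "AE \<eta> in P. (\<lambda>i. h \<eta> * Y (r i) \<eta>) \<longlonglongrightarrow> h \<eta> * y \<eta>"
      using y_lim by eventually_elim (rule tendsto_mult_left)
    show "AE \<eta> in P. norm (h \<eta> * Y (r i) \<eta>) \<le> 1" for i
      using hb Yabs by (auto simp: abs_mult intro!: AE_I2 mult_le_one)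
  qed simp_all
  have indep: "(\<integral>\<eta>. indicator ({\<eta> \<in> space path_space. \<xi> l \<eta> \<in> A} \<inter> B) \<eta> * y \<eta> \<partial>P)
        = measure (\<mu> l) A * (\<integral>\<eta>. indicator B \<eta> * y \<eta> \<partial>P)"
    if l: "l \<le> 0" and A: "A \<in> sets borel" and B: "B \<in> past coord (l - 1)" for l A B
  proof -
    let ?E = "{\<eta> \<in> space path_space. \<xi> l \<eta> \<in> A} \<inter> B"
    have l': "l - 1 \<le> 0" using l by simp
    have Bp: "B \<in> sets path_space" using past_coord_subset[OF l'] B by blast
    then have BP: "B \<in> sets P" by (simp only: solution_sets[OF sol])
    have "{\<eta> \<in> space path_space. \<xi> l \<eta> \<in> A} \<in> sets P"
      unfolding solution_sets[OF sol]
      by (rule noise_event[OF l A])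
    then have EP: "?E \<in> sets P" using BP by (rule sets.Int)
    have ev: "\<forall>\<^sub>F i in sequentially. (\<integral>\<eta>. indicator ?E \<eta> * Y (r i) \<eta> \<partial>P)
        = measure (\<mu> l) A * (\<integral>\<eta>. indicator B \<eta> * Y (r i) \<eta> \<partial>P)"
      unfolding eventually_sequentially
    proof (intro exI allI impI)
      fix i assume i: "nat (k - l + 1) \<le> i"
      have "k - int (r i) \<le> l - 1" using r_ge[of i] i by linarith
      then have Yl: "Y (r i) \<in> borel_measurable (past_algebra coord (l - 1))" by (rule Ypast)
      interpret \<mu>: prob_space "\<mu> l" by (rule prob_space_\<mu>[OF l])
      define H :: "(int \<Rightarrow> 's) \<times> 's \<Rightarrow> real" where "H z = indicator B (fst z) * Y (r i) (fst z) * indicator A (snd z)" for z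
      have B': "B \<in> sets (past_algebra coord (l - 1))" using B by (simp add: sets_past_algebra)
      have Hm: "H \<in> borel_measurable (past_algebra coord (l - 1) \<Otimes>\<^sub>M borel)"
        unfolding H_def
        by (intro borel_measurable_times measurable_compose[OF measurable_fst Yl]
            measurable_compose[OF measurable_fst borel_measurable_indicator[OF B']]
            measurable_compose[OF measurable_snd borel_measurable_indicator[OF A]])
      have Hb: "\<bar>H z\<bar> \<le> 1" for z
        unfolding H_def using Yabs[of "r i" "fst z"] by (auto split: split_indicator)
      have "(\<integral>\<eta>. indicator ?E \<eta> * Y (r i) \<eta> \<partial>P) = (\<integral>\<eta>. H (\<eta>, \<xi> l \<eta>) \<partial>P)"
        by (intro Bochner_Integration.integral_cong)
          (auto simp: H_def solution_space[OF sol] split: split_indicator)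
      also have "\<dots> = (\<integral>\<eta>. (\<integral>s. H (\<eta>, s) \<partial>\<mu> l) \<partial>P)" by (rule noise_integral[OF sol l Hm Hb])
      also have "\<dots> = (\<integral>\<eta>. measure (\<mu> l) A * (indicator B \<eta> * Y (r i) \<eta>) \<partial>P)"
      proof (rule Bochner_Integration.integral_cong[OF refl])
        fix \<eta>
        have "A \<in> sets (\<mu> l)" using A by (simp only: sets_\<mu>[OF l])
        then show "(\<integral>s. H (\<eta>, s) \<partial>\<mu> l) = measure (\<mu> l) A * (indicator B \<eta> * Y (r i) \<eta>)"
          by (simp add: H_def space_\<mu>[OF l])
      qed
      finally show "(\<integral>\<eta>. indicator ?E \<eta> * Y (r i) \<eta> \<partial>P)
          = measure (\<mu> l) A * (\<integral>\<eta>. indicator B \<eta> * Y (r i) \<eta> \<partial>P)"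
        by simp
    qed
    have L: "(\<lambda>i. \<integral>\<eta>. indicator ?E \<eta> * Y (r i) \<eta> \<partial>P) \<longlonglongrightarrow> (\<integral>\<eta>. indicator ?E \<eta> * y \<eta> \<partial>P)"
      by (rule lim_int) (use EP in \<open>auto split: split_indicator\<close>)
    have R: "(\<lambda>i. measure (\<mu> l) A * (\<integral>\<eta>. indicator B \<eta> * Y (r i) \<eta> \<partial>P))
        \<longlonglongrightarrow> measure (\<mu> l) A * (\<integral>\<eta>. indicator B \<eta> * y \<eta> \<partial>P)"
      by (intro tendsto_mult_left lim_int) (use BP in \<open>auto split: split_indicator\<close>)
    show ?thesis
      using LIMSEQ_unique[OF L] tendsto_cong[THEN iffD2, OF ev R] by blast
  qed
  have "(\<lambda>i. \<integral>\<eta>. Y (r i) \<eta> \<partial>P) \<longlonglongrightarrow> (\<integral>\<eta>. y \<eta> \<partial>P)"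
    using lim_int[of "\<lambda>_. 1"] by simp
  then have y_mean: "(\<integral>\<eta>. y \<eta> \<partial>P) = c" unfolding mean by (simp add: LIMSEQ_const_iff)
  have "AE \<eta> in P. y \<eta> = c"
    using extremal_tail_constant[OF P y_path yb indep] unfolding y_mean .
  with y_lim have to_c: "AE \<eta> in P. (\<lambda>i. Y (r i) \<eta>) \<longlonglongrightarrow> c"
    by eventually_elim simp
  have "(\<lambda>i. \<integral>\<eta>. Y (r i) \<eta> * Y (r i) \<eta> \<partial>P) \<longlonglongrightarrow> (\<integral>\<eta>. c * c \<partial>P)"
  proof (rule integral_dominated_convergence[where w="\<lambda>_. 1"])
    show "AE \<eta> in P. (\<lambda>i. Y (r i) \<eta> * Y (r i) \<eta>) \<longlonglongrightarrow> c * c"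
      using to_c by eventually_elim (rule tendsto_mult)
    show "AE \<eta> in P. norm (Y (r i) \<eta> * Y (r i) \<eta>) \<le> 1" for i
      by (rule AE_I2) (simp only: real_norm_def abs_mult mult_le_one Yabs abs_ge_zero)
  qed simp_all
  then have "(\<lambda>i. V (r i)) \<longlonglongrightarrow> c * c" by (simp add: V_def P.prob_space)
  then have "(\<lambda>i. V (r i) - c * c) \<longlonglongrightarrow> 0" by (simp add: LIM_zero)
  then have "\<forall>\<^sub>F i in sequentially. V (r i) - c * c < e" using e by (rule order_tendstoD(2))
  then obtain i where i: "V (r i) - c * c < e" unfolding eventually_sequentially by blast
  have var: "(\<integral>\<eta>. (Y m \<eta> - c)\<^sup>2 \<partial>P) = V m - c * c" for m
  proof -
    have "(\<integral>\<eta>. (Y m \<eta> - c)\<^sup>2 \<partial>P) = (\<integral>\<eta>. Y m \<eta> * Y m \<eta> - 2 * c * Y m \<eta> + c * c \<partial>P)"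
      by (intro Bochner_Integration.integral_cong) (auto simp: power2_eq_square algebra_simps)
    also have "\<dots> = V m - 2 * c * c + c * c"
      unfolding V_def by (simp add: int_YY int_Y mean P.prob_space)
    finally show ?thesis by simp
  qed
  have "\<forall>m\<ge>r i. (\<integral>\<eta>. (Y m \<eta> - c)\<^sup>2 \<partial>P) < e"
    unfolding var using i anti by (meson diff_right_mono le_less_trans)
  then show ?thesis unfolding Y_def by blast
qed

text \<open>The mean of the squared deviations, summed over \<open>F\<close>, is small for early \<open>n\<close>; at some path the sum
does not exceed its mean, and \<open>g\<close> is the group component of this path at time \<open>n\<close>.\<close>

lemma extremal_pick:
  assumes P: "P \<in> extremal_points (solutions \<xi> \<mu>)" and fin: "finite F"
    and F: "\<And>k f. (k, f) \<in> F \<Longrightarrow> k \<le> 0 \<and> f \<in> borel_measurable borel \<and> (\<forall>g. f g \<in> {1/4..3/4})" and e: "0 < e"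
  shows "\<exists>N. \<forall>n\<le>N. (\<forall>(k, f)\<in>F. n \<le> k) \<and>
    (\<exists>g. \<forall>(k, f)\<in>F. \<bar>average k f (nat (k - n)) g - (\<integral>x. f x \<partial>theta_at P k)\<bar> < e)"
proof -
  have sol: "P \<in> solutions \<xi> \<mu>" using P by (simp add: extremal_points_iff)
  interpret P: prob_space P by (rule solution_prob_space[OF sol])
  define D where "D n p \<eta> = (average (fst p) (snd p) (nat (fst p - n)) (\<theta> (\<eta> n)) - (\<integral>x. snd p x \<partial>theta_at P (fst p)))\<^sup>2"
    for n p and \<eta> :: "int \<Rightarrow> 's"
  define d where "d = e\<^sup>2 / (real (card F) + 1)"
  have d: "0 < d" using e by (simp add: d_def)
  have "\<forall>p\<in>F. \<exists>N. N \<le> fst p \<and> (\<forall>n\<le>N. (\<integral>\<eta>. D n p \<eta> \<partial>P) < d)"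
  proof
    fix p assume p: "p \<in> F"
    obtain k f where kf: "p = (k, f)" by (cases p)
    have *: "k \<le> 0" "f \<in> borel_measurable borel" "\<And>g. f g \<in> {1/4..3/4}" using F p kf by auto
    obtain N where N: "\<And>m. m \<ge> N \<Longrightarrow>
        (\<integral>\<eta>. (average k f m (\<theta> (\<eta> (k - int m))) - (\<integral>g. f g \<partial>theta_at P k))\<^sup>2 \<partial>P) < d"
      using extremal_average_converges[OF P * d] by blast
    show "\<exists>N. N \<le> fst p \<and> (\<forall>n\<le>N. (\<integral>\<eta>. D n p \<eta> \<partial>P) < d)"
    proof (intro exI[of _ "k - int N"] conjI allI impI)
      show "k - int N \<le> fst p" by (simp add: kf)
      fix n assume n: "n \<le> k - int N"
      have "N \<le> nat (k - n)" "k - int (nat (k - n)) = n" using n by auto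
      with N[of "nat (k - n)"] show "(\<integral>\<eta>. D n p \<eta> \<partial>P) < d" by (simp add: D_def kf)
    qed
  qed
  then obtain N where N: "\<And>p. p \<in> F \<Longrightarrow> N p \<le> fst p" "\<And>p n. p \<in> F \<Longrightarrow> n \<le> N p \<Longrightarrow> (\<integral>\<eta>. D n p \<eta> \<partial>P) < d"
    by metis
  define N0 where "N0 = Min (insert 0 (N ` F))"
  have N0: "N0 \<le> N p" if "p \<in> F" for p unfolding N0_def using fin that by (intro Min_le) auto
  have N00: "N0 \<le> 0" unfolding N0_def using fin by (intro Min_le) auto
  show ?thesis
  proof (intro exI[of _ N0] allI impI conjI)
    fix n assume n: "n \<le> N0"
    show le: "\<forall>(k, f)\<in>F. n \<le> k"
      using n N0 N(1) by fastforce
    have n0: "n \<le> 0" using n N00 by simp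
    have Dm: "D n p \<in> borel_measurable P" "\<And>\<eta>. \<bar>D n p \<eta>\<bar> \<le> 4" if p: "p \<in> F" for p
    proof -
      obtain k f where kf: "p = (k, f)" by (cases p)
      have *: "k \<le> 0" "f \<in> borel_measurable borel" "\<And>g. f g \<in> {1/4..3/4}" using F p kf by auto
      have "(\<lambda>\<eta>. average k f (nat (k - n)) (\<theta> (\<eta> n))) \<in> borel_measurable path_space"
        by (rule measurable_compose[OF measurable_compose[OF coord_measurable[OF n0] \<theta>_measurable]
              average_measurable[OF *(1,2)]])
      then have "(\<lambda>\<eta>. average k f (nat (k - n)) (\<theta> (\<eta> n))) \<in> borel_measurable P"
        by (simp only: measurable_from_solution[OF sol])
      then show "D n p \<in> borel_measurable P" unfolding D_def[abs_def] kf by simp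
      fix \<eta>
      have a: "average k f (nat (k - n)) (\<theta> (\<eta> n)) \<in> {1/4..3/4}" by (rule average_bounds[OF *])
      have "f \<in> borel_measurable (theta_at P k)"
        using *(2) by (simp only: measurable_cong_sets[OF theta_at_props(1)[OF sol *(1)] refl])
      then have b: "(\<integral>g. f g \<partial>theta_at P k) \<in> {1/4..3/4}"
        by (rule integral_bounds[OF theta_at_props(2)[OF sol *(1)]]) (rule *(3))
      have "\<bar>average k f (nat (k - n)) (\<theta> (\<eta> n)) - (\<integral>g. f g \<partial>theta_at P k)\<bar> \<le> 2"
        using a b by auto
      then have "\<bar>average k f (nat (k - n)) (\<theta> (\<eta> n)) - (\<integral>g. f g \<partial>theta_at P k)\<bar>\<^sup>2 \<le> 2\<^sup>2"
        by (rule power_mono) simp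
      then show "\<bar>D n p \<eta>\<bar> \<le> 4" by (simp add: D_def kf)
    qed
    have intD: "integrable P (D n p)" if "p \<in> F" for p
      by (rule integrable_bounded[OF P.prob_space_axioms Dm[OF that]])
    have "(\<integral>\<eta>. (\<Sum>p\<in>F. D n p \<eta>) \<partial>P) = (\<Sum>p\<in>F. \<integral>\<eta>. D n p \<eta> \<partial>P)"
      by (rule Bochner_Integration.integral_sum[OF intD])
    also have "\<dots> \<le> (\<Sum>p\<in>F. d)"
      using N(2) N0 n by (intro sum_mono less_imp_le) (meson order_trans)
    also have "\<dots> < e\<^sup>2"
      using e by (simp add: d_def field_simps)
    finally have small: "(\<integral>\<eta>. (\<Sum>p\<in>F. D n p \<eta>) \<partial>P) < e\<^sup>2" .
    have "\<exists>\<eta>. (\<Sum>p\<in>F. D n p \<eta>) < e\<^sup>2"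
    proof (rule ccontr)
      assume "\<nexists>\<eta>. (\<Sum>p\<in>F. D n p \<eta>) < e\<^sup>2"
      then have "e\<^sup>2 \<le> (\<Sum>p\<in>F. D n p \<eta>)" for \<eta> by (meson not_le)
      then have "(\<integral>\<eta>. e\<^sup>2 \<partial>P) \<le> (\<integral>\<eta>. (\<Sum>p\<in>F. D n p \<eta>) \<partial>P)"
        using intD by (intro integral_mono Bochner_Integration.integrable_sum P.integrable_const)
      with small show False by (simp add: P.prob_space)
    qed
    then obtain \<eta> where \<eta>: "(\<Sum>p\<in>F. D n p \<eta>) < e\<^sup>2" by blast
    have "\<bar>average k f (nat (k - n)) (\<theta> (\<eta> n)) - (\<integral>x. f x \<partial>theta_at P k)\<bar> < e" if "(k, f) \<in> F" for k f
    proof -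
      have "D n (k, f) \<eta> \<le> (\<Sum>p\<in>F. D n p \<eta>)"
        using fin that by (intro member_le_sum) (auto simp: D_def)
      with \<eta> have "(average k f (nat (k - n)) (\<theta> (\<eta> n)) - (\<integral>x. f x \<partial>theta_at P k))\<^sup>2 < e\<^sup>2"
        by (simp add: D_def)
      then have "\<bar>average k f (nat (k - n)) (\<theta> (\<eta> n)) - (\<integral>x. f x \<partial>theta_at P k)\<bar>\<^sup>2 < e\<^sup>2" by simp
      then show ?thesis using e by (rule power2_less_imp_less[OF _ less_imp_le])
    qed
    then show "\<exists>g. \<forall>(k, f)\<in>F. \<bar>average k f (nat (k - n)) g - (\<integral>x. f x \<partial>theta_at P k)\<bar> < e"
      by (intro exI[of _ "\<theta> (\<eta> n)"]) auto
  qed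
qed

lemma continuous_translated_integral:
  fixes f :: "'g \<Rightarrow> real"
  assumes cpt: "compact (UNIV :: 'g set)" and f: "continuous_on UNIV f" "\<And>g. f g \<in> {a..b}"
    and M: "prob_space M" "sets M = sets borel"
  shows "continuous_on UNIV (\<lambda>z. \<integral>x. f (z + x) \<partial>M)"
  unfolding continuous_on_def
proof (intro ballI tendstoI)
  fix z :: 'g and e :: real assume e: "0 < e"
  have "0 < e / 2" using e by simp
  then obtain N where N: "open N" "z \<in> N" "\<And>w x. w \<in> N \<Longrightarrow> \<bar>f (w + x) - f (z + x)\<bar> < e / 2"
    using left_translation_equicontinuous[where z=z and f=f, OF cpt f(1), of "e / 2"] by metis
  have fm: "f \<in> borel_measurable borel" by (rule borel_measurable_continuous_onI[OF f(1)])
  have m: "(\<lambda>x. f (w + x)) \<in> borel_measurable M" for w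
    unfolding measurable_cong_sets[OF M(2) refl]
    by (rule measurable_compose[OF _ fm]) (intro measurable_add measurable_const, auto)
  have int: "integrable M (\<lambda>x. f (w + x))" for w
    by (rule integrable_bounded[OF M(1) m abs_le_of_interval[OF f(2)]])
  have "dist (\<integral>x. f (w + x) \<partial>M) (\<integral>x. f (z + x) \<partial>M) < e" if "w \<in> N" for w
  proof -
    have "(\<integral>x. f (w + x) - f (z + x) \<partial>M) \<in> {- (e/2)..e/2}"
    proof (rule integral_bounds[OF M(1)])
      show "f (w + x) - f (z + x) \<in> {- (e/2)..e/2}" for x
        using N(3)[OF that, of x] unfolding atLeastAtMost_iff by arith
    qed (intro borel_measurable_diff m)
    then have "\<bar>(\<integral>x. f (w + x) \<partial>M) - (\<integral>x. f (z + x) \<partial>M)\<bar> \<le> e / 2"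
      unfolding Bochner_Integration.integral_diff[OF int int] atLeastAtMost_iff by arith
    with e show ?thesis by (simp add: dist_real_def)
  qed
  with N(1,2) show "\<forall>\<^sub>F w in at z within UNIV. dist (\<integral>x. f (w + x) \<partial>M) (\<integral>x. f (z + x) \<partial>M) < e"
    unfolding eventually_at_topological by blast
qed

text \<open>If \<open>g\<close> reproduces the means of \<open>P\<close> and \<open>h\<close> those of \<open>Q\<close>, translation by \<open>h + - g\<close> carries the former to
the latter. For this \<open>g\<close> must be good for the translate of \<open>f\<close> by \<open>h + - g\<close>, which depends on \<open>g\<close>.
So \<open>g\<close> is chosen for a finite set \<open>Z\<close> of translates that is dense up to \<open>e\<close> in the supremum norm.\<close>

lemma approximate_translation:
  fixes F :: "(int \<times> ('g \<Rightarrow> real)) set"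
  assumes cpt: "compact (UNIV :: 'g set)"
    and P: "P \<in> extremal_points (solutions \<xi> \<mu>)" and Q: "Q \<in> extremal_points (solutions \<xi> \<mu>)"
    and fin: "finite F" and F: "\<And>k f. (k, f) \<in> F \<Longrightarrow> k \<le> 0 \<and> continuous_on UNIV f \<and> (\<forall>g. f g \<in> {1/4..3/4})"
    and e: "0 < e"
  shows "\<exists>z. \<forall>(k, f)\<in>F. \<bar>(\<integral>x. f (z + x) \<partial>theta_at P k) - (\<integral>x. f x \<partial>theta_at Q k)\<bar> \<le> 4 * e"
proof -
  have solP: "P \<in> solutions \<xi> \<mu>" and solQ: "Q \<in> solutions \<xi> \<mu>" using P Q by (simp_all add: extremal_points_iff)
  have Fm: "f \<in> borel_measurable borel" if "(k, f) \<in> F" for k f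
    using F[OF that] by (intro borel_measurable_continuous_onI) simp
  have "\<forall>p\<in>F. \<exists>Z. finite Z \<and> (\<forall>w. \<exists>z\<in>Z. \<forall>x. \<bar>snd p (w + x) - snd p (z + x)\<bar> < e)"
  proof
    fix p assume "p \<in> F"
    then have cont: "continuous_on UNIV (snd p)" using F[of "fst p" "snd p"] by simp
    obtain N where N: "\<And>z. open (N z)" "\<And>z. z \<in> N z" "\<And>z w x. w \<in> N z \<Longrightarrow> \<bar>snd p (w + x) - snd p (z + x)\<bar> < e"
      using left_translation_equicontinuous[OF cpt cont e] by metis
    obtain Z where Z: "finite Z" "UNIV \<subseteq> (\<Union>z\<in>Z. N z)"
      using compactE_image[OF cpt, of UNIV N] N(1,2) by (metis UNIV_I UN_I subsetI)
    have "\<forall>w. \<exists>z\<in>Z. \<forall>x. \<bar>snd p (w + x) - snd p (z + x)\<bar> < e"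
    proof
      fix w
      obtain z where "z \<in> Z" "w \<in> N z" using Z(2) by blast
      then show "\<exists>z\<in>Z. \<forall>x. \<bar>snd p (w + x) - snd p (z + x)\<bar> < e" using N(3) by blast
    qed
    with Z(1) show "\<exists>Z. finite Z \<and> (\<forall>w. \<exists>z\<in>Z. \<forall>x. \<bar>snd p (w + x) - snd p (z + x)\<bar> < e)" by blast
  qed
  then obtain Z where Z: "\<And>p. p \<in> F \<Longrightarrow> finite (Z p)"
    and near: "\<And>p w. p \<in> F \<Longrightarrow> \<exists>z\<in>Z p. \<forall>x. \<bar>snd p (w + x) - snd p (z + x)\<bar> < e"
    by metis
  define F' where "F' = (\<Union>p\<in>F. (\<lambda>z. (fst p, \<lambda>x. snd p (z + x))) ` Z p)"
  have fin': "finite F'" unfolding F'_def using fin Z by blast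
  have tm: "(\<lambda>x. f (z + x)) \<in> borel_measurable borel" if "f \<in> borel_measurable borel" for f :: "'g \<Rightarrow> real" and z
    by (rule measurable_compose[OF _ that]) (intro measurable_add measurable_const, auto)
  have F': "k \<le> 0 \<and> f \<in> borel_measurable borel \<and> (\<forall>g. f g \<in> {1/4..3/4})" if kf: "(k, f) \<in> F'" for k f
  proof -
    obtain f0 z where f0: "(k, f0) \<in> F" "f = (\<lambda>x. f0 (z + x))" using kf unfolding F'_def by auto
    show ?thesis unfolding f0(2) using F[OF f0(1)] tm[OF Fm[OF f0(1)]] by blast
  qed
  obtain N where N: "\<forall>n\<le>N. (\<forall>(k, f)\<in>F'. n \<le> k) \<and>
    (\<exists>g. \<forall>(k, f)\<in>F'. \<bar>average k f (nat (k - n)) g - (\<integral>x. f x \<partial>theta_at P k)\<bar> < e)"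
    using extremal_pick[OF P fin' F' e] by blast
  obtain N' where N': "\<forall>n\<le>N'. (\<forall>(k, f)\<in>F. n \<le> k) \<and>
    (\<exists>g. \<forall>(k, f)\<in>F. \<bar>average k f (nat (k - n)) g - (\<integral>x. f x \<partial>theta_at Q k)\<bar> < e)"
    using extremal_pick[OF Q fin _ e] F Fm by blast
  define n where "n = min N N'"
  obtain g where g: "\<And>k f. (k, f) \<in> F' \<Longrightarrow> \<bar>average k f (nat (k - n)) g - (\<integral>x. f x \<partial>theta_at P k)\<bar> < e"
  proof -
    have "n \<le> N" by (simp add: n_def)
    then obtain g where "\<forall>(k, f)\<in>F'. \<bar>average k f (nat (k - n)) g - (\<integral>x. f x \<partial>theta_at P k)\<bar> < e"
      using N by blast
    then show thesis by (intro that[of g]) auto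
  qed
  obtain h where h: "\<And>k f. (k, f) \<in> F \<Longrightarrow> \<bar>average k f (nat (k - n)) h - (\<integral>x. f x \<partial>theta_at Q k)\<bar> < e"
  proof -
    have "n \<le> N'" by (simp add: n_def)
    then obtain g where "\<forall>(k, f)\<in>F. \<bar>average k f (nat (k - n)) g - (\<integral>x. f x \<partial>theta_at Q k)\<bar> < e"
      using N' by blast
    then show thesis by (intro that[of g]) auto
  qed
  define w where "w = h + - g"
  have "\<bar>(\<integral>x. f (w + x) \<partial>theta_at P k) - (\<integral>x. f x \<partial>theta_at Q k)\<bar> \<le> 4 * e" if kf: "(k, f) \<in> F" for k f
  proof -
    define m where "m = nat (k - n)"
    have k: "k \<le> 0" and fb: "\<And>g. f g \<in> {1/4..3/4}" using F[OF kf] by auto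
    note fm = Fm[OF kf]
    obtain z where z: "z \<in> Z (k, f)" "\<And>x. \<bar>f (w + x) - f (z + x)\<bar> < e"
      using near[OF kf, of w] by auto
    have "(k, \<lambda>x. f (z + x)) \<in> F'"
      unfolding F'_def using kf z(1) by force
    from g[OF this] have 1: "\<bar>average k (\<lambda>x. f (z + x)) m g - (\<integral>x. f (z + x) \<partial>theta_at P k)\<bar> < e"
      by (simp add: m_def)
    have le: "\<bar>f (w + x) - f (z + x)\<bar> \<le> e" for x using z(2)[of x] by simp
    have 2: "\<bar>average k (\<lambda>x. f (w + x)) m g - average k (\<lambda>x. f (z + x)) m g\<bar> \<le> e"
      by (rule average_diff[OF k tm[OF fm] _ tm[OF fm] _ le]) (rule fb)+
    have "average k (\<lambda>x. f (w + x)) m g = average k f m h"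
      unfolding average_translate by (simp add: w_def add.assoc)
    with h[OF kf] have 3: "\<bar>average k (\<lambda>x. f (w + x)) m g - (\<integral>x. f x \<partial>theta_at Q k)\<bar> < e"
      by (simp add: m_def)
    note pr = theta_at_props(2)[OF solP k] and cs = measurable_cong_sets[OF theta_at_props(1)[OF solP k] refl]
    have tm': "(\<lambda>x. f (u + x)) \<in> borel_measurable (theta_at P k)" for u
      using tm[OF fm] by (simp only: cs)
    have int: "integrable (theta_at P k) (\<lambda>x. f (u + x))" for u
      by (rule integrable_bounded[OF pr tm' abs_le_of_interval[OF fb]])
    have "(\<integral>x. f (w + x) - f (z + x) \<partial>theta_at P k) \<in> {- e..e}"
    proof (rule integral_bounds[OF pr])
      show "f (w + x) - f (z + x) \<in> {- e..e}" for x using le[of x] by (auto simp: abs_le_iff)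
    qed (intro borel_measurable_diff tm')
    then have 4: "\<bar>(\<integral>x. f (w + x) \<partial>theta_at P k) - (\<integral>x. f (z + x) \<partial>theta_at P k)\<bar> \<le> e"
      by (simp add: int abs_le_iff)
    from 1 2 3 4 show ?thesis by linarith
  qed
  then show ?thesis by blast
qed

end

text \<open>For each time and each continuous function, the translations that carry the mean under \<open>P\<close> to that under
\<open>Q\<close> up to a given error form a closed set. By \<open>approximate_translation\<close> these sets have the finite
intersection property. The hypothesis \<open>sep\<close> holds if \<open>G\<close> has a countable base.\<close>

theorem (in tsirelson_yor) extremal_transitive:
  assumes cpt: "compact (UNIV :: 'g set)"
    and sep: "\<And>M N :: 'g measure. prob_space M \<Longrightarrow> sets M = sets borel \<Longrightarrow> prob_space N \<Longrightarrow> sets N = sets borel \<Longrightarrow>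
      (\<And>f :: 'g \<Rightarrow> real. continuous_on UNIV f \<Longrightarrow> (\<And>x. f x \<in> {0..1}) \<Longrightarrow> (\<integral>x. f x \<partial>M) = (\<integral>x. f x \<partial>N)) \<Longrightarrow> M = N"
    and P: "P \<in> extremal_points (solutions \<xi> \<mu>)" and Q: "Q \<in> extremal_points (solutions \<xi> \<mu>)"
  shows "\<exists>z. translate \<theta> \<psi> \<psi>inv z P = Q"
proof -
  have solP: "P \<in> solutions \<xi> \<mu>" and solQ: "Q \<in> solutions \<xi> \<mu>" using P Q by (simp_all add: extremal_points_iff)
  define I where "I = {(k, f, e). k \<le> (0::int) \<and> continuous_on UNIV f \<and> (\<forall>g. (f :: 'g \<Rightarrow> real) g \<in> {1/4..3/4}) \<and> 0 < (e::real)}"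
  define A :: "int \<times> ('g \<Rightarrow> real) \<times> real \<Rightarrow> 'g set" where "A i = (case i of (k, f, e) \<Rightarrow>
    {z. \<bar>(\<integral>x. f (z + x) \<partial>theta_at P k) - (\<integral>x. f x \<partial>theta_at Q k)\<bar> \<le> e})" for i
  have "UNIV \<inter> (\<Inter>i\<in>I. A i) \<noteq> {}"
  proof (rule compact_imp_fip_image[OF cpt])
    fix i assume "i \<in> I"
    then obtain k f e where i: "i = (k, f, e)" "k \<le> 0" "continuous_on UNIV f" "\<And>g. f g \<in> {1/4..3/4}"
      unfolding I_def by blast
    have "continuous_on UNIV (\<lambda>z. \<bar>(\<integral>x. f (z + x) \<partial>theta_at P k) - (\<integral>x. f x \<partial>theta_at Q k)\<bar>)"
      by (intro continuous_intros continuous_translated_integral[OF cpt i(3,4)] theta_at_props solP i(2))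
    then show "closed (A i)"
      unfolding A_def i(1) by (auto intro!: closed_Collect_le)
  next
    fix J assume J: "finite J" "J \<subseteq> I"
    define d where "d = Min (insert 1 ((snd \<circ> snd) ` J))"
    have pos: "0 < snd (snd j)" if "j \<in> J" for j using J(2) that unfolding I_def by auto
    have d: "0 < d" unfolding d_def using J(1) pos by (subst Min_gr_iff) auto
    have dle: "d \<le> snd (snd j)" if "j \<in> J" for j
      unfolding d_def using J(1) that by (intro Min_le) auto
    define F where "F = (\<lambda>j. (fst j, fst (snd j))) ` J"
    have F: "k \<le> 0 \<and> continuous_on UNIV f \<and> (\<forall>g. f g \<in> {1/4..3/4})" if "(k, f) \<in> F" for k f
      using that J(2) unfolding F_def I_def by auto
    have "finite F" using J(1) by (simp add: F_def)
    from approximate_translation[OF cpt P Q this F, of "d / 4"] d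
    obtain z where z: "\<forall>(k, f)\<in>F. \<bar>(\<integral>x. f (z + x) \<partial>theta_at P k) - (\<integral>x. f x \<partial>theta_at Q k)\<bar> \<le> d"
      by auto
    have "z \<in> A j" if "j \<in> J" for j
    proof -
      obtain k f e where j: "j = (k, f, e)" by (cases j)
      have "(k, f) \<in> F" unfolding F_def using that j by force
      with z dle[OF that] show ?thesis by (fastforce simp: A_def j)
    qed
    then have "z \<in> UNIV \<inter> (\<Inter>i\<in>J. A i)" by blast
    then show "UNIV \<inter> (\<Inter>i\<in>J. A i) \<noteq> {}" by blast
  qed
  then obtain z where z_all: "z \<in> (\<Inter>i\<in>I. A i)" unfolding Int_UNIV_left ex_in_conv[symmetric] ..
  have z: "z \<in> A i" if "i \<in> I" for i using z_all that by (rule INT_D)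
  have m: "(+) z \<in> borel \<rightarrow>\<^sub>M borel" by (intro measurable_add measurable_const) auto
  have "theta_at (translate \<theta> \<psi> \<psi>inv z P) n = theta_at Q n" if n: "n \<le> 0" for n
  proof (rule sep)
    note tr = translate_solution[OF solP, of z]
    show "prob_space (theta_at (translate \<theta> \<psi> \<psi>inv z P) n)" "prob_space (theta_at Q n)"
      "sets (theta_at (translate \<theta> \<psi> \<psi>inv z P) n) = sets borel" "sets (theta_at Q n) = sets borel"
      by (rule theta_at_props[OF tr n] theta_at_props[OF solQ n])+
    fix f :: "'g \<Rightarrow> real" assume f: "continuous_on UNIV f" "\<And>x. f x \<in> {0..1}"
    have fm: "f \<in> borel_measurable borel" by (rule borel_measurable_continuous_onI[OF f(1)])
    \<comment> \<open>Rescaled so that its values stay away from 0 and 1.\<close>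
    define f' where "f' x = 1/4 + f x / 2" for x
    have f'_bounds: "f' x \<in> {1/4..3/4}" for x
      using f(2)[of x] by (simp add: f'_def)
    have f'_cont: "continuous_on UNIV f'"
      unfolding f'_def by (intro continuous_on_add continuous_on_divide continuous_on_const f(1)) simp
    have le: "\<bar>(\<integral>x. f' (z + x) \<partial>theta_at P n) - (\<integral>x. f' x \<partial>theta_at Q n)\<bar> \<le> e" if "0 < e" for e
    proof -
      have "(n, f', e) \<in> I" unfolding I_def using f'_cont f'_bounds n that by blast
      from z[OF this] show ?thesis unfolding A_def by simp
    qed
    have "\<bar>(\<integral>x. f' (z + x) \<partial>theta_at P n) - (\<integral>x. f' x \<partial>theta_at Q n)\<bar> \<le> 0"
      by (rule field_le_epsilon) (simp only: add_0_left le)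
    then have eq: "(\<integral>x. f' (z + x) \<partial>theta_at P n) = (\<integral>x. f' x \<partial>theta_at Q n)" by simp
    have int: "integrable (theta_at R n) (\<lambda>x. f (u + x))" if "R \<in> solutions \<xi> \<mu>" for R u
    proof (rule integrable_bounded[OF theta_at_props(2)[OF that n] _ abs_le_of_interval[OF f(2)]])
      show "(\<lambda>x. f (u + x)) \<in> borel_measurable (theta_at R n)"
        unfolding measurable_cong_sets[OF theta_at_props(1)[OF that n] refl]
        by (rule measurable_compose[OF _ fm]) (intro measurable_add measurable_const, auto)
    qed
    have lin: "(\<integral>x. f' (u + x) \<partial>theta_at R n) = 1/4 + (\<integral>x. f (u + x) \<partial>theta_at R n) / 2"
      if R: "R \<in> solutions \<xi> \<mu>" for R u
    proof -
      interpret R: prob_space "theta_at R n" by (rule theta_at_props(2)[OF R n])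
      show ?thesis unfolding f'_def using int[OF R, of u] by (simp add: R.prob_space)
    qed
    have "(\<integral>x. f x \<partial>theta_at (translate \<theta> \<psi> \<psi>inv z P) n) = (\<integral>x. f (z + x) \<partial>theta_at P n)"
      unfolding theta_at_translate[OF solP n]
      by (rule integral_distr) (use m fm in \<open>simp_all add: measurable_cong_sets[OF theta_at_props(1)[OF solP n] refl]\<close>)
    also have "\<dots> = (\<integral>x. f x \<partial>theta_at Q n)"
      using eq lin[OF solP, of z] lin[OF solQ, of 0] by simp
    finally show "(\<integral>x. f x \<partial>theta_at (translate \<theta> \<psi> \<psi>inv z P) n) = (\<integral>x. f x \<partial>theta_at Q n)" .
  qed
  then have "translate \<theta> \<psi> \<psi>inv z P = Q"
    by (rule solution_unique[OF translate_solution[OF solP] solQ])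
  then show ?thesis by blast
qed

section \<open>Strong solutions\<close>

text \<open>The sets that agree with a member of \<open>N\<close> up to a null set form a \<open>\<sigma>\<close>-algebra.\<close>

lemma sigma_sets_approximated_modulo_null:
  assumes \<A>: "\<And>A. A \<in> \<A> \<Longrightarrow> A \<in> sets P \<and> (\<exists>B\<in>sets N. sym_diff A B \<in> null_sets P)"
    and N: "sets N \<subseteq> sets P" "space N = space P" and A: "A \<in> sigma_sets (space P) \<A>"
  shows "A \<in> sets P \<and> (\<exists>B\<in>sets N. sym_diff A B \<in> null_sets P)"
  using A
proof induction
  case (Basic a)
  then show ?case by (rule \<A>)
next
  case Empty
  show ?case by (intro conjI bexI[of _ "{}"]) auto
next
  case (Compl a)
  then obtain B where a: "a \<in> sets P" and B: "B \<in> sets N" "sym_diff a B \<in> null_sets P" by blast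
  have "sym_diff (space P - a) (space P - B) = sym_diff a B"
    using sets.sets_into_space[OF a] sets.sets_into_space[of B P] B(1) N(1) by blast
  moreover have "space P - B \<in> sets N" using B(1) N(2) sets.compl_sets by metis
  ultimately show ?case using a B(2) by (metis sets.compl_sets)
next
  case (Union a)
  then have a: "\<And>i. a i \<in> sets P" and "\<forall>i. \<exists>B\<in>sets N. sym_diff (a i) B \<in> null_sets P" by blast+
  then obtain B where B: "\<And>i::nat. B i \<in> sets N" "\<And>i. sym_diff (a i) (B i) \<in> null_sets P" by metis
  have UN: "(\<Union>i. a i) \<in> sets P" "(\<Union>i. B i) \<in> sets N" "(\<Union>i. B i) \<in> sets P"
    using a B(1) N(1) by auto
  have "sym_diff (\<Union>i. a i) (\<Union>i. B i) \<in> null_sets P"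
  proof (rule null_sets_subset)
    show "(\<Union>i. sym_diff (a i) (B i)) \<in> null_sets P" using B(2) by (rule null_sets_UN)
    show "sym_diff (\<Union>i. a i) (\<Union>i. B i) \<in> sets P" using UN by blast
    show "sym_diff (\<Union>i. a i) (\<Union>i. B i) \<subseteq> (\<Union>i. sym_diff (a i) (B i))" by blast
  qed
  with UN show ?case by blast
qed

text \<open>The sets that can be approximated form a \<open>\<sigma>\<close>-algebra: a countable union is approximated by finitely
many of its terms, and these by sets of one \<open>N n\<close>.\<close>

lemma (in prob_space) sigma_sets_approximated_in_measure:
  assumes N: "\<And>n. sets (N n) \<subseteq> events" "\<And>n. space (N n) = space M" "\<And>n. sets (N n) \<subseteq> sets (N (Suc n))"
    and B: "B \<in> sigma_sets (space M) (\<Union>n::nat. sets (N n))" and e: "0 < e"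
  shows "B \<in> events \<and> (\<exists>n. \<exists>E\<in>sets (N n). prob (sym_diff B E) < e)"
  using B e
proof (induction arbitrary: e)
  case (Basic a)
  then obtain n where n: "a \<in> sets (N n)" by blast
  have "prob (sym_diff a a) < e" using Basic by simp
  with n N(1)[of n] show ?case by blast
next
  case Empty
  then have "prob (sym_diff {} {}) < e" by simp
  moreover have "{} \<in> sets (N 0)" by simp
  ultimately show ?case by blast
next
  case (Compl a)
  from Compl.IH[OF Compl.prems] obtain n E where a: "a \<in> events" and E: "E \<in> sets (N n)" "prob (sym_diff a E) < e" by blast
  have "sym_diff (space M - a) (space M - E) = sym_diff a E"
    using sets.sets_into_space[OF a] sets.sets_into_space[of E M] E(1) N(1) by blast
  moreover have "space M - E \<in> sets (N n)" using E(1) N(2)[of n] sets.compl_sets by metis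
  ultimately show ?case using a E(2) by (metis sets.compl_sets)
next
  case (Union a)
  have a: "a i \<in> events" for i using Union.IH zero_less_one[where 'a=real] by blast
  have UN: "(\<Union>i. a i) \<in> events" using a by blast
  have "incseq (\<lambda>m. \<Union>i<m. a i)"
    by (rule incseq_SucI) (auto simp: lessThan_Suc)
  then have "(\<lambda>m. prob (\<Union>i<m. a i)) \<longlonglongrightarrow> prob (\<Union>m. \<Union>i<m. a i)"
    using a by (intro finite_Lim_measure_incseq) auto
  moreover have "(\<Union>m. \<Union>i<m. a i) = (\<Union>i. a i)" by blast
  ultimately have "(\<lambda>m. prob (\<Union>i<m. a i)) \<longlonglongrightarrow> prob (\<Union>i. a i)" by simp
  then have "\<forall>\<^sub>F m in sequentially. prob (\<Union>i. a i) - e / 2 < prob (\<Union>i<m. a i)"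
    using Union.prems by (intro order_tendstoD(1)[where y="prob (\<Union>i. a i)"]) auto
  then obtain m where m: "prob (\<Union>i. a i) - e / 2 < prob (\<Union>i<m. a i)"
    unfolding eventually_sequentially by blast
  define d where "d = e / (2 * (real m + 1))"
  have d: "0 < d" using Union.prems by (simp add: d_def)
  have "\<forall>i. \<exists>n. \<exists>E\<in>sets (N n). prob (sym_diff (a i) E) < d"
    using Union.IH[OF d] by blast
  then obtain n E where E: "\<And>i. E i \<in> sets (N (n i))" "\<And>i. prob (sym_diff (a i) (E i)) < d" by metis
  define l where "l = (\<Sum>i<m. n i)"
  have N_mono: "sets (N i) \<subseteq> sets (N j)" if "i \<le> j" for i j
    using lift_Suc_mono_le[of "\<lambda>i. sets (N i)", OF N(3) that] .
  have El: "E i \<in> sets (N l)" if "i < m" for i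
  proof -
    have "n i \<le> l" unfolding l_def using that member_le_sum[of i "{..<m}" n] by simp
    then show ?thesis using N_mono[of "n i" l] E(1)[of i] by blast
  qed
  have Eev: "E i \<in> events" for i using E(1) N(1) by blast
  have UE: "(\<Union>i<m. E i) \<in> sets (N l)" using El by blast
  have Ue: "(\<Union>i<m. E i) \<in> events" using UE N(1) by blast
  have Ua: "(\<Union>i<m. a i) \<in> events" using a by blast
  have "prob (sym_diff (\<Union>i. a i) (\<Union>i<m. E i))
      \<le> prob (((\<Union>i. a i) - (\<Union>i<m. a i)) \<union> (\<Union>i<m. sym_diff (a i) (E i)))"
    using a Eev UN Ua by (intro finite_measure_mono) auto
  also have "\<dots> \<le> prob ((\<Union>i. a i) - (\<Union>i<m. a i)) + prob (\<Union>i<m. sym_diff (a i) (E i))"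
    using a Eev UN Ua by (intro measure_Un_le) auto
  also have "prob (\<Union>i<m. sym_diff (a i) (E i)) \<le> (\<Sum>i<m. prob (sym_diff (a i) (E i)))"
    using a Eev by (intro finite_measure_subadditive_finite) auto
  also have "\<dots> \<le> (\<Sum>i<m. d)" by (intro sum_mono less_imp_le E(2))
  also have "\<dots> \<le> e / 2" using Union.prems by (simp add: d_def field_simps)
  also have "prob ((\<Union>i. a i) - (\<Union>i<m. a i)) = prob (\<Union>i. a i) - prob (\<Union>i<m. a i)"
    using UN Ua by (intro finite_measure_Diff) auto
  finally have "prob (sym_diff (\<Union>i. a i) (\<Union>i<m. E i)) < e" using m by simp
  with UN UE show ?case by blast
qed

text \<open>The limes superior of approximations with summable errors agrees with \<open>A\<close> up to a null set, by the
Borel--Cantelli lemma.\<close>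

lemma (in prob_space) approximated_imp_modulo_null:
  assumes N: "sets N \<subseteq> events" and A: "A \<in> events"
    and approx: "\<And>e. 0 < e \<Longrightarrow> \<exists>B\<in>sets N. prob (sym_diff A B) \<le> e"
  shows "\<exists>B\<in>sets N. sym_diff A B \<in> null_sets M"
proof -
  have "\<forall>i::nat. \<exists>B\<in>sets N. prob (sym_diff A B) \<le> (1/2)^i" using approx by simp
  then obtain B where B: "\<And>i. B i \<in> sets N" "\<And>i::nat. prob (sym_diff A (B i)) \<le> (1/2)^i" by metis
  have Be [measurable]: "B i \<in> events" for i using B(1) N by blast
  note A[measurable]
  define L where "L = (\<Inter>n. \<Union>i. B (n + i))"
  have L: "L \<in> sets N" unfolding L_def using B(1) by blast
  have "AE x in M. \<forall>\<^sub>F i in sequentially. x \<in> space M - sym_diff A (B i)"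
  proof (rule borel_cantelli_AE1)
    show "sym_diff A (B i) \<in> events" for i by measurable
    show "emeasure M (sym_diff A (B i)) < \<infinity>" for i by (simp add: emeasure_eq_measure)
    show "summable (\<lambda>i. prob (sym_diff A (B i)))"
      by (rule summable_comparison_test'[of "\<lambda>i. (1/2)^i" 0]) (use B(2) in \<open>auto simp: summable_geometric\<close>)
  qed
  then have "AE x in M. x \<notin> sym_diff A L"
  proof eventually_elim
    case (elim x)
    then obtain n where n: "\<And>i. i \<ge> n \<Longrightarrow> x \<notin> sym_diff A (B i)" unfolding eventually_sequentially by blast
    show ?case
    proof (cases "x \<in> A")
      case True
      have "x \<in> (\<Union>i. B (m + i))" for m
        using n[of "m + n"] True by auto
      with True show ?thesis by (simp add: L_def)
    next
      case False
      have "x \<notin> B (n + i)" for i using n[of "n + i"] False by simp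
      then have "x \<notin> L" unfolding L_def by blast
      with False show ?thesis by simp
    qed
  qed
  moreover have "sym_diff A L \<in> events" using A L N by blast
  ultimately have "sym_diff A L \<in> null_sets M" by (simp add: AE_iff_null_sets)
  with L show ?thesis by blast
qed

text \<open>It suffices to recover single coordinates, because they generate the past.\<close>

lemma strong_iff:
  assumes P: "prob_space P" "sets P = sets path_space"
    and X: "\<And>j. j \<le> 0 \<Longrightarrow> X j \<in> path_space \<rightarrow>\<^sub>M borel"
  shows "strong X P \<longleftrightarrow> (\<forall>k\<le>0. \<forall>C\<in>sets borel. \<exists>B\<in>past X k.
    sym_diff {\<eta> \<in> space path_space. \<eta> k \<in> C} B \<in> null_sets P)" (is "_ \<longleftrightarrow> ?R")
proof
  have coord_past: "{\<eta> \<in> space path_space. \<eta> k \<in> C} \<in> past coord k" if "C \<in> sets borel" for k and C :: "'a set"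
  proof -
    have "{\<eta> \<in> space path_space. \<eta> k \<in> C} = coord k -` C \<inter> space path_space"
      by (auto simp: coord_def)
    then show ?thesis unfolding past_def using that by (intro sigma_sets.Basic) blast
  qed
  then show "strong X P \<Longrightarrow> ?R" unfolding strong_def by blast
  assume R: ?R
  have sp: "space P = space path_space" using P(2) by (rule sets_eq_imp_space_eq)
  show "strong X P"
    unfolding strong_def
  proof (intro allI impI ballI)
    fix k :: int and A :: "(int \<Rightarrow> 'a) set" assume k: "k \<le> 0" and A: "A \<in> past coord k"
    have "A \<in> sets P \<and> (\<exists>B\<in>sets (past_algebra X k). sym_diff A B \<in> null_sets P)"
    proof (rule sigma_sets_approximated_modulo_null)
      show "A \<in> sigma_sets (space P) {coord j -` C \<inter> space path_space |j C. j \<le> k \<and> C \<in> sets borel}"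
        using A by (simp add: past_def sp)
      show "sets (past_algebra X k) \<subseteq> sets P"
        unfolding sets_past_algebra P(2) using X k by (intro past_subset_path_space) simp
      show "space (past_algebra X k) = space P" by (simp add: sp)
      fix A assume "A \<in> {coord j -` C \<inter> space (path_space :: (int \<Rightarrow> 'a) measure) |j C. j \<le> k \<and> C \<in> sets borel}"
      then obtain j C where A: "A = coord j -` C \<inter> space path_space" and jC: "j \<le> k" "C \<in> sets borel" by blast
      have A: "A = {\<eta> \<in> space path_space. \<eta> j \<in> C}" unfolding A by (auto simp: coord_def)
      have j: "j \<le> 0" using jC k by simp
      have "A \<in> past coord j" unfolding A by (rule coord_past[OF jC(2)])
      then have "A \<in> sets P" unfolding P(2) using past_coord_subset[OF j] by blast
      moreover obtain B where "B \<in> past X j" "sym_diff A B \<in> null_sets P"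
        using R j jC(2) unfolding A by blast
      moreover have "past X j \<subseteq> past X k" using jC(1) by (rule past_mono)
      ultimately show "A \<in> sets P \<and> (\<exists>B\<in>sets (past_algebra X k). sym_diff A B \<in> null_sets P)"
        unfolding sets_past_algebra by blast
    qed
    then show "\<exists>B\<in>past X k. (A - B) \<union> (B - A) \<in> null_sets P" by (simp add: sets_past_algebra)
  qed
qed

text \<open>In the simple equation the product of the noise between the times \<open>n\<close> and \<open>n + m\<close>, in the order of time.\<close>

primrec noise_sum :: "int \<Rightarrow> (int \<Rightarrow> 'g::monoid_add) \<Rightarrow> nat \<Rightarrow> 'g" where
  "noise_sum n x 0 = 0"
| "noise_sum n x (Suc m) = noise_sum n x m + x (n + int (Suc m))"

lemma noise_sum_cong: "(\<And>i. n < i \<Longrightarrow> i \<le> n + int m \<Longrightarrow> x i = y i) \<Longrightarrow> noise_sum n x m = noise_sum n y m"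
  by (induction m) simp_all

context tsirelson_yor
begin

lemma noise_sum_measurable:
  fixes X :: "int \<Rightarrow> 'w \<Rightarrow> 'g"
  assumes "\<And>i. n < i \<Longrightarrow> i \<le> n + int m \<Longrightarrow> X i \<in> M \<rightarrow>\<^sub>M borel"
  shows "(\<lambda>w. noise_sum n (\<lambda>i. X i w) m) \<in> M \<rightarrow>\<^sub>M borel"
  using assms
proof (induction m)
  case (Suc m)
  then have "(\<lambda>w. noise_sum n (\<lambda>i. X i w) m) \<in> M \<rightarrow>\<^sub>M borel" by simp
  moreover have "X (n + int (Suc m)) \<in> M \<rightarrow>\<^sub>M borel" using Suc.prems[of "n + int (Suc m)"] by simp
  ultimately show ?case unfolding noise_sum.simps by (rule measurable_add)
qed simp

lemma theta_eq_noise_sum: "\<theta> (\<eta> (n + int m)) = \<theta> (\<eta> n) + noise_sum n (\<lambda>i. \<theta> (\<xi> i \<eta>)) m"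
proof (induction m)
  case (Suc m)
  have "\<theta> (\<eta> (n + int (Suc m))) = \<theta> (\<eta> (n + int (Suc m) - 1)) + \<theta> (\<xi> (n + int (Suc m)) \<eta>)"
    by (rule \<theta>_step)
  also have "n + int (Suc m) - 1 = n + int m" by simp
  finally show ?case unfolding Suc by (simp add: add.assoc)
qed simp

definition noises :: "int \<Rightarrow> (int \<Rightarrow> 's) \<Rightarrow> int \<Rightarrow> 's" where
  "noises n \<eta> = (\<lambda>i\<in>{n<..0}. \<xi> i \<eta>)"

lemma noises_measurable: "noises n \<in> path_space \<rightarrow>\<^sub>M PiM {n<..0} (\<lambda>_. borel)"
  unfolding noises_def[abs_def] by (rule measurable_restrict) (simp add: \<xi>_measurable)

text \<open>The product law of the code (\<open>distr_encode\<close>), with the first coordinate split off.\<close>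

lemma distr_start_noises:
  assumes P: "P \<in> solutions \<xi> \<mu>" and n: "n \<le> 0"
  shows "distr P (borel \<Otimes>\<^sub>M PiM {n<..0} (\<lambda>_. borel)) (\<lambda>\<eta>. (\<eta> n, noises n \<eta>))
    = distr P borel (\<lambda>\<eta>. \<eta> n) \<Otimes>\<^sub>M PiM {n<..0} \<mu>"
proof -
  interpret P: prob_space P by (rule solution_prob_space[OF P])
  let ?\<nu> = "distr P borel (\<lambda>\<eta>. \<eta> n)" and ?J = "{n<..0}"
  let ?W = "window_laws n ?\<nu>" and ?B = "PiM {n<..0} (\<lambda>_. borel) :: (int \<Rightarrow> 's) measure"
  have mn: "(\<lambda>\<eta>. \<eta> n) \<in> P \<rightarrow>\<^sub>M borel"
    unfolding measurable_from_solution[OF P] using n by (rule coord_measurable)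
  have me: "encode n \<in> P \<rightarrow>\<^sub>M PiM {n..0} (\<lambda>_. borel)"
    unfolding measurable_from_solution[OF P] using n by (rule encode_measurable)
  interpret \<nu>: prob_space ?\<nu> using mn by (rule P.prob_space_distr)
  have prW: "prob_space (?W j)" for j by (rule prob_space_window_laws) unfold_locales
  have sW: "sets (?W j) = sets borel" for j by (rule sets_window_laws) simp
  have ivl: "{n..0} = insert n ?J" using n by auto
  have Wn: "?W n = ?\<nu>" by (simp add: window_laws_def)
  have WJ: "PiM ?J ?W = PiM ?J \<mu>" by (rule PiM_cong) (auto simp: window_laws_def)
  have sWJ: "sets (PiM ?J \<mu>) = sets ?B" unfolding WJ[symmetric] by (intro sets_PiM_cong refl sW)
  define split where "split x = (x n, restrict x ?J)" for x :: "int \<Rightarrow> 's"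
  have ms: "split \<in> PiM {n..0} (\<lambda>_. borel) \<rightarrow>\<^sub>M borel \<Otimes>\<^sub>M ?B"
    unfolding split_def
    by (intro measurable_Pair measurable_component_singleton measurable_restrict_subset) (use n in auto)
  have mu: "(\<lambda>(x, X). X(n := x)) \<in> ?\<nu> \<Otimes>\<^sub>M PiM ?J ?W \<rightarrow>\<^sub>M PiM (insert n ?J) ?W"
    unfolding split_beta by (rule measurable_fun_upd[where J="?J"]) (auto simp: Wn)
  have "distr P (borel \<Otimes>\<^sub>M ?B) (\<lambda>\<eta>. (\<eta> n, noises n \<eta>)) = distr P (borel \<Otimes>\<^sub>M ?B) (split \<circ> encode n)"
    using n by (intro arg_cong[where f="distr _ _"]) (auto simp: fun_eq_iff split_def encode_def noises_def restrict_def)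
  also have "\<dots> = distr (distr P (PiM {n..0} (\<lambda>_. borel)) (encode n)) (borel \<Otimes>\<^sub>M ?B) split"
    by (rule distr_distr[OF ms me, symmetric])
  also have "\<dots> = distr (PiM (insert n ?J) ?W) (borel \<Otimes>\<^sub>M ?B) split"
    unfolding distr_encode[OF P n] by (simp only: ivl)
  also have "\<dots> = distr (distr (?\<nu> \<Otimes>\<^sub>M PiM ?J ?W) (PiM (insert n ?J) ?W) (\<lambda>(x, X). X(n := x))) (borel \<Otimes>\<^sub>M ?B) split"
  proof -
    have "distr (?W n \<Otimes>\<^sub>M PiM ?J ?W) (PiM (insert n ?J) ?W) (\<lambda>(x, X). X(n := x)) = PiM (insert n ?J) ?W"
      by (rule distr_pair_PiM_eq_PiM) (rule prW)+
    then show ?thesis unfolding Wn by (simp only:)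
  qed
  also have "\<dots> = distr (?\<nu> \<Otimes>\<^sub>M PiM ?J ?W) (borel \<Otimes>\<^sub>M ?B) (split \<circ> (\<lambda>(x, X). X(n := x)))"
  proof (rule distr_distr[OF _ mu])
    show "split \<in> PiM (insert n ?J) ?W \<rightarrow>\<^sub>M borel \<Otimes>\<^sub>M ?B"
      using ms unfolding ivl by (simp only: measurable_cong_sets[OF sets_PiM_cong[OF refl sW] refl])
  qed
  also have "\<dots> = distr (?\<nu> \<Otimes>\<^sub>M PiM ?J ?W) (?\<nu> \<Otimes>\<^sub>M PiM ?J ?W) (\<lambda>z. z)"
  proof (rule distr_cong)
    show "sets (borel \<Otimes>\<^sub>M ?B) = sets (?\<nu> \<Otimes>\<^sub>M PiM ?J ?W)"
      by (intro sets_pair_measure_cong sets_PiM_cong refl sW[symmetric]) simp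
    fix z assume "z \<in> space (?\<nu> \<Otimes>\<^sub>M PiM ?J ?W)"
    then have "snd z \<in> extensional ?J" by (auto simp: space_pair_measure space_PiM PiE_iff)
    then have "restrict ((snd z)(n := fst z)) ?J = snd z"
      by (auto simp: fun_eq_iff extensional_def restrict_def)
    then show "(split \<circ> (\<lambda>(x, X). X(n := x))) z = z"
      by (simp add: split_def split_beta)
  qed simp
  finally show ?thesis by (simp only: distr_id WJ)
qed

text \<open>The windows \<open>{k - m<..0}\<close> of noise generate increasing \<open>\<sigma>\<close>-algebras whose union generates
a \<open>\<sigma>\<close>-algebra that contains all the noise up to \<open>k\<close>. They reach up to 0 and not only to \<open>k\<close>, in accordance with
\<open>distr_start_noises\<close>.\<close>

lemma noise_event_approximation:
  assumes P: "P \<in> solutions \<xi> \<mu>" and k: "k \<le> 0" and B: "B \<in> past \<xi> k" and e: "0 < e"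
  shows "\<exists>n\<le>k. \<exists>X\<in>sets (PiM {n<..0} (\<lambda>_. borel)). measure P (sym_diff B (noises n -` X \<inter> space path_space)) < e"
proof -
  interpret P: prob_space P by (rule solution_prob_space[OF P])
  note sp = solution_space[OF P]
  define N where "N m = vimage_algebra (space path_space) (noises (k - int m)) (PiM {k - int m<..0} (\<lambda>_. borel :: 's measure))" for m
  have fsp: "noises n \<in> space path_space \<rightarrow> space (PiM {n<..0} (\<lambda>_. borel :: 's measure))" for n
    using measurable_space[OF noises_measurable] by blast
  have sN: "sets (N m) = {noises (k - int m) -` X \<inter> space path_space | X. X \<in> sets (PiM {k - int m<..0} (\<lambda>_. borel))}" for m
    unfolding N_def by (rule sets_vimage_algebra2[OF fsp])
  have spN: "space (N m) = space P" for m by (simp add: N_def sp)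
  have N1: "sets (N m) \<subseteq> P.events" for m
    unfolding sN solution_sets[OF P] using measurable_sets[OF noises_measurable] by blast
  have N2: "sets (N m) \<subseteq> sets (N (Suc m))" for m
  proof
    fix Y assume "Y \<in> sets (N m)"
    then obtain X where X: "X \<in> sets (PiM {k - int m<..0} (\<lambda>_. borel))" "Y = noises (k - int m) -` X \<inter> space path_space"
      unfolding sN by blast
    let ?n = "k - int m" and ?n' = "k - int (Suc m)"
    let ?X' = "(\<lambda>x. restrict x {?n<..0}) -` X \<inter> space (PiM {?n'<..0} (\<lambda>_. borel :: 's measure))"
    have m: "(\<lambda>x. restrict x {?n<..0}) \<in> PiM {?n'<..0} (\<lambda>_. borel) \<rightarrow>\<^sub>M PiM {?n<..0} (\<lambda>_. borel :: 's measure)"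
      by (intro measurable_restrict_subset) auto
    have X': "?X' \<in> sets (PiM {?n'<..0} (\<lambda>_. borel))" by (rule measurable_sets[OF m X(1)])
    have "restrict (noises ?n' \<eta>) {?n<..0} = noises ?n \<eta>" for \<eta>
      by (auto simp: noises_def fun_eq_iff restrict_def)
    then have "noises ?n' -` ?X' \<inter> space path_space = Y"
      using fsp[of ?n'] unfolding X(2) by auto
    with X' show "Y \<in> sets (N (Suc m))" unfolding sN by blast
  qed
  have "B \<in> sigma_sets (space P) (\<Union>m. sets (N m))"
  proof -
    have "past \<xi> k \<subseteq> sigma_sets (space P) (\<Union>m. sets (N m))"
      unfolding past_def sp
    proof (rule sigma_sets_mono, rule subsetI)
      fix Y assume "Y \<in> {\<xi> j -` A \<inter> space path_space |j A. j \<le> k \<and> A \<in> sets borel}"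
      then obtain j A where Y: "Y = \<xi> j -` A \<inter> space path_space" and j: "j \<le> k" and A: "A \<in> sets borel" by blast
      define m where "m = Suc (nat (k - j))"
      have m: "k - int m < j" using j by (simp add: m_def)
      have jin: "j \<in> {k - int m<..0}" using m j k by simp
      let ?X = "(\<lambda>x. x j) -` A \<inter> space (PiM {k - int m<..0} (\<lambda>_. borel :: 's measure))"
      have X: "?X \<in> sets (PiM {k - int m<..0} (\<lambda>_. borel))"
        by (rule measurable_sets[OF measurable_component_singleton[OF jin] A])
      have "noises (k - int m) -` ?X \<inter> space path_space = Y"
        using fsp[of "k - int m"] jin unfolding Y by (auto simp: noises_def)
      with X have "Y \<in> sets (N m)" unfolding sN by blast
      then show "Y \<in> sigma_sets (space path_space) (\<Union>m. sets (N m))" by (intro sigma_sets.Basic) blast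
    qed
    with B show ?thesis by blast
  qed
  from P.sigma_sets_approximated_in_measure[OF N1 spN N2 this e]
  obtain m E where "E \<in> sets (N m)" "P.prob (sym_diff B E) < e" by blast
  then obtain X where "X \<in> sets (PiM {k - int m<..0} (\<lambda>_. borel))"
    "P.prob (sym_diff B (noises (k - int m) -` X \<inter> space path_space)) < e"
    unfolding sN by blast
  moreover have "k - int m \<le> k" by simp
  ultimately show ?thesis by blast
qed

text \<open>The measure of the symmetric difference is by Fubini's theorem a mean over \<open>\<eta> n\<close>, which is independent
of the noise after \<open>n\<close>. Some value \<open>y\<close> of \<open>\<eta> n\<close> does not exceed the mean; \<open>g = \<theta> y\<close>.\<close>

lemma freeze_start:
  assumes P: "P \<in> solutions \<xi> \<mu>" and C: "C \<in> sets borel" and X: "X \<in> sets (PiM {n<..0} (\<lambda>_. borel))"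
    and nk: "n + int m \<le> 0"
    and small: "measure P (sym_diff {\<eta> \<in> space path_space. \<theta> (\<eta> (n + int m)) \<in> C} (noises n -` X \<inter> space path_space)) < e"
  shows "\<exists>g. measure P (sym_diff {\<eta> \<in> space path_space. g + noise_sum n (\<lambda>i. \<theta> (\<xi> i \<eta>)) m \<in> C}
    (noises n -` X \<inter> space path_space)) < e"
proof -
  have n: "n \<le> 0" using nk by simp
  have e: "0 < e" using small measure_nonneg le_less_trans by blast
  interpret P: prob_space P by (rule solution_prob_space[OF P])
  note sp = solution_space[OF P]
  let ?B = "PiM {n<..0} (\<lambda>_. borel) :: (int \<Rightarrow> 's) measure"
  let ?\<nu> = "distr P borel (\<lambda>\<eta>. \<eta> n)" and ?M = "PiM {n<..0} \<mu>"
  have mn: "(\<lambda>\<eta>. \<eta> n) \<in> P \<rightarrow>\<^sub>M borel"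
    unfolding measurable_from_solution[OF P] using n by (rule coord_measurable)
  have mN: "noises n \<in> P \<rightarrow>\<^sub>M ?B"
    unfolding measurable_from_solution[OF P] by (rule noises_measurable)
  interpret \<nu>: prob_space ?\<nu> using mn by (rule P.prob_space_distr)
  interpret M: prob_space ?M by (rule prob_space_PiM) (simp add: prob_space_\<mu>)
  have sM: "sets ?M = sets ?B" by (rule sets_PiM_cong) (simp_all add: sets_\<mu>)
  have spB: "space ?M = space ?B" using sM by (rule sets_eq_imp_space_eq)
  have sP: "sets (?\<nu> \<Otimes>\<^sub>M ?M) = sets (borel \<Otimes>\<^sub>M ?B)" by (intro sets_pair_measure_cong sM) simp
  define \<phi> where "\<phi> g x = g + noise_sum n (\<lambda>i. \<theta> (x i)) m" for g and x :: "int \<Rightarrow> 's"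
  define S where "S = {z \<in> space (borel \<Otimes>\<^sub>M ?B). (\<phi> (\<theta> (fst z)) (snd z) \<in> C) \<noteq> (snd z \<in> X)}"
  have msum: "(\<lambda>x. noise_sum n (\<lambda>i. \<theta> (x i)) m) \<in> ?B \<rightarrow>\<^sub>M borel"
  proof (rule noise_sum_measurable)
    fix i assume "n < i" "i \<le> n + int m"
    then have "i \<in> {n<..0}" using nk by simp
    then have "(\<lambda>x. x i) \<in> ?B \<rightarrow>\<^sub>M borel" by (rule measurable_component_singleton)
    then show "(\<lambda>x. \<theta> (x i)) \<in> ?B \<rightarrow>\<^sub>M borel" by (rule measurable_compose[OF _ \<theta>_measurable])
  qed
  have m\<phi>: "(\<lambda>z. \<phi> (\<theta> (fst z)) (snd z)) \<in> borel \<Otimes>\<^sub>M ?B \<rightarrow>\<^sub>M borel"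
    unfolding \<phi>_def
    by (intro measurable_add measurable_compose[OF measurable_fst \<theta>_measurable] measurable_compose[OF measurable_snd msum])
  have S: "S \<in> sets (borel \<Otimes>\<^sub>M ?B)"
  proof -
    have "S = sym_diff ((\<lambda>z. \<phi> (\<theta> (fst z)) (snd z)) -` C \<inter> space (borel \<Otimes>\<^sub>M ?B)) (snd -` X \<inter> space (borel \<Otimes>\<^sub>M ?B))"
      unfolding S_def by blast
    moreover have "snd -` X \<inter> space (borel \<Otimes>\<^sub>M ?B) \<in> sets (borel \<Otimes>\<^sub>M ?B)"
      by (rule measurable_sets[OF measurable_snd X])
    ultimately show ?thesis
      using measurable_sets[OF m\<phi> C] by (simp only:) (intro sets.Un sets.Diff)
  qed
  have noise_val: "noise_sum n (\<lambda>i. \<theta> (noises n \<eta> i)) m = noise_sum n (\<lambda>i. \<theta> (\<xi> i \<eta>)) m" for \<eta>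
    using nk by (intro noise_sum_cong) (simp add: noises_def)
  have mp: "(\<lambda>\<eta>. (\<eta> n, noises n \<eta>)) \<in> P \<rightarrow>\<^sub>M borel \<Otimes>\<^sub>M ?B" by (rule measurable_Pair[OF mn mN])
  note L = distr_start_noises[OF P n]
  have E: "emeasure (?\<nu> \<Otimes>\<^sub>M ?M) T = emeasure P ((\<lambda>\<eta>. (\<eta> n, noises n \<eta>)) -` T \<inter> space P)"
    if "T \<in> sets (borel \<Otimes>\<^sub>M ?B)" for T
    unfolding L[symmetric] by (rule emeasure_distr[OF mp that])
  have marg: "emeasure ?M T = emeasure P (noises n -` T \<inter> space P)" if T: "T \<in> sets ?B" for T
  proof -
    have "emeasure ?M T = emeasure (?\<nu> \<Otimes>\<^sub>M ?M) (UNIV \<times> T)"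
      using T M.emeasure_pair_measure_Times[of UNIV ?\<nu> T] \<nu>.emeasure_space_1 by (simp add: sM)
    also have "\<dots> = emeasure P ((\<lambda>\<eta>. (\<eta> n, noises n \<eta>)) -` (UNIV \<times> T) \<inter> space P)"
      using T by (intro E pair_measureI) auto
    also have "(\<lambda>\<eta>. (\<eta> n, noises n \<eta>)) -` (UNIV \<times> T) \<inter> space P = noises n -` T \<inter> space P" by auto
    finally show ?thesis .
  qed
  have preS: "(\<lambda>\<eta>. (\<eta> n, noises n \<eta>)) -` S \<inter> space P
      = sym_diff {\<eta> \<in> space path_space. \<theta> (\<eta> (n + int m)) \<in> C} (noises n -` X \<inter> space path_space)"
    using measurable_space[OF mN]
    by (auto simp: S_def \<phi>_def noise_val theta_eq_noise_sum sp space_pair_measure)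
  have sec: "Pair y -` S \<in> sets ?B" for y using sets_Pair1[OF S] .
  have preSec: "noises n -` (Pair y -` S) \<inter> space P
      = sym_diff {\<eta> \<in> space path_space. \<theta> y + noise_sum n (\<lambda>i. \<theta> (\<xi> i \<eta>)) m \<in> C} (noises n -` X \<inter> space path_space)" for y
    using measurable_space[OF mN]
    by (auto simp: S_def \<phi>_def noise_val sp space_pair_measure)
  have "emeasure (?\<nu> \<Otimes>\<^sub>M ?M) S < ennreal e"
    unfolding E[OF S] preS P.emeasure_eq_measure using small by (intro ennreal_lessI e)
  moreover have "emeasure (?\<nu> \<Otimes>\<^sub>M ?M) S = (\<integral>\<^sup>+y. emeasure ?M (Pair y -` S) \<partial>?\<nu>)"
    using S by (intro M.emeasure_pair_measure_alt) (simp only: sP)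
  ultimately have less: "(\<integral>\<^sup>+y. emeasure ?M (Pair y -` S) \<partial>?\<nu>) < ennreal e" by simp
  have "\<exists>y. emeasure ?M (Pair y -` S) < ennreal e"
  proof (rule ccontr)
    assume "\<nexists>y. emeasure ?M (Pair y -` S) < ennreal e"
    then have "ennreal e \<le> emeasure ?M (Pair y -` S)" for y by (meson not_le)
    then have "(\<integral>\<^sup>+y. ennreal e \<partial>?\<nu>) \<le> (\<integral>\<^sup>+y. emeasure ?M (Pair y -` S) \<partial>?\<nu>)"
      by (rule nn_integral_mono)
    moreover have "(\<integral>\<^sup>+y. ennreal e \<partial>?\<nu>) = ennreal e" using \<nu>.emeasure_space_1 by simp
    ultimately show False using less by (simp add: not_le[symmetric])
  qed
  then obtain y where "emeasure ?M (Pair y -` S) < ennreal e" by blast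
  then have "P.prob (noises n -` (Pair y -` S) \<inter> space P) < e"
    unfolding marg[OF sec] P.emeasure_eq_measure by (simp add: ennreal_less_iff)
  then show ?thesis unfolding preSec by blast
qed

end

context tsirelson_yor_pair
begin

lemma group_noise_past: "k \<le> 0 \<Longrightarrow> group_path \<in> past_algebra \<xi> k \<rightarrow>\<^sub>M past_algebra G.\<xi> k"
proof (rule measurable_into_past_algebra)
  show "group_path \<in> space (past_algebra \<xi> k) \<rightarrow> space path_space"
    using space_group_path by blast
  fix j assume k: "k \<le> 0" and j: "j \<le> k"
  then have "(\<lambda>\<eta>. G.\<xi> j (group_path \<eta>)) = (\<lambda>\<eta>. \<theta> (\<xi> j \<eta>))" by (simp add: group_noise)
  moreover have "(\<lambda>\<eta>. \<theta> (\<xi> j \<eta>)) \<in> past_algebra \<xi> k \<rightarrow>\<^sub>M borel"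
    by (rule measurable_compose[OF measurable_past_algebra[OF j] \<theta>_measurable])
  ultimately show "(\<lambda>\<eta>. G.\<xi> j (group_path \<eta>)) \<in> past_algebra \<xi> k \<rightarrow>\<^sub>M borel" by (simp only:)
qed

lemma group_null_sets_iff:
  assumes P: "P \<in> solutions \<xi> \<mu>" and N: "N \<in> sets path_space"
  shows "N \<in> null_sets (theta_law \<theta> P) \<longleftrightarrow> group_path -` N \<inter> space path_space \<in> null_sets P"
proof -
  have m: "group_path \<in> P \<rightarrow>\<^sub>M path_space"
    unfolding measurable_from_solution[OF P] by (rule group_path_measurable)
  show ?thesis
    unfolding theta_law_eq null_sets_distr_iff[OF m] solution_space[OF P] using N by simp
qed

lemma coordinate_event:
  fixes C :: "'x::topological_space set"
  shows "k \<le> 0 \<Longrightarrow> C \<in> sets borel \<Longrightarrow> {\<zeta> \<in> space path_space. \<zeta> k \<in> C} \<in> sets path_space"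
  using measurable_sets[OF coord_measurable, of k C] by (simp add: vimage_def Int_def conj_commute)

text \<open>\<open>\<eta> k\<close> is the image under \<open>\<psi>\<close> of \<open>T \<eta> = (\<theta> (\<eta> (k - 1)), \<xi> k \<eta>)\<close>, whose first component can be
recovered from the noise of the simple equation. As \<open>\<psi>\<close> is only measurable, this is first shown for
rectangles and then for the \<open>\<sigma>\<close>-algebra that they generate.\<close>

lemma strong_if_group_strong:
  assumes P: "P \<in> solutions \<xi> \<mu>" and strong: "strong G.\<xi> (theta_law \<theta> P)"
  shows "strong \<xi> P"
proof -
  note R = theta_law_solution[OF P]
  have iffG: "strong G.\<xi> (theta_law \<theta> P) \<longleftrightarrow> (\<forall>k\<le>0. \<forall>C\<in>sets borel. \<exists>B\<in>past G.\<xi> k.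
      sym_diff {\<zeta> \<in> space path_space. \<zeta> k \<in> C} B \<in> null_sets (theta_law \<theta> P))"
    by (rule strong_iff[OF G.solution_prob_space[OF R] G.solution_sets[OF R]]) (rule G.\<xi>_measurable)
  have iffS: "strong \<xi> P \<longleftrightarrow> (\<forall>k\<le>0. \<forall>C\<in>sets borel. \<exists>B\<in>past \<xi> k.
      sym_diff {\<eta> \<in> space path_space. \<eta> k \<in> C} B \<in> null_sets P)"
    by (rule strong_iff[OF solution_prob_space[OF P] solution_sets[OF P]]) (rule \<xi>_measurable)
  have strong': "\<exists>B\<in>past G.\<xi> k. sym_diff {\<zeta> \<in> space path_space. \<zeta> k \<in> C} B \<in> null_sets (theta_law \<theta> P)"
    if "k \<le> 0" "C \<in> sets borel" for k C
    using strong[unfolded iffG, rule_format, OF that] .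
  note sp = solution_space[OF P]
  show ?thesis
    unfolding iffS
  proof (intro allI impI ballI)
    fix k :: int and C :: "'s set" assume k: "k \<le> 0" and C: "C \<in> sets borel"
    define T where "T \<eta> = (\<theta> (\<eta> (k - 1)), \<xi> k \<eta>)" for \<eta>
    let ?gen = "{T -` E \<inter> space P | E. E \<in> {a \<times> b |a b. a \<in> sets (borel :: 'g measure) \<and> b \<in> sets (borel :: 's measure)}}"
    have sub: "past \<xi> k \<subseteq> sets P"
      unfolding solution_sets[OF P] using k by (intro past_subset_path_space \<xi>_measurable) simp
    have "case_prod \<psi> -` C \<inter> space (borel \<Otimes>\<^sub>M borel) \<in> sets (borel \<Otimes>\<^sub>M borel)"
      by (rule measurable_sets[OF \<psi>_measurable C])
    then have "case_prod \<psi> -` C \<in> sigma_sets UNIV {a \<times> b |a b. a \<in> sets (borel :: 'g measure) \<and> b \<in> sets (borel :: 's measure)}"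
      by (simp add: sets_pair_measure space_pair_measure)
    moreover have "{T -` E \<inter> space P | E. E \<in> sigma_sets UNIV {a \<times> b |a b. a \<in> sets (borel :: 'g measure) \<and> b \<in> sets (borel :: 's measure)}}
        = sigma_sets (space P) ?gen"
      by (rule sigma_sets_vimage_commute) simp
    ultimately have "T -` (case_prod \<psi> -` C) \<inter> space P \<in> sigma_sets (space P) ?gen" by blast
    moreover have "T -` (case_prod \<psi> -` C) \<inter> space P = {\<eta> \<in> space path_space. \<eta> k \<in> C}"
      using tye[of _ k] by (auto simp: T_def sp)
    ultimately have mem: "{\<eta> \<in> space path_space. \<eta> k \<in> C} \<in> sigma_sets (space P) ?gen" by simp
    have "{\<eta> \<in> space path_space. \<eta> k \<in> C} \<in> sets P \<and>
        (\<exists>B\<in>sets (past_algebra \<xi> k). sym_diff {\<eta> \<in> space path_space. \<eta> k \<in> C} B \<in> null_sets P)"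
    proof (rule sigma_sets_approximated_modulo_null[OF _ _ _ mem])
      show "sets (past_algebra \<xi> k) \<subseteq> sets P" using sub by (simp only: sets_past_algebra)
      show "space (past_algebra \<xi> k) = space P" by (simp add: sp)
      fix A assume "A \<in> ?gen"
      then obtain a b where ab: "a \<in> sets borel" "b \<in> sets borel" and A: "A = T -` (a \<times> b) \<inter> space P" by blast
      have k': "k - 1 \<le> 0" using k by simp
      obtain B where B: "B \<in> past G.\<xi> (k - 1)"
        and null: "sym_diff {\<zeta> \<in> space path_space. \<zeta> (k - 1) \<in> a} B \<in> null_sets (theta_law \<theta> P)"
        using strong'[OF k' ab(1)] by blast
      have Bp: "B \<in> sets path_space"
        using B past_subset_path_space[of "k - 1" G.\<xi>] G.\<xi>_measurable k' by (meson order_trans subsetD)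
      define B1 where "B1 = group_path -` B \<inter> space path_space"
      define b1 where "b1 = \<xi> k -` b \<inter> space path_space"
      have "B1 \<in> past \<xi> (k - 1)"
        using measurable_sets[OF group_noise_past[OF k'], of B] B by (simp add: sets_past_algebra B1_def)
      then have B1: "B1 \<in> past \<xi> k" using past_mono[of "k - 1" k \<xi>] by auto
      have b1: "b1 \<in> past \<xi> k" unfolding b1_def past_def using ab(2) by (intro sigma_sets.Basic) blast
      have "B1 \<inter> b1 \<in> sets (past_algebra \<xi> k)" using B1 b1 by (simp add: sets_past_algebra[symmetric])
      moreover have "sym_diff A (B1 \<inter> b1) \<in> null_sets P"
      proof (rule null_sets_subset)
        have "sym_diff {\<zeta> \<in> space path_space. \<zeta> (k - 1) \<in> a} B \<in> sets path_space"
          using coordinate_event[OF k' ab(1)] Bp by blast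
        from group_null_sets_iff[OF P this] null
        show "group_path -` sym_diff {\<zeta> \<in> space path_space. \<zeta> (k - 1) \<in> a} B \<inter> space path_space \<in> null_sets P"
          by blast
        have T: "T \<in> P \<rightarrow>\<^sub>M borel \<Otimes>\<^sub>M borel"
          unfolding measurable_from_solution[OF P] T_def[abs_def] using k
          by (intro measurable_Pair \<xi>_measurable measurable_compose[OF coord_measurable \<theta>_measurable]) auto
        have "A \<in> sets P" unfolding A using ab by (intro measurable_sets[OF T] pair_measureI) auto
        moreover have "B1 \<inter> b1 \<in> sets P" using B1 b1 sub by blast
        ultimately show "sym_diff A (B1 \<inter> b1) \<in> sets P" by blast
        show "sym_diff A (B1 \<inter> b1) \<subseteq> group_path -` sym_diff {\<zeta> \<in> space path_space. \<zeta> (k - 1) \<in> a} B \<inter> space path_space"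
          using k' space_group_path by (auto simp: A T_def B1_def b1_def sp group_path_def)
      qed
      moreover have "A \<in> sets P"
      proof -
        have T: "T \<in> P \<rightarrow>\<^sub>M borel \<Otimes>\<^sub>M borel"
          unfolding measurable_from_solution[OF P] T_def[abs_def] using k
          by (intro measurable_Pair \<xi>_measurable measurable_compose[OF coord_measurable \<theta>_measurable]) auto
        show ?thesis unfolding A using ab by (intro measurable_sets[OF T] pair_measureI) auto
      qed
      ultimately show "A \<in> sets P \<and> (\<exists>B\<in>sets (past_algebra \<xi> k). sym_diff A B \<in> null_sets P)" by blast
    qed
    then show "\<exists>B\<in>past \<xi> k. sym_diff {\<eta> \<in> space path_space. \<eta> k \<in> C} B \<in> null_sets P"
      by (simp add: sets_past_algebra)
  qed
qed

text \<open>The event \<open>A = {\<theta> (\<eta> k) \<in> C}\<close> agrees with an event of the noise, hence is close to an event \<open>E\<close> of a finite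
window of noise. By \<open>freeze_start\<close> the event \<open>E\<close>, and thus \<open>A\<close>, is close to one of the noise of the
simple equation.\<close>

lemma group_strong_if_strong:
  assumes P: "P \<in> solutions \<xi> \<mu>" and strong: "strong \<xi> P"
  shows "strong G.\<xi> (theta_law \<theta> P)"
proof -
  interpret P: prob_space P by (rule solution_prob_space[OF P])
  note R = theta_law_solution[OF P]
  have iffG: "strong G.\<xi> (theta_law \<theta> P) \<longleftrightarrow> (\<forall>k\<le>0. \<forall>C\<in>sets borel. \<exists>B\<in>past G.\<xi> k.
      sym_diff {\<zeta> \<in> space path_space. \<zeta> k \<in> C} B \<in> null_sets (theta_law \<theta> P))"
    by (rule strong_iff[OF G.solution_prob_space[OF R] G.solution_sets[OF R]]) (rule G.\<xi>_measurable)
  have iffS: "strong \<xi> P \<longleftrightarrow> (\<forall>k\<le>0. \<forall>C\<in>sets borel. \<exists>B\<in>past \<xi> k.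
      sym_diff {\<eta> \<in> space path_space. \<eta> k \<in> C} B \<in> null_sets P)"
    by (rule strong_iff[OF solution_prob_space[OF P] solution_sets[OF P]]) (rule \<xi>_measurable)
  have strong': "\<exists>B\<in>past \<xi> k. sym_diff {\<eta> \<in> space path_space. \<eta> k \<in> C} B \<in> null_sets P"
    if "k \<le> 0" "C \<in> sets borel" for k C
    using strong[unfolded iffS, rule_format, OF that] .
  note sp = solution_space[OF P]
  show ?thesis
    unfolding iffG
  proof (intro allI impI ballI)
    fix k :: int and C :: "'g set" assume k: "k \<le> 0" and C: "C \<in> sets borel"
    define A where "A = {\<eta> \<in> space path_space. \<theta> (\<eta> k) \<in> C}"
    have C': "\<theta> -` C \<in> sets borel" using measurable_sets[OF \<theta>_measurable C] by simp
    have AP: "A \<in> sets P"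
      unfolding A_def solution_sets[OF P] using coordinate_event[OF k C'] by simp
    obtain B where B: "B \<in> past \<xi> k" and null: "sym_diff A B \<in> null_sets P"
      using strong'[OF k C'] unfolding A_def by auto
    have BP: "B \<in> sets P"
      using B past_subset_path_space[of k \<xi>] \<xi>_measurable k unfolding solution_sets[OF P] by (meson order_trans subsetD)
    define N where "N = vimage_algebra (space path_space) group_path (past_algebra G.\<xi> k)"
    have gsp: "group_path \<in> space path_space \<rightarrow> space (past_algebra G.\<xi> k)" using space_group_path by simp
    have sN: "sets N = {group_path -` X \<inter> space path_space | X. X \<in> past G.\<xi> k}"
      unfolding N_def sets_vimage_algebra2[OF gsp] sets_past_algebra ..
    have pastG: "past G.\<xi> k \<subseteq> sets path_space"
      using k by (intro past_subset_path_space G.\<xi>_measurable) simp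
    have NP: "sets N \<subseteq> P.events"
      unfolding sN solution_sets[OF P] using measurable_sets[OF group_path_measurable] pastG by blast
    have "\<exists>B\<in>sets N. sym_diff A B \<in> null_sets P"
    proof (rule P.approximated_imp_modulo_null[OF NP AP])
      fix e :: real assume "0 < e"
      then have e: "0 < e / 2" by simp
      obtain n X where n: "n \<le> k" and X: "X \<in> sets (PiM {n<..0} (\<lambda>_. borel))"
        and BX: "P.prob (sym_diff B (noises n -` X \<inter> space path_space)) < e / 2"
        using noise_event_approximation[OF P k B e] by blast
      define m where "m = nat (k - n)"
      have nm: "n + int m = k" using n by (simp add: m_def)
      define E where "E = noises n -` X \<inter> space path_space"
      have EP: "E \<in> sets P"
        unfolding E_def solution_sets[OF P] by (rule measurable_sets[OF noises_measurable X])
      have AE': "P.prob (sym_diff A E) < e / 2"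
      proof -
        have "P.prob (sym_diff A E) \<le> P.prob (sym_diff A B \<union> sym_diff B E)"
          using AP BP EP by (intro P.finite_measure_mono) auto
        also have "\<dots> \<le> P.prob (sym_diff A B) + P.prob (sym_diff B E)"
          using AP BP EP by (intro measure_Un_le) auto
        also have "P.prob (sym_diff A B) = 0" using null by (rule measure_eq_0_null_sets)
        finally show ?thesis using BX by (simp add: E_def)
      qed
      then obtain g where g: "P.prob (sym_diff {\<eta> \<in> space path_space. g + noise_sum n (\<lambda>i. \<theta> (\<xi> i \<eta>)) m \<in> C} E) < e / 2"
        using freeze_start[OF P C X, of m "e / 2"] k unfolding nm A_def E_def by blast
      define Y where "Y = {\<zeta> \<in> space path_space. g + noise_sum n (\<lambda>i. G.\<xi> i \<zeta>) m \<in> C}"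
      have "(\<lambda>\<zeta>. g + noise_sum n (\<lambda>i. G.\<xi> i \<zeta>) m) \<in> past_algebra G.\<xi> k \<rightarrow>\<^sub>M borel"
        by (intro measurable_add measurable_const noise_sum_measurable measurable_past_algebra) (auto simp: nm)
      from measurable_sets[OF this C] have Y: "Y \<in> past G.\<xi> k"
        by (simp add: Y_def sets_past_algebra vimage_def Int_def conj_commute)
      have "noise_sum n (\<lambda>i. G.\<xi> i (group_path \<eta>)) m = noise_sum n (\<lambda>i. \<theta> (\<xi> i \<eta>)) m" for \<eta>
        using k nm by (intro noise_sum_cong group_noise) simp
      then have preY: "group_path -` Y \<inter> space path_space
          = {\<eta> \<in> space path_space. g + noise_sum n (\<lambda>i. \<theta> (\<xi> i \<eta>)) m \<in> C}" (is "?Y = _")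
        using space_group_path by (auto simp: Y_def)
      have YN: "?Y \<in> sets N" unfolding sN using Y by blast
      then have YP: "?Y \<in> sets P" using NP by blast
      have "P.prob (sym_diff A ?Y) \<le> P.prob (sym_diff A E \<union> sym_diff ?Y E)"
        using AP YP EP by (intro P.finite_measure_mono) auto
      also have "\<dots> \<le> P.prob (sym_diff A E) + P.prob (sym_diff ?Y E)"
        using AP YP EP by (intro measure_Un_le) auto
      also have "\<dots> \<le> e" using AE' g unfolding preY by simp
      finally show "\<exists>B\<in>sets N. P.prob (sym_diff A B) \<le> e" using YN by blast
    qed
    then obtain X where X: "X \<in> past G.\<xi> k" and null: "sym_diff A (group_path -` X \<inter> space path_space) \<in> null_sets P"
      unfolding sN by blast
    have "group_path -` sym_diff {\<zeta> \<in> space path_space. \<zeta> k \<in> C} X \<inter> space path_space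
        = sym_diff A (group_path -` X \<inter> space path_space)"
      using k space_group_path by (auto simp: A_def group_path_def)
    moreover have "sym_diff {\<zeta> \<in> space path_space. \<zeta> k \<in> C} X \<in> sets path_space"
      using coordinate_event[OF k C] X pastG by blast
    ultimately have "sym_diff {\<zeta> \<in> space path_space. \<zeta> k \<in> C} X \<in> null_sets (theta_law \<theta> P)"
      using group_null_sets_iff[OF P] null by simp
    with X show "\<exists>B\<in>past G.\<xi> k. sym_diff {\<zeta> \<in> space path_space. \<zeta> k \<in> C} B \<in> null_sets (theta_law \<theta> P)"
      by blast
  qed
qed

end

lemma bij_betw_unique_iff:
  assumes "bij_betw f K K'"
  shows "(\<exists>!x. x \<in> K) \<longleftrightarrow> (\<exists>!y. y \<in> K')"
proof -
  have K': "K' = f ` K" and inj: "inj_on f K" using assms by (auto simp: bij_betw_def)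
  show ?thesis
  proof
    assume "\<exists>!x. x \<in> K"
    then obtain x where "K = {x}" by blast
    then show "\<exists>!y. y \<in> K'" unfolding K' by simp
  next
    assume "\<exists>!y. y \<in> K'"
    then obtain y where y: "f ` K = {y}" unfolding K' by blast
    then obtain x where x: "x \<in> K" by blast
    have "x' = x" if "x' \<in> K" for x'
      using inj that x y by (metis imageI inj_onD singletonD)
    with x show "\<exists>!x. x \<in> K" by blast
  qed
qed

section \<open>The correspondence\<close>

theorem proposition8p6:
  fixes \<theta> :: "'s::polish_space \<Rightarrow> 'g::{topological_group_add, t2_space}"
    and \<psi> \<psi>inv :: "'g \<Rightarrow> 's \<Rightarrow> 's"
    and \<mu> :: "int \<Rightarrow> 's measure"
  assumes "compact (UNIV :: 'g set)"
    and "(UNIV :: 'g set) \<noteq> {0}"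
    and "\<theta> \<in> borel \<rightarrow>\<^sub>M borel"
    and "case_prod \<psi> \<in> borel \<Otimes>\<^sub>M borel \<rightarrow>\<^sub>M borel"
    and "case_prod \<psi>inv \<in> borel \<Otimes>\<^sub>M borel \<rightarrow>\<^sub>M borel"
    and "\<And>g s. \<psi>inv g (\<psi> g s) = s"
    and "\<And>g s. \<psi> g (\<psi>inv g s) = s"
    and "\<And>g s. \<theta> (\<psi> g s) = g + \<theta> s"
    and "\<And>k. k \<le> 0 \<Longrightarrow> \<mu> k \<in> space (prob_algebra borel)"
  defines "\<xi> \<equiv> tye_noise \<theta> \<psi>inv"
    and "\<xi>h \<equiv> (stye_noise :: int \<Rightarrow> (int \<Rightarrow> 'g) \<Rightarrow> 'g)"
    and "\<mu>h \<equiv> (\<lambda>k. distr (\<mu> k) borel \<theta>)"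
  shows "bij_betw (theta_law \<theta>) (solutions \<xi> \<mu>) (solutions \<xi>h \<mu>h)
    \<and> (\<forall>P \<in> solutions \<xi> \<mu>. strong \<xi> P \<longleftrightarrow> strong \<xi>h (theta_law \<theta> P))
    \<and> (\<forall>P \<in> solutions \<xi> \<mu>. P \<in> extremal_points (solutions \<xi> \<mu>)
          \<longleftrightarrow> theta_law \<theta> P \<in> extremal_points (solutions \<xi>h \<mu>h))
    \<and> (group_action group_of_type (solutions \<xi> \<mu>)
          (\<lambda>g. restrict (translate \<theta> \<psi> \<psi>inv g) (solutions \<xi> \<mu>))
       \<and> transitive_action group_of_type (extremal_points (solutions \<xi> \<mu>))
          (\<lambda>g. restrict (translate \<theta> \<psi> \<psi>inv g) (extremal_points (solutions \<xi> \<mu>))))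
    \<and> (case_C1 \<xi> \<mu> \<longleftrightarrow> case_C1 \<xi>h \<mu>h)
    \<and> (case_C2 \<xi> \<mu> \<longleftrightarrow> case_C2 \<xi>h \<mu>h)
    \<and> (case_C3 \<xi> \<mu> \<longleftrightarrow> case_C3 \<xi>h \<mu>h)"
proof -
  have action: "(\<lambda>(g, s). g + \<theta> s) \<in> borel \<Otimes>\<^sub>M borel \<rightarrow>\<^sub>M borel"
  proof -
    have "(\<lambda>(g, s). g + \<theta> s) = \<theta> \<circ> case_prod \<psi>" using assms(8) by auto
    then show ?thesis using measurable_comp[OF assms(4,3)] by simp
  qed
  have "surj \<theta>"
  proof (rule surjI)
    fix g
    show "\<theta> (\<psi> (g + - \<theta> undefined) undefined) = g"
      unfolding assms(8) by (simp add: add.assoc)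
  qed
  then have base: "has_countable_base TYPE('g)"
    by (rule countable_base_if_action_measurable[OF assms(1) action])
  have ty: "tsirelson_yor \<theta> \<psi> \<psi>inv \<mu>"
    by (rule tsirelson_yor.intro) (fact assms add_measurable_if_countable_base[OF base])+
  interpret T: tsirelson_yor_pair \<theta> \<psi> \<psi>inv \<mu> by (rule tsirelson_yor_pair.intro[OF ty])
  have \<xi>h_eq: "\<xi>h = tye_noise (\<lambda>x. x) (\<lambda>g h. - g + h)" unfolding \<xi>h_def by (rule stye_noise_eq)
  let ?K = "solutions \<xi> \<mu>" and ?K' = "solutions \<xi>h \<mu>h"
  have i: "bij_betw (theta_law \<theta>) ?K ?K'"
    unfolding \<xi>_def \<xi>h_def \<mu>h_def by (rule bij_betw_theta_law[OF ty])
  have ii: "strong \<xi> P \<longleftrightarrow> strong \<xi>h (theta_law \<theta> P)" if "P \<in> ?K" for P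
  proof
    have P: "P \<in> solutions (tye_noise \<theta> \<psi>inv) \<mu>" using that by (simp only: \<xi>_def)
    show "strong \<xi> P \<Longrightarrow> strong \<xi>h (theta_law \<theta> P)"
      unfolding \<xi>_def \<xi>h_eq by (rule T.group_strong_if_strong[OF P])
    show "strong \<xi>h (theta_law \<theta> P) \<Longrightarrow> strong \<xi> P"
      unfolding \<xi>_def \<xi>h_eq by (rule T.strong_if_group_strong[OF P])
  qed
  have iii: "theta_law \<theta> P \<in> extremal_points ?K' \<longleftrightarrow> P \<in> extremal_points ?K" if "P \<in> ?K" for P
    by (rule extremal_points_bij_betw[OF i _ that]) (rule T.theta_law_mixes_iff[folded \<xi>_def])
  have act: "translate \<theta> \<psi> \<psi>inv g P \<in> ?K"
    "translate \<theta> \<psi> \<psi>inv g (translate \<theta> \<psi> \<psi>inv h P) = translate \<theta> \<psi> \<psi>inv (g + h) P"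
    "translate \<theta> \<psi> \<psi>inv 0 P = P" if "P \<in> ?K" for P g h
    using that T.translate_solution T.translate_add T.translate_zero unfolding \<xi>_def by blast+
  have iv: "group_action group_of_type ?K (\<lambda>g. restrict (translate \<theta> \<psi> \<psi>inv g) ?K)"
    by (rule group_action_of_typeI) (rule act; assumption)+
  have ex_sub: "P \<in> ?K" if "P \<in> extremal_points ?K" for P using that by (simp add: extremal_points_iff)
  have ex_act: "translate \<theta> \<psi> \<psi>inv g P \<in> extremal_points ?K" if "P \<in> extremal_points ?K" for P g
    using T.extremal_translate[folded \<xi>_def, OF ex_sub[OF that]] that by simp
  have iv': "transitive_action group_of_type (extremal_points ?K)
      (\<lambda>g. restrict (translate \<theta> \<psi> \<psi>inv g) (extremal_points ?K))"
  proof (intro transitive_action.intro transitive_action_axioms.intro)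
    show "group_action group_of_type (extremal_points ?K) (\<lambda>g. restrict (translate \<theta> \<psi> \<psi>inv g) (extremal_points ?K))"
      by (rule group_action_of_typeI) (auto intro: ex_act act ex_sub)
    fix P Q assume P: "P \<in> extremal_points ?K" and Q: "Q \<in> extremal_points ?K"
    obtain g where "translate \<theta> \<psi> \<psi>inv g P = Q"
      using T.extremal_transitive[folded \<xi>_def, OF assms(1) measure_eq_if_continuous_integral_eq[OF assms(1) base] P Q]
      by blast
    with P show "\<exists>g\<in>carrier group_of_type. restrict (translate \<theta> \<psi> \<psi>inv g) (extremal_points ?K) P = Q"
      by (intro bexI[of _ g]) (auto simp: group_of_type_def)
  qed
  have unique: "unique_in_law \<xi> \<mu> \<longleftrightarrow> unique_in_law \<xi>h \<mu>h"
    unfolding unique_in_law_def by (rule bij_betw_unique_iff[OF i])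
  have exists: "strong_solution_exists \<xi> \<mu> \<longleftrightarrow> strong_solution_exists \<xi>h \<mu>h"
  proof -
    have "?K' = theta_law \<theta> ` ?K" using i by (simp add: bij_betw_def)
    then show ?thesis unfolding strong_solution_exists_def using ii by simp
  qed
  show ?thesis
    unfolding case_C1_def case_C2_def case_C3_def unique exists
    using i ii iii iv iv' by simp
qed

end
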